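(* Let $\{(N_k,B_k)\}_{k=1}^m$ be finitely many admissible pairs in $\mathbb{R}$, let $\mathbf n=\{n_k\}_{k=1}^\infty$ be a sequence of positive integers, let $\Omega=\{1,\dots,m\}^\infty$, and let $\mathbb{P}$ be a Borel probability measure on $\Omega$. For $\omega=\omega_1\omega_2\cdots\in\Omega$ let $$\mu^{\mathbf n}(\omega)=\delta_{N_{\omega_1}^{-n_1}B_{\omega_1}}*\delta_{N_{\omega_1}^{-n_1}N_{\omega_2}^{-n_2}B_{\omega_2}}*\cdots,\qquad \mu(\omega)=\delta_{N_{\omega_1}^{-1}B_{\omega_1}}*\delta_{N_{\omega_1}^{-1}N_{\omega_2}^{-1}B_{\omega_2}}*\cdots,$$ and let $$\mathcal{E}_m=\{t\in\mathbb{N}_+:\gcd(t,N_k)=1\text{ for all }1\le k\le m\}.$$ If $\mu(\omega)$ is non-degenerate for $\mathbb{P}$-a.e. $\omega\in\Omega$, then $\mu^{\mathbf n}$ is a spectral random measure $\mathbb{P}$-a.e., and $\mathcal{E}_m$ is an $\aleph_1$-spectral eigen set of $\mu^{\mathbf n}$ $\mathbb{P}$-a.e.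
   Context: For a nonempty finite $D\subset\mathbb{R}$, $\delta_D=\frac{1}{\#D}\sum_{a\in D}\delta_a$. Infinite convolutions are weak limits of the corresponding finite convolutions; those above exist for every $\omega\in\Omega$, and $(\omega,B)\mapsto\mu^{\mathbf n}(\omega)(B)$ is a random measure, denoted $\mu^{\mathbf n}$ (i.e. measurable in $\omega$ for each Borel $B$ and a measure in $B$ for each $\omega$). $\Omega$ has the metric $d(\alpha,\beta)=2^{-|\alpha\wedge\beta|}$ for $\alpha\neq\beta$, $|\alpha\wedge\beta|$ being the length of the longest common prefix. Admissible pair: an integer $N\ge2$ and a finite $B\subset\mathbb{Z}$ with $\#B\ge2$ form an admissible pair $(N,B)$ if there is $L\subset\mathbb{Z}$ such that the matrix $\left[\frac{1}{\sqrt{\#B}}e^{-2\pi i bl/N}\right]_{b\in B,\,l\in L}$ is unitary. Non-degenerate: for $k\ge1$ put $\nu_{>k}(\omega)=\delta_{N_{\omega_{k+1}}^{-1}B_{\omega_{k+1}}}*\delta_{(N_{\omega_{k+1}}N_{\omega_{k+2}})^{-1}B_{\omega_{k+2}}}*\cdots$. $\mu(\omega)$ is non-degenerate if some subsequence $\{\nu_{>k_j}(\omega)\}_{j=1}^\infty$ converges weakly to a measure singular to Lebesgue measure. A Borel probability measure $\eta$ on $\mathbb{R}$ is a spectral measure if there is a countable $\Lambda\subset\mathbb{R}$ (a spectrum of $\eta$) such that $\{e^{-2\pi i\lambda x}:\lambda\in\Lambda\}$ is an orthonormal basis of $L^2(\eta)$. A random measure $M$ on $\mathbb{R}$ is a spectral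 random measure $\mathbb{P}$-a.e. if $M(\omega)$ is a spectral measure for $\mathbb{P}$-a.e. $\omega$. A set $\mathcal{E}\subset\mathbb{R}$ containing $1$ is an $\aleph_1$-spectral eigen set of $M$ $\mathbb{P}$-a.e. if for $\mathbb{P}$-a.e. $\omega\in\Omega$ there exist uncountably many subsets $\Lambda_\omega\subset\mathbb{R}$ such that $t\Lambda_\omega$ is a spectrum of $M(\omega)$ for all $t\in\mathcal{E}$. *)

theory Defs
  imports "HOL-Probability.Probability"
begin

text \<open>Sequences \<open>x\<^sub>1 x\<^sub>2 \<dots>\<close> are functions on \<^typ>\<open>nat\<close> shifted by one:
  \<open>\<omega> i\<close> is the letter \<open>\<omega>\<^sub>i\<^sub>+\<^sub>1\<close> and \<open>n i\<close> the exponent \<open>n\<^sub>i\<^sub>+\<^sub>1\<close>.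
  Alphabets \<open>{1..m}\<close> are not shifted.\<close>

subsection \<open>Sequence space\<close>

definition seq_space :: "nat \<Rightarrow> (nat \<Rightarrow> nat) set" where
  "seq_space m = {\<omega>. \<forall>i. \<omega> i \<in> {1..m}}"

text \<open>Because of the shift, the first position of disagreement is the length of the
  longest common prefix.\<close>

definition seq_dist :: "(nat \<Rightarrow> nat) \<Rightarrow> (nat \<Rightarrow> nat) \<Rightarrow> real" where
  "seq_dist \<alpha> \<beta> = (if \<alpha> = \<beta> then 0 else (1/2) ^ (LEAST i. \<alpha> i \<noteq> \<beta> i))"

lemma Metric_space_seq_dist: "Metric_space (seq_space m) seq_dist"
proof
  fix \<alpha> \<beta> \<gamma> :: "nat \<Rightarrow> nat"
  show "0 \<le> seq_dist \<alpha> \<beta>" by (simp add: seq_dist_def)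
  show "seq_dist \<alpha> \<beta> = seq_dist \<beta> \<alpha>" by (simp add: seq_dist_def eq_commute)
  show "(seq_dist \<alpha> \<beta> = 0) = (\<alpha> = \<beta>)" by (simp add: seq_dist_def)
  show "seq_dist \<alpha> \<gamma> \<le> seq_dist \<alpha> \<beta> + seq_dist \<beta> \<gamma>"
  proof (cases "\<alpha> = \<beta> \<or> \<beta> = \<gamma> \<or> \<alpha> = \<gamma>")
    case True
    then show ?thesis by (auto simp: seq_dist_def)
  next
    case False
    define k where "k = (LEAST i. \<alpha> i \<noteq> \<gamma> i)"
    have "\<exists>i. \<alpha> i \<noteq> \<gamma> i" using False by auto
    then have "\<alpha> k \<noteq> \<gamma> k" unfolding k_def by (rule LeastI_ex)
    then have "\<alpha> k \<noteq> \<beta> k \<or> \<beta> k \<noteq> \<gamma> k" by auto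
    then have "(LEAST i. \<alpha> i \<noteq> \<beta> i) \<le> k \<or> (LEAST i. \<beta> i \<noteq> \<gamma> i) \<le> k"
      by (auto intro: Least_le)
    then have "(1/2::real) ^ k \<le> (1/2) ^ (LEAST i. \<alpha> i \<noteq> \<beta> i)
        \<or> (1/2::real) ^ k \<le> (1/2) ^ (LEAST i. \<beta> i \<noteq> \<gamma> i)"
      by (auto intro!: power_decreasing)
    moreover have "0 \<le> (1/2::real) ^ j" for j by simp
    ultimately have "(1/2::real) ^ k
        \<le> (1/2) ^ (LEAST i. \<alpha> i \<noteq> \<beta> i) + (1/2) ^ (LEAST i. \<beta> i \<noteq> \<gamma> i)"
      by (meson add_increasing add_increasing2)
    then show ?thesis using False by (simp add: seq_dist_def k_def)
  qed
qed

definition seq_borel :: "nat \<Rightarrow> (nat \<Rightarrow> nat) measure" where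
  "seq_borel m = sigma (seq_space m)
     {U. openin (Metric_space.mtopology (seq_space m) seq_dist) U}"

subsection \<open>Admissible pairs\<close>

definition unitary_matrix :: "'a set \<Rightarrow> 'b set \<Rightarrow> ('a \<Rightarrow> 'b \<Rightarrow> complex) \<Rightarrow> bool" where
  "unitary_matrix I J U \<longleftrightarrow> finite I \<and> finite J \<and> card I = card J \<and>
     (\<forall>i\<in>I. \<forall>i'\<in>I. (\<Sum>j\<in>J. U i j * cnj (U i' j)) = (if i = i' then 1 else 0)) \<and>
     (\<forall>j\<in>J. \<forall>j'\<in>J. (\<Sum>i\<in>I. cnj (U i j) * U i j') = (if j = j' then 1 else 0))"

definition admissible_pair :: "int \<Rightarrow> int set \<Rightarrow> bool" where
  "admissible_pair N B \<longleftrightarrow> N \<ge> 2 \<and> finite B \<and> card B \<ge> 2 \<and>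
     (\<exists>L :: int set. unitary_matrix B L
        (\<lambda>b l. complex_of_real (1 / sqrt (real (card B)))
               * exp (- 2 * of_real pi * \<i> * of_int b * of_int l / of_int N)))"

subsection \<open>Infinite convolutions\<close>

definition uniform_dirac :: "real set \<Rightarrow> real measure" where
  "uniform_dirac D = distr (measure_pmf (pmf_of_set D)) borel (\<lambda>x. x)"

primrec finite_convolution :: "(nat \<Rightarrow> real measure) \<Rightarrow> nat \<Rightarrow> real measure" where
  "finite_convolution \<nu> 0 = return borel 0"
| "finite_convolution \<nu> (Suc k) = (finite_convolution \<nu> k \<star> \<nu> k)"

text \<open>The weak limit of the finite convolutions; it is unique when it exists, and the value
  is unspecified otherwise.\<close>

definition infinite_convolution :: "(nat \<Rightarrow> real measure) \<Rightarrow> real measure" where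
  "infinite_convolution \<nu> =
     (THE \<mu>. real_distribution \<mu> \<and> weak_conv_m (finite_convolution \<nu>) \<mu>)"

definition mu_conv ::
    "(nat \<Rightarrow> int) \<Rightarrow> (nat \<Rightarrow> int set) \<Rightarrow> (nat \<Rightarrow> nat) \<Rightarrow> (nat \<Rightarrow> nat) \<Rightarrow> real measure" where
  "mu_conv N B n \<omega> = infinite_convolution (\<lambda>k. uniform_dirac
     ((\<lambda>b. real_of_int b / (\<Prod>i\<le>k. real_of_int (N (\<omega> i)) ^ n i)) ` B (\<omega> k)))"

text \<open>\<open>\<mu>(\<omega>)\<close> is \<open>mu_conv N B (\<lambda>_. 1) \<omega>\<close>, and \<open>\<nu>\<^sub>>\<^sub>k(\<omega>)\<close> is the same convolution for the
  sequence \<open>\<omega>\<^sub>k\<^sub>+\<^sub>1 \<omega>\<^sub>k\<^sub>+\<^sub>2 \<dots>\<close>.\<close>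

definition nu_tail ::
    "(nat \<Rightarrow> int) \<Rightarrow> (nat \<Rightarrow> int set) \<Rightarrow> nat \<Rightarrow> (nat \<Rightarrow> nat) \<Rightarrow> real measure" where
  "nu_tail N B k \<omega> = mu_conv N B (\<lambda>_. 1) (\<lambda>i. \<omega> (k + i))"

definition mutually_singular :: "'a measure \<Rightarrow> 'a measure \<Rightarrow> bool" where
  "mutually_singular \<mu> \<nu> \<longleftrightarrow>
     (\<exists>A \<in> sets \<mu> \<inter> sets \<nu>. emeasure \<mu> A = 0 \<and> emeasure \<nu> (space \<nu> - A) = 0)"

definition non_degenerate ::
    "(nat \<Rightarrow> int) \<Rightarrow> (nat \<Rightarrow> int set) \<Rightarrow> (nat \<Rightarrow> nat) \<Rightarrow> bool" where
  "non_degenerate N B \<omega> \<longleftrightarrow> (\<exists>k \<eta>. strict_mono k \<and> (\<forall>j. k j \<ge> 1) \<and> real_distribution \<eta> \<and>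
     weak_conv_m (\<lambda>j. nu_tail N B (k j) \<omega>) \<eta> \<and> mutually_singular \<eta> lborel)"

subsection \<open>Spectral measures\<close>

definition expo :: "real \<Rightarrow> real \<Rightarrow> complex" where
  "expo s x = exp (- 2 * of_real pi * \<i> * of_real (s * x))"

definition square_integrable :: "real measure \<Rightarrow> (real \<Rightarrow> complex) \<Rightarrow> bool" where
  "square_integrable \<eta> f \<longleftrightarrow>
     f \<in> borel_measurable \<eta> \<and> integrable \<eta> (\<lambda>x. (cmod (f x))\<^sup>2)"

text \<open>Orthonormality is that of the family indexed by \<open>\<Lambda>\<close>, so distinct frequencies must
  give orthogonal exponentials. The last conjunct says that the linear span is dense in
  \<open>L\<^sup>2(\<eta>)\<close>.\<close>

definition is_spectrum :: "real measure \<Rightarrow> real set \<Rightarrow> bool" where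
  "is_spectrum \<eta> \<Lambda> \<longleftrightarrow> countable \<Lambda> \<and>
     (\<forall>s\<in>\<Lambda>. \<forall>s'\<in>\<Lambda>.
        (\<integral>x. expo s x * cnj (expo s' x) \<partial>\<eta>) = (if s = s' then 1 else 0)) \<and>
     (\<forall>f. square_integrable \<eta> f \<longrightarrow> (\<forall>\<epsilon>>0. \<exists>F c. finite F \<and> F \<subseteq> \<Lambda> \<and>
        (\<integral>x. (cmod (f x - (\<Sum>s\<in>F. c s * expo s x)))\<^sup>2 \<partial>\<eta>) < \<epsilon>\<^sup>2))"

definition spectral_measure :: "real measure \<Rightarrow> bool" where
  "spectral_measure \<eta> \<longleftrightarrow> real_distribution \<eta> \<and> (\<exists>\<Lambda>. is_spectrum \<eta> \<Lambda>)"

definition random_measure :: "'a measure \<Rightarrow> ('a \<Rightarrow> real measure) \<Rightarrow> bool" where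
  "random_measure P M \<longleftrightarrow> (\<forall>\<omega>\<in>space P. sets (M \<omega>) = sets borel) \<and>
     (\<forall>A\<in>sets borel. (\<lambda>\<omega>. emeasure (M \<omega>) A) \<in> borel_measurable P)"

definition spectral_random_measure :: "'a measure \<Rightarrow> ('a \<Rightarrow> real measure) \<Rightarrow> bool" where
  "spectral_random_measure P M \<longleftrightarrow> random_measure P M \<and> (AE \<omega> in P. spectral_measure (M \<omega>))"

definition aleph1_spectral_eigen_set ::
    "'a measure \<Rightarrow> ('a \<Rightarrow> real measure) \<Rightarrow> real set \<Rightarrow> bool" where
  "aleph1_spectral_eigen_set P M E \<longleftrightarrow> 1 \<in> E \<and>
     (AE \<omega> in P. uncountable {\<Lambda>. \<forall>t\<in>E. is_spectrum (M \<omega>) ((*) t ` \<Lambda>)})"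

definition coprime_multipliers :: "nat \<Rightarrow> (nat \<Rightarrow> int) \<Rightarrow> real set" where
  "coprime_multipliers m N = real ` {t. t > 0 \<and> (\<forall>k\<in>{1..m}. gcd (int t) (N k) = 1)}"

end

theory Submission
  imports Defs "HOL-Complex_Analysis.Complex_Analysis" "HOL-Real_Asymp.Real_Asymp"
    "HOL-Library.Diagonal_Subsequence"
begin

text \<open>Fix \<open>\<omega>\<close> and write \<open>a\<^sub>i = N\<^sub>\<omega>\<^sub>i ^ n\<^sub>i\<close>. The Fourier transform of \<open>\<mu>\<close> is the infinite
  product of the masks of the \<open>B\<^sub>\<omega>\<^sub>i\<close> at the scales \<open>a\<^sub>0 \<cdots> a\<^sub>i\<close>. A spectrum of \<open>\<mu>\<close> is obtained as an
  increasing union of spectra of the finite convolutions, where at each stage the new frequencies are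
  moved by multiples of the current scale to points at which the Fourier transform of the tail is
  bounded away from 0; Parseval for the finite convolutions then passes to the limit. Orthogonality
  survives dilation by every \<open>t\<close> coprime to the \<open>N\<^sub>k\<close>, because an integer polynomial that vanishes at
  a root of unity vanishes at its coprime powers. For completeness of \<open>t\<Lambda>\<close> it suffices that
  infinitely many stages are adapted to \<open>t\<close>, so the stages can take turns. Translating the spectrum
  yields uncountably many.

  The required lower bound on tails is where non-degeneracy enters. If the tail is small on
  \<open>x + t\<int>\<close>, then the next tail is small on \<open>(x + t l) / a + t\<int>\<close> for some residue \<open>l\<close>, and for at least
  two of them when \<open>#B < N\<close>. Such letters therefore produce many separated near-zeros in \<open>[0, t]\<close>
  of an entire function \<open>f\<close> of bounded exponential type with \<open>f 0 = 1\<close>, which is impossible. If, on the other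
  hand, only finitely many letters with \<open>#B < N\<close> were visible in a limit of tails, then the
  Fourier transform of that limit would vanish on \<open>\<sigma>(\<int> - {0})\<close> for some \<open>\<sigma>\<close>, and the limit
  would be absolutely continuous.\<close>

section \<open>Integer polynomials at roots of unity\<close>

text \<open>The hypothesis concerns the exponents 1, the conclusion arbitrary exponents. The powers
  \<open>N (\<omega> i) ^ n i\<close> may be unbounded, so the tails of the measure do not range
  over a compact family although the alphabet is finite. Non-degeneracy is therefore first turned
  into a combinatorial property of \<omega>: for every \<open>G\<close> there is a window length
  such that at infinitely many positions the window contains at least \<open>G\<close> letters with
  \<open>card B < N\<close>. This property survives the passage to powers, because
  \<open>N \<le> N ^ n\<close>. A very large power inside a window does no harm, since it forces the
  tail at that level to be near 1 on \<open>[0, t]\<close>. If no power in the window is large, the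
  near-zeros are separated by a constant. The number of near-zeros that is contradictory depends
  only on the exponential type and on \<open>t\<close>, not on the separation; this matters because
  the separation deteriorates with the window length, which in turn is chosen to produce that
  number.\<close>

definition int_poly_eval :: "int poly \<Rightarrow> complex \<Rightarrow> complex" where
  "int_poly_eval f z = poly (map_poly of_int f) z"

lemma int_poly_eval_0 [simp]: "int_poly_eval 0 z = 0"
  by (simp add: int_poly_eval_def)

lemma int_poly_eval_pCons [simp]:
  "int_poly_eval (pCons a f) z = of_int a + z * int_poly_eval f z"
  by (simp add: int_poly_eval_def map_poly_pCons)

lemma int_poly_eval_1 [simp]: "int_poly_eval 1 z = 1"
  by (simp add: one_pCons)

lemma int_poly_eval_add [simp]:
  "int_poly_eval (f + g) z = int_poly_eval f z + int_poly_eval g z"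
  by (induction f g rule: poly_induct2) (simp_all add: algebra_simps)

lemma int_poly_eval_smult [simp]:
  "int_poly_eval (smult c f) z = of_int c * int_poly_eval f z"
  by (induction f) (simp_all add: algebra_simps)

lemma int_poly_eval_minus [simp]: "int_poly_eval (- f) z = - int_poly_eval f z"
  using int_poly_eval_smult[of "-1" f z] by simp

lemma int_poly_eval_diff [simp]:
  "int_poly_eval (f - g) z = int_poly_eval f z - int_poly_eval g z"
  using int_poly_eval_add[of f "-g" z] by simp

lemma int_poly_eval_mult [simp]:
  "int_poly_eval (f * g) z = int_poly_eval f z * int_poly_eval g z"
  by (induction f) (simp_all add: algebra_simps)

lemma int_poly_eval_power [simp]: "int_poly_eval (f ^ k) z = int_poly_eval f z ^ k"
  by (induction k) simp_all

lemma int_poly_eval_monom [simp]: "int_poly_eval (monom a k) z = of_int a * z ^ k"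
  by (simp add: int_poly_eval_def map_poly_monom poly_monom)

lemma int_poly_eval_sum [simp]:
  "int_poly_eval (\<Sum>x\<in>A. f x) z = (\<Sum>x\<in>A. int_poly_eval (f x) z)"
  by (induction A rule: infinite_finite_induct) simp_all

lemma int_poly_eval_pcompose [simp]:
  "int_poly_eval (f \<circ>\<^sub>p g) z = int_poly_eval f (int_poly_eval g z)"
  by (induction f) (simp_all add: pcompose_pCons)

text \<open>Gauss's lemma: a primitive polynomial of least degree vanishing at \<zeta> divides
  \<open>X ^ n - 1\<close> over the integers, so its leading coefficient divides 1. Being monic
  allows division with remainder inside integer polynomials, which makes \<int>[\<zeta>] a lattice
  with the powers of \<zeta> below \<open>degree g\<close> as a basis.\<close>

lemma obtain_monic_min_poly_root_of_unity:
  fixes \<zeta> :: complex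
  assumes "n > 0" "\<zeta> ^ n = 1"
  obtains g :: "int poly" where "lead_coeff g = 1" "int_poly_eval g \<zeta> = 0"
    "\<And>h. int_poly_eval h \<zeta> = 0 \<Longrightarrow> degree h < degree g \<Longrightarrow> h = 0"
proof -
  define X :: "int poly" where "X = monom 1 n - 1"
  have X0: "X \<noteq> 0" and lcX: "lead_coeff X = 1" and evX: "int_poly_eval X \<zeta> = 0"
  proof -
    have "coeff X n = 1" using assms by (simp add: X_def)
    moreover have "degree X = n"
    proof (rule antisym)
      show "degree X \<le> n" unfolding X_def by (intro degree_diff_le) (auto simp: degree_monom_le)
      show "n \<le> degree X" using \<open>coeff X n = 1\<close> by (intro le_degree) simp
    qed
    ultimately show "lead_coeff X = 1" by simp
    then show "X \<noteq> 0" by auto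
    show "int_poly_eval X \<zeta> = 0" using assms by (simp add: X_def)
  qed
  define Q where "Q g \<longleftrightarrow> g \<noteq> 0 \<and> int_poly_eval g \<zeta> = 0" for g
  have "Q X" using X0 evX by (simp add: Q_def)
  then obtain g0 where g0: "Q g0" "\<And>h. Q h \<Longrightarrow> degree g0 \<le> degree h"
    using ex_has_least_nat[of Q X degree] by blast
  define g1 where "g1 = primitive_part g0"
  have g1: "Q g1" "\<And>h. Q h \<Longrightarrow> degree g1 \<le> degree h" "content g1 = 1"
  proof -
    have "g0 \<noteq> 0" using g0 by (simp add: Q_def)
    have g: "g0 = smult (content g0) g1" by (simp add: g1_def)
    have "of_int (content g0) * int_poly_eval g1 \<zeta> = 0"
      using g0(1) int_poly_eval_smult[of "content g0" g1 \<zeta>] g by (simp add: Q_def)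
    with \<open>g0 \<noteq> 0\<close> show "Q g1" by (simp add: Q_def g1_def)
    show "degree g1 \<le> degree h" if "Q h" for h
      using g0(2)[OF that] by (simp add: g1_def)
    show "content g1 = 1" using \<open>g0 \<noteq> 0\<close> by (simp add: g1_def)
  qed
  have "g1 \<noteq> 0" using g1(1) by (simp add: Q_def)
  obtain q r where qr: "pseudo_divmod X g1 = (q, r)" by fastforce
  \<comment> \<open>Pseudo-division multiplies \<open>X\<close> by this power of the leading
    coefficient; the comparison of contents below removes it again.\<close>
  define c where "c = lead_coeff g1 ^ (Suc (degree X) - degree g1)"
  have c: "smult c X = g1 * q + r" "r = 0 \<or> degree r < degree g1"
    using pseudo_divmod[OF \<open>g1 \<noteq> 0\<close> qr] by (simp_all add: c_def)
  have "int_poly_eval (smult c X) \<zeta> = int_poly_eval (g1 * q + r) \<zeta>" by (simp only: c)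
  then have "int_poly_eval r \<zeta> = 0" using evX g1(1) by (simp add: Q_def)
  then have "r = 0" using c(2) g1(2)[of r] by (metis Q_def leD)
  then have cX: "smult c X = g1 * q" using c by simp
  have "c \<noteq> 0" using \<open>g1 \<noteq> 0\<close> by (simp add: c_def)
  have "content X = 1"
  proof -
    have "content X dvd lead_coeff X" by (rule content_dvd_coeff)
    then have "normalize (content X) = 1" using lcX by (intro is_unit_normalize) simp
    then show ?thesis by (metis normalize_content)
  qed
  have "content (smult c X) = content g1 * content q" by (simp only: cX content_mult)
  then have cq: "content q = normalize c" using \<open>content X = 1\<close> g1(3) by simp
  then have "[:c:] dvd q" by (simp add: const_poly_dvd_iff_dvd_content)
  then obtain q' where "q = [:c:] * q'" by blast
  then have "smult c X = smult c (g1 * q')" using cX by simp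
  then have "smult c (X - g1 * q') = 0" by (simp add: smult_diff_right)
  then have "X = g1 * q'" using \<open>c \<noteq> 0\<close> by simp
  then have "lead_coeff g1 * lead_coeff q' = 1" using lcX lead_coeff_mult[of g1 q'] by simp
  then have u: "lead_coeff g1 = 1 \<or> lead_coeff g1 = -1" by (auto simp: zmult_eq_1_iff)
  define g where "g = smult (lead_coeff g1) g1"
  have "lead_coeff g = 1" using u by (auto simp: g_def)
  moreover have "int_poly_eval g \<zeta> = 0" using g1(1) by (simp add: g_def Q_def)
  moreover have "degree g = degree g1" using u by (auto simp: g_def)
  ultimately show ?thesis using g1(2) that[of g] by (metis Q_def leD)
qed

lemma prime_dvd_power_add:
  fixes a b :: "'a :: comm_ring_1"
  assumes p: "prime (p::nat)"
  shows "of_nat p dvd ((a + b) ^ p - (a ^ p + b ^ p))"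
proof -
  have "p > 0" using p by (simp add: prime_gt_0_nat)
  have "(a + b) ^ p = (\<Sum>k\<le>p. of_nat (p choose k) * a ^ k * b ^ (p - k))"
    by (rule binomial_ring)
  also have "\<dots> = (\<Sum>k\<in>{..p}-{0,p}. of_nat (p choose k) * a ^ k * b ^ (p - k))
      + (\<Sum>k\<in>{0,p}. of_nat (p choose k) * a ^ k * b ^ (p - k))"
    by (rule sum.subset_diff) auto
  also have "(\<Sum>k\<in>{0,p}. of_nat (p choose k) * a ^ k * b ^ (p - k)) = a ^ p + b ^ p"
    using \<open>p > 0\<close> by simp
  finally have "(a + b) ^ p - (a ^ p + b ^ p)
     = (\<Sum>k\<in>{..p}-{0,p}. of_nat (p choose k) * a ^ k * b ^ (p - k))" by simp
  also have "of_nat p dvd \<dots>"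
  proof (rule dvd_sum)
    fix k assume "k \<in> {..p} - {0, p}"
    then have "p dvd (p choose k)" by (intro dvd_choose_prime) (use p in auto)
    then obtain j where "p choose k = p * j" by blast
    then show "of_nat p dvd of_nat (p choose k) * a ^ k * b ^ (p - k)"
      by (simp add: mult.assoc)
  qed
  finally show ?thesis .
qed

text \<open>Fermat's little theorem, by induction from the binomial congruence. Negative
  \<open>a\<close> are reached through \<open>a + (- a) = 0\<close>, which avoids distinguishing the
  parity of \<open>p\<close>.\<close>

lemma prime_dvd_power_diff_self:
  fixes a :: int
  assumes p: "prime (p::nat)"
  shows "int p dvd (a ^ p - a)"
proof -
  have p0: "p > 0" using p by (simp add: prime_gt_0_nat)
  have nn: "int p dvd (int n ^ p - int n)" for n
  proof (induction n)
    case (Suc n)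
    have "int p dvd (int n + 1) ^ p - (int n ^ p + 1 ^ p)"
      using prime_dvd_power_add[OF p, of "int n" 1] by simp
    from dvd_add[OF this Suc] show ?case by (simp add: algebra_simps)
  qed (use p0 in \<open>simp add: power_0_left\<close>)
  show ?thesis
  proof (cases a)
    case (neg n)
    have "int p dvd (a + (- a)) ^ p - (a ^ p + (- a) ^ p)"
      by (rule prime_dvd_power_add[OF p, of a "- a"])
    moreover have "(a + (- a)) ^ p - (a ^ p + (- a) ^ p) = - (a ^ p + (- a) ^ p)"
      using p0 by (simp add: power_0_left)
    ultimately have 1: "int p dvd a ^ p + (- a) ^ p" by (simp only: dvd_minus_iff)
    have "- a = int (Suc n)" using neg by simp
    then have "int p dvd (- a) ^ p - (- a)" using nn[of "Suc n"] by (simp only:)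
    from dvd_diff[OF 1 this] show ?thesis by simp
  next
    case (nonneg n)
    then show ?thesis using nn[of n] by (simp only:)
  qed
qed

text \<open>Since \<open>pCons a f\<close> is \<open>a + X f\<close>, the binomial congruence splits
  its \<open>p\<close>-th power into a part settled by Fermat for \<open>a\<close> and a part
  settled by induction for \<open>f\<close>.\<close>

lemma frobenius_int_poly:
  fixes f :: "int poly"
  assumes p: "prime (p::nat)"
  shows "of_nat p dvd (f ^ p - f \<circ>\<^sub>p monom 1 p)"
proof (induction f)
  case 0
  then show ?case using p by (simp add: prime_gt_0_nat power_0_left)
next
  case (pCons a f)
  have eq: "pCons a f ^ p - pCons a f \<circ>\<^sub>p monom 1 p =
     (([:a:] + monom 1 1 * f) ^ p - ([:a:] ^ p + (monom 1 1 * f) ^ p)) + ([:a:] ^ p - [:a:])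
      + monom 1 p * (f ^ p - f \<circ>\<^sub>p monom 1 p)"
  proof -
    have "pCons a f = [:a:] + monom 1 1 * f"
      by (simp add: monom_altdef)
    moreover have "pCons a f \<circ>\<^sub>p monom 1 p = [:a:] + monom 1 p * (f \<circ>\<^sub>p monom 1 p)"
      by (simp add: pcompose_pCons)
    moreover have "(monom 1 1 * f) ^ p = monom 1 p * f ^ p"
      by (simp add: power_mult_distrib monom_power)
    ultimately show ?thesis by (simp only: algebra_simps)
  qed
  have "[:int p:] dvd ([:a ^ p - a:])"
    using prime_dvd_power_diff_self[OF p, of a] by (simp add: const_poly_dvd_const_poly_iff)
  then have "of_nat p dvd ([:a:] ^ p - [:a:])"
    by (simp add: poly_const_pow of_nat_poly)
  then show ?case unfolding eq
    using prime_dvd_power_add[OF p] pCons.IH by (intro dvd_add dvd_mult) auto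
qed

lemma int_poly_eval_reduce:
  assumes "lead_coeff g = 1" "int_poly_eval g \<zeta> = 0" "degree g > 0"
  obtains r where "int_poly_eval r \<zeta> = int_poly_eval f \<zeta>" "degree r < degree g"
proof -
  have "g \<noteq> 0" using assms by auto
  obtain q r where qr: "pseudo_divmod f g = (q, r)" by fastforce
  have "f = g * q + r" "r = 0 \<or> degree r < degree g"
    using pseudo_divmod[OF \<open>g \<noteq> 0\<close> qr] assms by simp_all
  then show ?thesis using assms by (intro that[of r]) auto
qed

text \<open>By the Frobenius congruence \<open>p\<close> divides \<open>f(\<zeta> ^ p)\<close> in \<open>\<int>[\<zeta>]\<close>, but \<open>f(\<zeta> ^ p)\<close> takes only finitely many
  values, and a nonzero element of the lattice \<open>\<int>[\<zeta>]\<close> has only finitely many prime divisors.\<close>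

lemma root_of_unity_large_prime_power:
  fixes f :: "int poly" and n :: nat
  assumes "n > 0"
  obtains X :: nat where "\<And>\<zeta> p. \<zeta> ^ n = 1 \<Longrightarrow> prime p \<Longrightarrow> p > X \<Longrightarrow>
     int_poly_eval f \<zeta> = 0 \<Longrightarrow> int_poly_eval f (\<zeta> ^ p) = 0"
proof -
  have "\<exists>X::nat. \<forall>p. prime p \<longrightarrow> p > X \<longrightarrow> \<zeta> ^ p = \<zeta>' \<longrightarrow>
      int_poly_eval f \<zeta> = 0 \<longrightarrow> int_poly_eval f \<zeta>' = 0"
    if z: "\<zeta> ^ n = 1" "\<zeta>' ^ n = 1" for \<zeta> \<zeta>'
  proof (cases "\<exists>j. \<zeta>' = \<zeta> ^ j")
    case False
    then show ?thesis by blast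
  next
    case True
    then obtain j where j: "\<zeta>' = \<zeta> ^ j" by blast
    obtain g where g: "lead_coeff g = 1" "int_poly_eval g \<zeta> = 0"
      "\<And>h. int_poly_eval h \<zeta> = 0 \<Longrightarrow> degree h < degree g \<Longrightarrow> h = 0"
      using obtain_monic_min_poly_root_of_unity[OF assms z(1)] by metis
    have "degree g > 0"
    proof (rule ccontr)
      assume "\<not> degree g > 0"
      then have "g = 1" using g(1) by (metis degree_0_id neq0_conv one_pCons of_int_1)
      then show False using g(2) by simp
    qed
    obtain h where h: "int_poly_eval h \<zeta> = int_poly_eval (f \<circ>\<^sub>p monom 1 j) \<zeta>" "degree h < degree g"
      using int_poly_eval_reduce[OF g(1,2) \<open>degree g > 0\<close>] by metis
    have h': "int_poly_eval h \<zeta> = int_poly_eval f \<zeta>'" using h(1) j by simp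
    \<comment> \<open>\<open>h\<close> represents the value of \<open>f\<close> at
      \<open>\<zeta>'\<close> in the basis of powers of \<zeta> and does not depend on
      \<open>p\<close>. The congruence makes \<open>p\<close> divide every coefficient of
      \<open>h\<close>, so a prime above this bound forces \<open>h = 0\<close>.\<close>
    define X where "X = nat (\<Sum>i\<le>degree h. \<bar>coeff h i\<bar>)"
    have "int_poly_eval f \<zeta>' = 0"
      if p: "prime p" "p > X" "\<zeta> ^ p = \<zeta>'" "int_poly_eval f \<zeta> = 0" for p
    proof -
      obtain q where "f ^ p - f \<circ>\<^sub>p monom 1 p = [:int p:] * q"
        using frobenius_int_poly[OF p(1), of f] by (auto simp: of_nat_poly)
      then have "int_poly_eval (f ^ p - f \<circ>\<^sub>p monom 1 p) \<zeta> = int_poly_eval ([:int p:] * q) \<zeta>"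
        by simp
      then have e: "- int_poly_eval f \<zeta>' = of_nat p * int_poly_eval q \<zeta>"
        using p prime_gt_0_nat[OF p(1)] by (simp add: power_0_left)
      obtain r where r: "int_poly_eval r \<zeta> = int_poly_eval q \<zeta>" "degree r < degree g"
        using int_poly_eval_reduce[OF g(1,2) \<open>degree g > 0\<close>] by metis
      have "int_poly_eval (h + smult (int p) r) \<zeta> = 0" using e r h' by (simp flip: e)
      moreover have "degree (h + smult (int p) r) < degree g"
        by (rule degree_add_less) (use h r le_less_trans[OF degree_smult_le] in auto)
      ultimately have hr: "h + smult (int p) r = 0" by (rule g(3))
      have "coeff h i = 0" for i
      proof (rule ccontr)
        assume nz: "coeff h i \<noteq> 0"
        have "coeff h i + int p * coeff r i = 0" using hr by (metis coeff_add coeff_smult coeff_0)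
        then have "int p dvd coeff h i" by (metis dvd_triv_left dvd_minus_iff add_eq_0_iff)
        then have "int p \<le> \<bar>coeff h i\<bar>" using nz by (simp add: zdvd_imp_le)
        also have "\<dots> \<le> (\<Sum>i\<le>degree h. \<bar>coeff h i\<bar>)"
          using nz by (intro member_le_sum) (auto simp: le_degree)
        finally show False using p(2) by (simp add: X_def)
      qed
      then have "h = 0" by (simp add: poly_eq_iff)
      then show ?thesis using h' by simp
    qed
    then show ?thesis by blast
  qed
  then obtain X :: "complex \<Rightarrow> complex \<Rightarrow> nat" where X: "\<And>\<zeta> \<zeta>' p. \<zeta> ^ n = 1 \<Longrightarrow> \<zeta>' ^ n = 1 \<Longrightarrow>
     prime p \<Longrightarrow> p > X \<zeta> \<zeta>' \<Longrightarrow> \<zeta> ^ p = \<zeta>' \<Longrightarrow> int_poly_eval f \<zeta> = 0 \<Longrightarrow> int_poly_eval f \<zeta>' = 0"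
    by metis
  \<comment> \<open>There are finitely many pairs of \<open>n\<close>-th roots of unity, so the
    bounds for single pairs combine into one.\<close>
  define U where "U = {z::complex. z ^ n = 1}"
  have "finite U" unfolding U_def using finite_roots_unity[of n] assms by simp
  define Y where "Y = (\<Sum>(\<zeta>,\<zeta>')\<in>U\<times>U. X \<zeta> \<zeta>')"
  show ?thesis
  proof (rule that[of Y])
    fix \<zeta> :: complex and p
    assume a: "\<zeta> ^ n = 1" "prime p" "p > Y" "int_poly_eval f \<zeta> = 0"
    have u: "(\<zeta> ^ p) ^ n = 1" using a(1) by (metis power_mult mult.commute power_one)
    have "X \<zeta> (\<zeta> ^ p) = (case (\<zeta>, \<zeta> ^ p) of (\<zeta>, \<zeta>') \<Rightarrow> X \<zeta> \<zeta>')" by simp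
    also have "\<dots> \<le> Y" unfolding Y_def
      using \<open>finite U\<close> a(1) u by (intro member_le_sum) (auto simp: U_def)
    finally show "int_poly_eval f (\<zeta> ^ p) = 0" using X[OF a(1) u a(2)] a by simp
  qed
qed

text \<open>Replacing \<open>t\<close> by \<open>t + n k\<close> for a suitable \<open>k\<close> makes all prime factors of the exponent large.\<close>

lemma root_of_unity_coprime_power:
  fixes f :: "int poly" and t n :: nat
  assumes n: "n > 0" and z: "\<zeta> ^ n = 1" and f: "int_poly_eval f \<zeta> = 0"
    and t: "t > 0" "coprime t n"
  shows "int_poly_eval f (\<zeta> ^ t) = 0"
proof -
  obtain X :: nat where X: "\<And>\<zeta> p. \<zeta> ^ n = 1 \<Longrightarrow> prime p \<Longrightarrow> p > X \<Longrightarrow>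
     int_poly_eval f \<zeta> = 0 \<Longrightarrow> int_poly_eval f (\<zeta> ^ p) = 0"
    using root_of_unity_large_prime_power[OF n, of f] by blast
  have step: "(\<forall>p. prime p \<longrightarrow> p dvd s \<longrightarrow> p > X) \<Longrightarrow> s > 0 \<Longrightarrow>
      \<zeta> ^ n = 1 \<Longrightarrow> int_poly_eval f \<zeta> = 0 \<Longrightarrow> int_poly_eval f (\<zeta> ^ s) = 0" for s \<zeta>
  proof (induction s arbitrary: \<zeta> rule: less_induct)
    case (less s)
    show ?case
    proof (cases "s = 1")
      case False
      then obtain p where p: "prime p" "p dvd s" using prime_factor_nat by blast
      then obtain s' where s: "s = p * s'" by blast
      have s': "s' > 0" "s' < s" using s less.prems(2) prime_gt_1_nat[OF p(1)] by auto
      have "int_poly_eval f (\<zeta> ^ p) = 0" using X less.prems p by blast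
      moreover have "(\<zeta> ^ p) ^ n = 1" using less.prems(3) by (metis power_mult mult.commute power_one)
      ultimately have "int_poly_eval f ((\<zeta> ^ p) ^ s') = 0"
        using s' less.prems(1) s by (intro less.IH[of s' "\<zeta> ^ p"]) auto
      then show ?thesis by (simp add: s power_mult)
    qed (use less in simp)
  qed
  \<comment> \<open>Each prime \<open>p \<le> X\<close> divides exactly one of \<open>t\<close> and
    \<open>n * k\<close>, hence not their sum: a divisor of \<open>t\<close> divides neither
    \<open>n\<close>, by coprimality, nor \<open>k\<close>, and any other is a factor of
    \<open>k\<close>.\<close>
  define k where "k = (\<Prod>p\<in>{p. prime p \<and> p \<le> X \<and> \<not> p dvd t}. p)"
  have fin: "finite {p. prime p \<and> p \<le> X \<and> \<not> p dvd t}" by simp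
  have "p > X" if p: "prime p" "p dvd t + n * k" for p
  proof (rule ccontr)
    assume "\<not> p > X"
    then have "p \<le> X" by simp
    show False
    proof (cases "p dvd t")
      case True
      then have "p dvd n * k" using p(2) by (simp add: dvd_add_right_iff)
      moreover have "\<not> p dvd n" using True t(2) p(1)
        by (meson coprime_common_divisor_nat not_prime_1 coprime_def not_prime_unit)
      ultimately have "p dvd k" using p(1) by (simp add: prime_dvd_mult_iff)
      then obtain q where "q \<in> {p. prime p \<and> p \<le> X \<and> \<not> p dvd t}" "p dvd q"
        unfolding k_def using prime_dvd_prod_iff[OF fin p(1)] by auto
      then show False using True p(1) primes_dvd_imp_eq by blast
    next
      case False
      then have "p dvd k" unfolding k_def using p(1) \<open>p \<le> X\<close> fin by (intro dvd_prodI) auto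
      then show False using p(2) False by (simp add: dvd_add_left_iff)
    qed
  qed
  then have "int_poly_eval f (\<zeta> ^ (t + n * k)) = 0"
    using step[of "t + n * k" \<zeta>] t(1) z f by simp
  then show ?thesis by (simp add: power_add power_mult z)
qed

section \<open>Near-zeros of entire functions\<close>

lemma holomorphic_factor_zeros:
  assumes "finite Y" "f holomorphic_on UNIV" "\<And>y. y \<in> Y \<Longrightarrow> f y = 0"
  shows "\<exists>g. g holomorphic_on UNIV \<and> (\<forall>z. f z = g z * (\<Prod>y\<in>Y. z - y))"
  using assms
proof (induction Y rule: finite_induct)
  case empty
  then show ?case by auto
next
  case (insert a Y)
  then obtain g where g: "g holomorphic_on UNIV" "\<And>z. f z = g z * (\<Prod>y\<in>Y. z - y)" by auto
  have "(\<Prod>y\<in>Y. a - y) \<noteq> 0" using insert.hyps by (auto simp: prod_zero_iff)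
  moreover have "g a * (\<Prod>y\<in>Y. a - y) = 0" using g(2)[of a] insert.prems(2)[of a] by simp
  ultimately have ga: "g a = 0" by simp
  define k where "k z = (if z = a then deriv g a else (g z - g a) / (z - a))" for z
  have "k holomorphic_on UNIV" unfolding k_def by (rule pole_lemma_open[OF g(1)]) simp
  moreover have "f z = k z * (\<Prod>y\<in>insert a Y. z - y)" for z
    using insert.hyps ga by (cases "z = a") (auto simp: g(2) k_def)
  ultimately show ?case by blast
qed

text \<open>Subtracting the Lagrange interpolant turns the near-zeros into zeros; dividing these out
  and applying the maximum principle on the circle of radius \<open>4t\<close> contradicts \<open>f 0 = 1\<close>.\<close>

lemma near_zeros_bound:
  fixes C t :: real
  assumes "t > 0"
  obtains n :: nat where "\<And>s. s > 0 \<Longrightarrow> \<exists>\<epsilon>>0. \<forall>f (Y::real set).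
    f holomorphic_on UNIV \<longrightarrow> f 0 = 1 \<longrightarrow> (\<forall>z. cmod (f z) \<le> exp (C * cmod z)) \<longrightarrow>
    card Y = n \<longrightarrow> Y \<subseteq> {0..t} \<longrightarrow> (\<forall>x\<in>Y. \<forall>y\<in>Y. x \<noteq> y \<longrightarrow> \<bar>x - y\<bar> \<ge> s) \<longrightarrow>
    (\<exists>y\<in>Y. cmod (f (of_real y)) > \<epsilon>)"
proof -
  \<comment> \<open>Points of \<open>[0, t]\<close> are at distance at least \<open>3 * t\<close>
    from the circle of radius \<open>4 * t\<close> but at most \<open>t\<close> from 0. Each zero
    therefore gains a factor 3 at the origin, and \<open>n\<close> zeros beat the growth
    \<open>exp (C * r)\<close>. As \<open>n\<close> is fixed before \<open>s\<close>, a caller may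
    let the separation depend on \<open>n\<close>.\<close>
  define r where "r = 4 * t"
  obtain n0 :: nat where n0: "2 * (exp (C * r) + 1) < 3 ^ n0"
    using real_arch_pow[of 3 "2 * (exp (C * r) + 1)"] by fastforce
  define n where "n = Suc n0"
  have "(3::real) ^ n0 \<le> 3 ^ n" by (simp add: n_def)
  then have n: "2 * (exp (C * r) + 1) < 3 ^ n" "n > 0"
    using n0 by (linarith, simp add: n_def)
  show ?thesis
  proof (rule that[of n])
    fix s :: real assume s: "s > 0"
    \<comment> \<open>Bound for the Lagrange basis polynomials on the disc of radius
      \<open>r\<close>; \<epsilon> is then chosen to keep the whole interpolant at most 1/4
      there.\<close>
    define K where "K = (max 1 ((r + t) / s)) ^ n"
    have K1: "K \<ge> 1" by (simp add: K_def)
    define \<epsilon> where "\<epsilon> = 1 / (4 * real n * K)"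
    have \<epsilon>: "\<epsilon> > 0" "real n * \<epsilon> * K = 1 / 4" using K1 n(2) by (auto simp: \<epsilon>_def)
    have False
      if f: "f holomorphic_on UNIV" "f 0 = 1" "\<And>z. cmod (f z) \<le> exp (C * cmod z)"
        and Y: "card Y = n" "Y \<subseteq> {0..t}" "\<And>x y. x \<in> Y \<Longrightarrow> y \<in> Y \<Longrightarrow> x \<noteq> y \<Longrightarrow> \<bar>x - y\<bar> \<ge> s"
        and small: "\<And>y. y \<in> Y \<Longrightarrow> cmod (f (of_real y)) \<le> \<epsilon>" for f and Y :: "real set"
    proof -
      have fin: "finite Y" using Y(1) n(2) card_ge_0_finite by metis
      define l where "l y z = (\<Prod>x\<in>Y - {y}. (z - of_real x) / of_real (y - x))" for y :: real and z :: complex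
      define L where "L z = (\<Sum>y\<in>Y. f (of_real y) * l y z)" for z
      have l_bound: "cmod (l y z) \<le> K" if "y \<in> Y" "cmod z \<le> r" for y z
      proof -
        have "cmod (l y z) = (\<Prod>x\<in>Y - {y}. cmod ((z - of_real x) / of_real (y - x)))"
          by (simp add: l_def prod_norm)
        also have "\<dots> \<le> (\<Prod>x\<in>Y - {y}. max 1 ((r + t) / s))"
        proof (intro prod_mono conjI)
          fix x assume x: "x \<in> Y - {y}"
          have "cmod (z - of_real x) \<le> r + t"
            using norm_triangle_ineq4[of z "of_real x"] that(2) x Y(2) by auto
          moreover have "\<bar>y - x\<bar> \<ge> s" using Y(3) x that by auto
          ultimately have "cmod (z - of_real x) / \<bar>y - x\<bar> \<le> (r + t) / s"
            using s assms by (intro frac_le) (auto simp: r_def)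
          then show "cmod ((z - of_real x) / of_real (y - x)) \<le> max 1 ((r + t) / s)"
            unfolding norm_divide norm_of_real by (rule max.coboundedI2)
        qed simp
        also have "\<dots> = max 1 ((r + t) / s) ^ card (Y - {y})" by simp
        also have "\<dots> \<le> K" unfolding K_def
          by (intro power_increasing) (use Y(1) card_Diff1_le[of Y y] in auto)
        finally show ?thesis .
      qed
      have L_bound: "cmod (L z) \<le> 1 / 4" if "cmod z \<le> r" for z
      proof -
        have "cmod (L z) \<le> (\<Sum>y\<in>Y. cmod (f (of_real y) * l y z))" unfolding L_def by (rule norm_sum)
        also have "\<dots> \<le> (\<Sum>y\<in>Y. \<epsilon> * K)"
        proof (rule sum_mono)
          fix y assume y: "y \<in> Y"
          show "cmod (f (of_real y) * l y z) \<le> \<epsilon> * K"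
            unfolding norm_mult by (intro mult_mono small l_bound y that) (use \<epsilon> in auto)
        qed
        also have "\<dots> = 1 / 4" using \<epsilon>(2) Y(1) by simp
        finally show ?thesis .
      qed
      have L_hol: "L holomorphic_on UNIV" unfolding L_def l_def divide_inverse by (intro holomorphic_intros)
      have L_eq: "L (of_real y) = f (of_real y)" if y: "y \<in> Y" for y
      proof -
        have "l y (of_real y) = 1" unfolding l_def by (intro prod.neutral) auto
        moreover have "l x (of_real y) = 0" if "x \<in> Y - {y}" for x
        proof -
          have "y \<in> Y - {x}" "(of_real y - of_real y) / of_real (x - y) = (0::complex)"
            using that y by auto
          then show ?thesis unfolding l_def using fin by (intro prod_zero) auto
        qed
        moreover have "L (of_real y) = f (of_real y) * l y (of_real y)
            + (\<Sum>x\<in>Y - {y}. f (of_real x) * l x (of_real y))"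
          unfolding L_def using fin y by (simp add: sum.remove)
        ultimately show ?thesis by simp
      qed
      have "\<exists>g. g holomorphic_on UNIV \<and> (\<forall>z. f z - L z = g z * (\<Prod>y\<in>of_real ` Y. z - y))"
        by (rule holomorphic_factor_zeros)
           (use fin f(1) L_hol L_eq in \<open>auto intro!: holomorphic_intros\<close>)
      then obtain g where g: "g holomorphic_on UNIV"
        "\<And>z. f z - L z = g z * (\<Prod>y\<in>of_real ` Y. z - y)" by blast
      have prodY: "cmod (\<Prod>y\<in>of_real ` Y. z - y) = (\<Prod>y\<in>Y. cmod (z - of_real y))" for z :: complex
        by (simp add: prod.reindex inj_on_def prod_norm)
      define D where "D = exp (C * r) + 1 / 4"
      \<comment> \<open>Cauchy's inequality for the derivative of order 0 serves as the maximum
        principle.\<close>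
      have "cmod ((deriv ^^ 0) g 0) \<le> fact 0 * (D / (3 * t) ^ n) / r ^ 0"
      proof (rule Cauchy_inequality)
        show "g holomorphic_on ball 0 r" using g(1) holomorphic_on_subset by blast
        show "continuous_on (cball 0 r) g"
          using g(1) holomorphic_on_imp_continuous_on holomorphic_on_subset by blast
        show "0 < r" using assms by (simp add: r_def)
        fix z :: complex assume "cmod (0 - z) = r"
        then have z: "cmod z = r" by simp
        have "(3 * t) ^ n = (\<Prod>y\<in>Y. 3 * t)" using Y(1) by simp
        also have "\<dots> \<le> (\<Prod>y\<in>Y. cmod (z - of_real y))"
        proof (intro prod_mono conjI)
          fix y assume "y \<in> Y"
          then show "3 * t \<le> cmod (z - of_real y)"
            using norm_triangle_ineq2[of z "of_real y"] z Y(2) by (auto simp: r_def)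
        qed (use assms in simp)
        finally have "cmod (g z) * (3 * t) ^ n \<le> cmod (g z) * (\<Prod>y\<in>Y. cmod (z - of_real y))"
          by (intro mult_left_mono) auto
        also have "\<dots> = cmod (f z - L z)" by (simp add: g(2) norm_mult prodY)
        also have "\<dots> \<le> cmod (f z) + cmod (L z)" by (rule norm_triangle_ineq4)
        also have "\<dots> \<le> D" using f(3)[of z] L_bound[of z] z by (simp add: D_def)
        finally show "cmod (g z) \<le> D / (3 * t) ^ n" using assms by (simp add: field_simps)
      qed
      then have g0: "cmod (g 0) \<le> D / (3 * t) ^ n" by simp
      have "cmod (f 0 - L 0) \<ge> cmod (f 0) - cmod (L 0)" by (rule norm_triangle_ineq2)
      then have "3 / 4 \<le> cmod (f 0 - L 0)" using L_bound[of 0] f(2) assms by (simp add: r_def)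
      also have "\<dots> = cmod (g 0) * (\<Prod>y\<in>Y. \<bar>y\<bar>)" using prodY[of 0] g(2)[of 0] by (simp add: norm_mult)
      also have "\<dots> \<le> (D / (3 * t) ^ n) * (\<Prod>y\<in>Y. t)"
        using Y(2) g0 by (intro mult_mono prod_mono) (auto intro: prod_nonneg simp: D_def assms less_imp_le add_nonneg_nonneg)
      also have "\<dots> = D / 3 ^ n" using Y(1) assms by (simp add: power_mult_distrib)
      also have "\<dots> < 1 / 2" using n(1) by (simp add: D_def field_simps)
      finally show False by simp
    qed
    then show "\<exists>\<epsilon>>0. \<forall>f (Y::real set).
    f holomorphic_on UNIV \<longrightarrow> f 0 = 1 \<longrightarrow> (\<forall>z. cmod (f z) \<le> exp (C * cmod z)) \<longrightarrow>
    card Y = n \<longrightarrow> Y \<subseteq> {0..t} \<longrightarrow> (\<forall>x\<in>Y. \<forall>y\<in>Y. x \<noteq> y \<longrightarrow> \<bar>x - y\<bar> \<ge> s) \<longrightarrow>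
    (\<exists>y\<in>Y. cmod (f (of_real y)) > \<epsilon>)"
      by (intro exI[of _ \<epsilon>] conjI \<epsilon>(1) allI impI) (rule ccontr, blast intro: leI)
  qed
qed

section \<open>Masks and their products\<close>

text \<open>The Fourier transform of the uniform measure on \<open>B\<close>. The argument is
  complex because the bound on near-zeros is about entire functions.\<close>

definition mask :: "int set \<Rightarrow> complex \<Rightarrow> complex" where
  "mask B z = (\<Sum>b\<in>B. exp (- 2 * of_real pi * \<i> * of_int b * z)) / of_nat (card B)"

definition scale :: "(nat \<Rightarrow> int) \<Rightarrow> nat \<Rightarrow> int" where
  "scale a k = (\<Prod>i<k. a i)"

definition mask_prod :: "(nat \<Rightarrow> int) \<Rightarrow> (nat \<Rightarrow> int set) \<Rightarrow> nat \<Rightarrow> complex \<Rightarrow> complex" where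
  "mask_prod a B k z = (\<Prod>i<k. mask (B i) (z / of_int (scale a (Suc i))))"

text \<open>The limit is taken on the real line only; where an entire function is required, a long
  finite product takes its place.\<close>

definition mask_limit :: "(nat \<Rightarrow> int) \<Rightarrow> (nat \<Rightarrow> int set) \<Rightarrow> real \<Rightarrow> complex" where
  "mask_limit a B x = lim (\<lambda>k. mask_prod a B k (of_real x))"

lemma mask_of_real:
  "mask B (of_real x) = (\<Sum>b\<in>B. cis (- (2 * pi * of_int b * x))) / of_nat (card B)"
  by (simp add: mask_def cis_conv_exp algebra_simps)

lemma mask_0 [simp]: "finite B \<Longrightarrow> B \<noteq> {} \<Longrightarrow> mask B 0 = 1"
  by (simp add: mask_def)

lemma exp_int_period: "exp (- 2 * of_real pi * \<i> * of_int b * (z + of_int j)) =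
    exp (- 2 * of_real pi * \<i> * of_int b * z)"
proof -
  have "exp (2 * of_int (- b * j) * of_real pi * \<i>) = 1"
    using exp_integer_2pi[of "of_int (- b * j)"] by simp
  moreover have "- 2 * of_real pi * \<i> * of_int b * (z + of_int j) =
    - 2 * of_real pi * \<i> * of_int b * z + 2 * of_int (- b * j) * of_real pi * \<i>"
    by (simp add: algebra_simps)
  ultimately show ?thesis by (simp only: exp_add mult_1_right)
qed

lemma mask_periodic: "mask B (z + of_int j) = mask B z"
  unfolding mask_def exp_int_period ..

lemma norm_cis_diff_le: "cmod (cis x - cis y) \<le> \<bar>x - y\<bar>"
proof -
  have "cis x - cis y = cis y * (cis (x - y) - 1)"
    by (simp add: algebra_simps cis_mult)
  then have "cmod (cis x - cis y) = cmod (cis (x - y) - 1)" by (simp add: norm_mult)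
  also have "\<dots> \<le> \<bar>x - y\<bar>"
    using iexp_approx1[of "x - y" 0] by (simp add: cis_conv_exp)
  finally show ?thesis .
qed

lemma norm_mask_of_real_le_1: "cmod (mask B (of_real x)) \<le> 1"
proof -
  have "cmod (\<Sum>b\<in>B. cis (- (2 * pi * of_int b * x))) \<le> real (card B)"
    using norm_sum[of "\<lambda>b. cis (- (2 * pi * of_int b * x))" B] by simp
  then show ?thesis by (cases "card B = 0") (simp_all add: mask_of_real norm_divide)
qed

lemma norm_mask_le_exp:
  assumes "\<And>b. b \<in> B \<Longrightarrow> \<bar>real_of_int b\<bar> \<le> R"
  shows "cmod (mask B z) \<le> exp (2 * pi * R * cmod z)"
proof -
  have "cmod (\<Sum>b\<in>B. exp (- 2 * of_real pi * \<i> * of_int b * z)) \<le> (\<Sum>b\<in>B. exp (2 * pi * R * cmod z))"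
  proof (rule sum_norm_le)
    fix b assume "b \<in> B"
    have "Re (- 2 * of_real pi * \<i> * of_int b * z) \<le> cmod (- 2 * of_real pi * \<i> * of_int b * z)"
      by (rule complex_Re_le_cmod)
    also have "\<dots> = 2 * pi * \<bar>real_of_int b\<bar> * cmod z" by (simp add: norm_mult)
    also have "\<dots> \<le> 2 * pi * R * cmod z"
      using assms[OF \<open>b \<in> B\<close>] by (intro mult_right_mono mult_left_mono) auto
    finally show "cmod (exp (- 2 * of_real pi * \<i> * of_int b * z)) \<le> exp (2 * pi * R * cmod z)"
      by (simp only: norm_exp_eq_Re exp_le_cancel_iff)
  qed
  then show ?thesis
    by (cases "card B = 0") (simp_all add: mask_def norm_divide divide_le_eq mult.commute)
qed

lemma mask_lipschitz:
  assumes "\<And>b. b \<in> B \<Longrightarrow> \<bar>real_of_int b\<bar> \<le> R" "R \<ge> 0"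
  shows "cmod (mask B (of_real x) - mask B (of_real y)) \<le> 2 * pi * R * \<bar>x - y\<bar>"
proof -
  have "cmod (\<Sum>b\<in>B. cis (- (2 * pi * of_int b * x)) - cis (- (2 * pi * of_int b * y)))
     \<le> (\<Sum>b\<in>B. 2 * pi * R * \<bar>x - y\<bar>)"
  proof (rule sum_norm_le)
    fix b assume "b \<in> B"
    have "cmod (cis (- (2 * pi * of_int b * x)) - cis (- (2 * pi * of_int b * y)))
       \<le> \<bar>- (2 * pi * of_int b * x) - - (2 * pi * of_int b * y)\<bar>" by (rule norm_cis_diff_le)
    also have "- (2 * pi * of_int b * x) - - (2 * pi * of_int b * y) = - 2 * pi * of_int b * (x - y)"
      by (simp add: algebra_simps)
    also have "\<bar>\<dots>\<bar> = 2 * pi * \<bar>of_int b\<bar> * \<bar>x - y\<bar>" by (simp add: abs_mult)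
    also have "\<dots> \<le> 2 * pi * R * \<bar>x - y\<bar>"
      using assms(1)[OF \<open>b \<in> B\<close>] by (intro mult_right_mono mult_left_mono) auto
    finally show "cmod (cis (- (2 * pi * of_int b * x)) - cis (- (2 * pi * of_int b * y)))
      \<le> 2 * pi * R * \<bar>x - y\<bar>" .
  qed
  then show ?thesis using assms(2)
    by (cases "card B = 0")
       (simp_all add: mask_of_real sum_subtractf norm_divide divide_le_eq mult.commute
         flip: diff_divide_distrib)
qed

text \<open>Expanding the squares gives a double sum over digits whose off-diagonal terms cancel for
  every shift \<open>y\<close>. There are two uses: with \<open>card L = card B\<close> this is
  Parseval for a single digit set, and with \<open>L\<close> running over all residues modulo
  \<open>a\<close> the value is \<open>a / card B\<close>.\<close>

lemma sum_norm_mask_squared: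
  fixes \<theta> :: "'l \<Rightarrow> real"
  assumes B: "finite B" "B \<noteq> {}"
    and orth: "\<And>b b'. b \<in> B \<Longrightarrow> b' \<in> B \<Longrightarrow> b \<noteq> b' \<Longrightarrow>
      (\<Sum>l\<in>L. cis (- (2 * pi * of_int (b - b') * \<theta> l))) = 0"
  shows "(\<Sum>l\<in>L. (cmod (mask B (of_real (y + \<theta> l))))\<^sup>2) = real (card L) / real (card B)"
proof -
  define q where "q = card B"
  have q: "q > 0" using B by (simp add: q_def card_gt_0_iff)
  have "complex_of_real (\<Sum>l\<in>L. (cmod (mask B (of_real (y + \<theta> l))))\<^sup>2) =
     (\<Sum>l\<in>L. mask B (of_real (y + \<theta> l)) * cnj (mask B (of_real (y + \<theta> l))))"
    by (simp only: of_real_sum complex_norm_square)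
  also have "\<dots> = (\<Sum>l\<in>L. \<Sum>b\<in>B. \<Sum>b'\<in>B. cis (- (2 * pi * of_int (b - b') * y)) *
       cis (- (2 * pi * of_int (b - b') * \<theta> l)) / of_nat q ^ 2)"
  proof (rule sum.cong[OF refl])
    fix l
    have "mask B (of_real (y + \<theta> l)) * cnj (mask B (of_real (y + \<theta> l))) =
      (\<Sum>b\<in>B. cis (- (2 * pi * of_int b * (y + \<theta> l)))) *
      (\<Sum>b'\<in>B. cis (2 * pi * of_int b' * (y + \<theta> l))) / of_nat q ^ 2"
      unfolding mask_of_real by (simp add: q_def cis_cnj power2_eq_square)
    also have "\<dots> = (\<Sum>b\<in>B. \<Sum>b'\<in>B. cis (- (2 * pi * of_int b * (y + \<theta> l))) *
       cis (2 * pi * of_int b' * (y + \<theta> l)) / of_nat q ^ 2)"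
      by (simp add: sum_product sum_divide_distrib)
    also have "\<dots> = (\<Sum>b\<in>B. \<Sum>b'\<in>B. cis (- (2 * pi * of_int (b - b') * y)) *
       cis (- (2 * pi * of_int (b - b') * \<theta> l)) / of_nat q ^ 2)"
      by (intro sum.cong refl) (simp add: cis_mult algebra_simps)
    finally show "mask B (of_real (y + \<theta> l)) * cnj (mask B (of_real (y + \<theta> l))) = \<dots>" .
  qed
  also have "\<dots> = (\<Sum>b\<in>B. \<Sum>b'\<in>B. \<Sum>l\<in>L. cis (- (2 * pi * of_int (b - b') * y)) *
       cis (- (2 * pi * of_int (b - b') * \<theta> l)) / of_nat q ^ 2)"
    by (subst sum.swap, rule sum.cong[OF refl], rule sum.swap)
  also have "\<dots> = (\<Sum>b\<in>B. \<Sum>b'\<in>B. cis (- (2 * pi * of_int (b - b') * y)) / of_nat q ^ 2 *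
       (\<Sum>l\<in>L. cis (- (2 * pi * of_int (b - b') * \<theta> l))))"
    by (simp add: sum_distrib_left)
  also have "\<dots> = (\<Sum>b\<in>B. \<Sum>b'\<in>B. if b = b' then of_nat (card L) / of_nat q ^ 2 else 0)"
  proof (intro sum.cong refl)
    fix b b' assume b: "b \<in> B" "b' \<in> B"
    show "cis (- (2 * pi * of_int (b - b') * y)) / of_nat q ^ 2 *
       (\<Sum>l\<in>L. cis (- (2 * pi * of_int (b - b') * \<theta> l))) =
       (if b = b' then of_nat (card L) / of_nat q ^ 2 else 0)"
    proof (cases "b = b'")
      case False
      then show ?thesis using orth[OF b] by simp
    qed simp
  qed
  also have "\<dots> = (\<Sum>b\<in>B. of_nat (card L) / of_nat q ^ 2)"
    by (intro sum.cong refl) (use B in simp)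
  also have "\<dots> = complex_of_real (real (card L) / real (card B))"
    using q by (simp add: q_def power2_eq_square)
  finally show ?thesis by (simp only: of_real_eq_iff)
qed

text \<open>A geometric sum over a number different from 1 whose \<open>a\<close>-th power is
  1.\<close>

lemma sum_cis_residues:
  fixes c t a :: int
  assumes "a > 0" "\<not> a dvd c * t"
  shows "(\<Sum>l<nat a. cis (- (2 * pi * of_int c * (of_int t * real l / of_int a)))) = 0"
proof -
  define z where "z = cis (- (2 * pi * of_int (c * t) / of_int a))"
  have zl: "cis (- (2 * pi * of_int c * (of_int t * real l / of_int a))) = z ^ l" for l
    unfolding z_def Complex.DeMoivre by (rule arg_cong[of _ _ cis]) (simp add: field_simps)
  have "z ^ nat a = cis (2 * pi * of_int (- c * t))"
    unfolding z_def Complex.DeMoivre using assms(1)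
    by (intro arg_cong[of _ _ cis]) (simp add: field_simps)
  then have za: "z ^ nat a = 1" using cis_multiple_2pi[of "of_int (- c * t)"] by simp
  have "z \<noteq> 1"
  proof
    assume "z = 1"
    then have "cos (2 * pi * (of_int (c * t) / of_int a)) = 1"
      unfolding z_def by (simp add: complex_eq_iff)
    then obtain j where "2 * pi * (of_int (c * t) / of_int a) = real_of_int j * 2 * pi"
      by (auto simp only: cos_one_2pi_int)
    then have "2 * pi * (of_int (c * t) / of_int a) = 2 * pi * real_of_int j"
      by (simp only: mult_ac)
    then have "real_of_int (c * t) / of_int a = of_int j"
      by (simp only: mult_cancel_left) simp
    then have "real_of_int (c * t) = of_int (a * j)" using assms(1) by (simp add: field_simps)
    then have "c * t = a * j" by (simp only: of_int_eq_iff)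
    then show False using assms(2) by simp
  qed
  have "(z - 1) * (\<Sum>l<nat a. z ^ l) = z ^ nat a - 1" by (simp add: power_diff_1_eq)
  then show ?thesis using za \<open>z \<noteq> 1\<close> unfolding zl by simp
qed

section \<open>Estimates for mask products, uniform over all tails\<close>

locale digit_sequence =
  fixes a :: "nat \<Rightarrow> int" and B :: "nat \<Rightarrow> int set" and R :: real
  assumes a_ge_2: "\<And>i. a i \<ge> 2"
    and finite_B: "\<And>i. finite (B i)"
    and B_nonempty: "\<And>i. B i \<noteq> {}"
    and B_bounded: "\<And>i b. b \<in> B i \<Longrightarrow> \<bar>real_of_int b\<bar> \<le> R"
begin

abbreviation tail_limit :: "nat \<Rightarrow> real \<Rightarrow> complex" where
  "tail_limit k \<equiv> mask_limit (\<lambda>i. a (k + i)) (\<lambda>i. B (k + i))"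

text \<open>Serves as exponential type of all finite products and as Lipschitz constant of the
  products and their limits: since \<open>a i \<ge> 2\<close>, the reciprocals of the scales sum to
  at most 1. It depends on \<open>R\<close> only and is thus unchanged by shifts.\<close>

definition C :: real where "C = 2 * pi * R"

lemma R_nonneg: "R \<ge> 0"
proof -
  obtain b where "b \<in> B 0" using B_nonempty[of 0] by blast
  from B_bounded[OF this] show ?thesis by linarith
qed

lemma C_nonneg: "C \<ge> 0"
  by (simp add: C_def R_nonneg)

lemma shift: "digit_sequence (\<lambda>i. a (k + i)) (\<lambda>i. B (k + i)) R"
  by unfold_locales (use a_ge_2 finite_B B_nonempty B_bounded in auto)

lemma scale_0 [simp]: "scale a 0 = 1"
  by (simp add: scale_def)

lemma scale_Suc: "scale a (Suc k) = scale a k * a k"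
  by (simp add: scale_def)

lemma scale_ge: "2 ^ k \<le> scale a k"
proof (induction k)
  case (Suc k)
  have "2 ^ k * 2 \<le> scale a k * a k"
    using Suc a_ge_2[of k] order_trans[OF zero_le_power[of 2 k] Suc] by (intro mult_mono) auto
  then show ?case by (simp add: scale_Suc)
qed simp

lemma scale_pos: "scale a k > 0"
  by (rule less_le_trans[OF _ scale_ge]) simp

lemma real_scale_pos: "real_of_int (scale a k) > 0"
  using scale_pos by simp

lemma real_scale_ge: "2 ^ k \<le> real_of_int (scale a k)"
  using scale_ge[of k] by (metis of_int_le_iff of_int_numeral of_int_power)

lemma scale_add: "scale a (k + p) = scale a k * scale (\<lambda>i. a (k + i)) p"
  by (induction p) (simp_all add: scale_def prod.lessThan_Suc mult.assoc)

lemma mask_prod_0 [simp]: "mask_prod a B k 0 = 1"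
  using finite_B B_nonempty by (simp add: mask_prod_def)

lemma mask_prod_add:
  "mask_prod a B (k + p) z =
     mask_prod a B k z * mask_prod (\<lambda>i. a (k + i)) (\<lambda>i. B (k + i)) p (z / of_int (scale a k))"
proof (induction p)
  case (Suc p)
  have "scale a (Suc (k + p)) = scale a k * scale (\<lambda>i. a (k + i)) (Suc p)"
    using scale_add[of k "Suc p"] by simp
  then show ?case using Suc by (simp add: mask_prod_def prod.lessThan_Suc mult.assoc)
qed (simp add: mask_prod_def)

text \<open>The period of each factor divides \<open>scale a k\<close>. This is why frequencies of
  the \<open>k\<close>-th finite convolution can be moved by multiples of
  \<open>scale a k\<close>.\<close>

lemma mask_prod_periodic:
  "mask_prod a B k (z + of_int (scale a k) * of_int j) = mask_prod a B k z"
  unfolding mask_prod_def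
proof (rule prod.cong[OF refl])
  fix i assume "i \<in> {..<k}"
  then have "scale a k = scale a (Suc i) * scale (\<lambda>l. a (Suc i + l)) (k - Suc i)"
    using scale_add[of "Suc i" "k - Suc i"] by simp
  then have "(z + of_int (scale a k) * of_int j) / of_int (scale a (Suc i)) =
     z / of_int (scale a (Suc i)) + of_int (scale (\<lambda>l. a (Suc i + l)) (k - Suc i) * j)"
    using scale_pos[of "Suc i"] by (simp add: field_simps)
  then show "mask (B i) ((z + of_int (scale a k) * of_int j) / of_int (scale a (Suc i))) =
    mask (B i) (z / of_int (scale a (Suc i)))" by (simp only: mask_periodic)
qed

lemma mask_of_real_divide: "mask (B i) (of_real x / of_int j) = mask (B i) (of_real (x / of_int j))"
  by simp

lemma norm_mask_prod_le_1: "cmod (mask_prod a B k (of_real x)) \<le> 1"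
  unfolding mask_prod_def prod_norm [symmetric]
proof (intro prod_le_1 conjI)
  fix i
  show "cmod (mask (B i) (of_real x / of_int (scale a (Suc i)))) \<le> 1"
    using norm_mask_of_real_le_1[of "B i" "x / of_int (scale a (Suc i))"] by simp
qed simp

lemma sum_inverse_scale_le: "(\<Sum>i<k. 1 / real_of_int (scale a (Suc i))) \<le> 1"
proof -
  have "(\<Sum>i<k. 1 / real_of_int (scale a (Suc i))) \<le> (\<Sum>i<k. (1/2) ^ Suc i)"
  proof (rule sum_mono)
    fix i
    have "1 / real_of_int (scale a (Suc i)) \<le> 1 / 2 ^ Suc i"
      by (intro divide_left_mono real_scale_ge) (use scale_pos[of "Suc i"] in auto)
    then show "1 / real_of_int (scale a (Suc i)) \<le> (1/2) ^ Suc i"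
      by (simp add: power_one_over)
  qed
  also have "\<dots> = (1/2) * (\<Sum>i<k. (1/2) ^ i)" by (simp add: sum_distrib_left)
  also have "\<dots> = 1 - (1/2) ^ k" by (simp add: sum_gp_strict)
  also have "\<dots> \<le> 1" by simp
  finally show ?thesis .
qed

lemma norm_mask_prod_le_exp: "cmod (mask_prod a B k z) \<le> exp (C * cmod z)"
proof -
  have "cmod (mask_prod a B k z) = (\<Prod>i<k. cmod (mask (B i) (z / of_int (scale a (Suc i)))))"
    by (simp add: mask_prod_def prod_norm)
  also have "\<dots> \<le> (\<Prod>i<k. exp (C * cmod z * (1 / real_of_int (scale a (Suc i)))))"
  proof (intro prod_mono conjI)
    fix i
    have "cmod (mask (B i) (z / of_int (scale a (Suc i)))) \<le>
      exp (2 * pi * R * cmod (z / of_int (scale a (Suc i))))"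
      by (rule norm_mask_le_exp) (use B_bounded in auto)
    then show "cmod (mask (B i) (z / of_int (scale a (Suc i))))
       \<le> exp (C * cmod z * (1 / real_of_int (scale a (Suc i))))"
      using scale_pos[of "Suc i"] by (simp add: C_def norm_divide)
  qed simp
  also have "\<dots> = exp (C * cmod z * (\<Sum>i<k. 1 / real_of_int (scale a (Suc i))))"
    by (simp only: exp_sum[symmetric] finite_lessThan sum_distrib_left)
  also have "\<dots> \<le> exp (C * cmod z * 1)"
    using sum_inverse_scale_le[of k] C_nonneg
    by (subst exp_le_cancel_iff, intro mult_left_mono) auto
  finally show ?thesis by simp
qed

lemma holomorphic_mask_prod: "mask_prod a B k holomorphic_on A"
  unfolding mask_prod_def mask_def by (intro holomorphic_intros) (use scale_pos in force)+

lemma mask_prod_lipschitz: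
  "cmod (mask_prod a B k (of_real x) - mask_prod a B k (of_real y)) \<le> C * \<bar>x - y\<bar>"
proof -
  have "cmod (mask_prod a B k (of_real x) - mask_prod a B k (of_real y)) \<le>
    (\<Sum>i<k. cmod (mask (B i) (of_real (x / of_int (scale a (Suc i))))
       - mask (B i) (of_real (y / of_int (scale a (Suc i))))))"
    unfolding mask_prod_def mask_of_real_divide
    by (intro norm_prod_diff norm_mask_of_real_le_1)
  also have "\<dots> \<le> (\<Sum>i<k. C * \<bar>x - y\<bar> * (1 / real_of_int (scale a (Suc i))))"
  proof (rule sum_mono)
    fix i
    have "cmod (mask (B i) (of_real (x / of_int (scale a (Suc i))))
       - mask (B i) (of_real (y / of_int (scale a (Suc i))))) \<le>
      2 * pi * R * \<bar>x / of_int (scale a (Suc i)) - y / of_int (scale a (Suc i))\<bar>"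
      by (rule mask_lipschitz) (use B_bounded R_nonneg in auto)
    also have "x / of_int (scale a (Suc i)) - y / of_int (scale a (Suc i)) =
       (x - y) / of_int (scale a (Suc i))" by (simp add: diff_divide_distrib)
    also have "2 * pi * R * \<bar>(x - y) / of_int (scale a (Suc i))\<bar> =
       C * \<bar>x - y\<bar> * (1 / real_of_int (scale a (Suc i)))"
      using scale_pos[of "Suc i"] by (simp add: C_def)
    finally show "cmod (mask (B i) (of_real (x / of_int (scale a (Suc i))))
       - mask (B i) (of_real (y / of_int (scale a (Suc i)))))
       \<le> C * \<bar>x - y\<bar> * (1 / real_of_int (scale a (Suc i)))" .
  qed
  also have "\<dots> = C * \<bar>x - y\<bar> * (\<Sum>i<k. 1 / real_of_int (scale a (Suc i)))"
    by (simp only: sum_distrib_left)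
  also have "\<dots> \<le> C * \<bar>x - y\<bar> * 1"
    using sum_inverse_scale_le[of k] C_nonneg by (intro mult_left_mono) auto
  finally show ?thesis by simp
qed

text \<open>The factors from \<open>k\<close> on form a shifted product at
  \<open>x / scale a k\<close>, and the Lipschitz bound compares it with its value 1 at 0.\<close>

lemma mask_prod_tail:
  "cmod (mask_prod a B (k + p) (of_real x) - mask_prod a B k (of_real x)) \<le> C * \<bar>x\<bar> / 2 ^ k"
proof -
  interpret sh: digit_sequence "\<lambda>i. a (k + i)" "\<lambda>i. B (k + i)" R by (rule shift)
  let ?y = "x / of_int (scale a k)"
  have "mask_prod a B (k + p) (of_real x) - mask_prod a B k (of_real x) =
    mask_prod a B k (of_real x) *
     (mask_prod (\<lambda>i. a (k + i)) (\<lambda>i. B (k + i)) p (of_real ?y) - 1)"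
    by (simp add: mask_prod_add algebra_simps)
  then have "cmod (mask_prod a B (k + p) (of_real x) - mask_prod a B k (of_real x)) =
    cmod (mask_prod a B k (of_real x)) *
     cmod (mask_prod (\<lambda>i. a (k + i)) (\<lambda>i. B (k + i)) p (of_real ?y) - 1)"
    by (simp only: norm_mult)
  also have "\<dots> \<le> 1 * (C * \<bar>?y\<bar>)"
    using sh.mask_prod_lipschitz[of p ?y 0] norm_mask_prod_le_1 sh.C_def C_def
    by (intro mult_mono) auto
  also have "\<bar>?y\<bar> = \<bar>x\<bar> / of_int (scale a k)" using scale_pos[of k] by simp
  also have "1 * (C * (\<bar>x\<bar> / of_int (scale a k))) \<le> C * (\<bar>x\<bar> / 2 ^ k)"
  proof -
    have "\<bar>x\<bar> / of_int (scale a k) \<le> \<bar>x\<bar> / 2 ^ k"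
      by (intro divide_left_mono real_scale_ge) (use scale_pos[of k] in auto)
    from mult_left_mono[OF this C_nonneg] show ?thesis by simp
  qed
  finally show ?thesis by simp
qed

lemma mask_prod_tendsto:
  "(\<lambda>k. mask_prod a B k (of_real x)) \<longlonglongrightarrow> mask_limit a B x"
proof -
  have "Cauchy (\<lambda>k. mask_prod a B k (of_real x))"
  proof (rule CauchyI')
    fix e :: real assume "e > 0"
    have "(\<lambda>k. C * \<bar>x\<bar> / 2 ^ k) \<longlonglongrightarrow> 0" by real_asymp
    then have "\<forall>\<^sub>F k in sequentially. C * \<bar>x\<bar> / 2 ^ k < e"
      using \<open>e > 0\<close> by (rule order_tendstoD)
    then obtain K where K: "C * \<bar>x\<bar> / 2 ^ k < e" if "k \<ge> K" for k
      by (auto simp: eventually_sequentially)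
    show "\<exists>M. \<forall>m\<ge>M. \<forall>n>m. dist (mask_prod a B m (of_real x)) (mask_prod a B n (of_real x)) < e"
    proof (intro exI allI impI)
      fix m n assume "m \<ge> K" "n > m"
      then have "cmod (mask_prod a B n (of_real x) - mask_prod a B m (of_real x)) < e"
        using mask_prod_tail[of m "n - m" x] K[of m] by simp
      then show "dist (mask_prod a B m (of_real x)) (mask_prod a B n (of_real x)) < e"
        by (simp add: dist_norm norm_minus_commute)
    qed
  qed
  then show ?thesis unfolding mask_limit_def by (simp add: Cauchy_convergent_iff convergent_LIMSEQ_iff)
qed

lemma mask_limit_0 [simp]: "mask_limit a B 0 = 1"
  using mask_prod_tendsto[of 0] by (simp add: LIMSEQ_const_iff)

lemma norm_mask_limit_le_1: "cmod (mask_limit a B x) \<le> 1"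
  by (rule LIMSEQ_le_const2[OF tendsto_norm[OF mask_prod_tendsto]])
     (use norm_mask_prod_le_1 in auto)

lemma mask_limit_lipschitz: "cmod (mask_limit a B x - mask_limit a B y) \<le> C * \<bar>x - y\<bar>"
  by (rule LIMSEQ_le_const2[OF tendsto_norm[OF tendsto_diff[OF mask_prod_tendsto mask_prod_tendsto]]])
     (use mask_prod_lipschitz in auto)

lemma mask_limit_near_0: "cmod (mask_limit a B x - 1) \<le> C * \<bar>x\<bar>"
  using mask_limit_lipschitz[of x 0] by simp

lemma mask_limit_approx: "cmod (mask_limit a B x - mask_prod a B k (of_real x)) \<le> C * \<bar>x\<bar> / 2 ^ k"
proof (rule LIMSEQ_le_const2)
  show "(\<lambda>p. cmod (mask_prod a B (p + k) (of_real x) - mask_prod a B k (of_real x)))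
      \<longlonglongrightarrow> cmod (mask_limit a B x - mask_prod a B k (of_real x))"
    by (rule tendsto_norm[OF tendsto_diff[OF LIMSEQ_ignore_initial_segment[OF mask_prod_tendsto] tendsto_const]])
  show "\<exists>N. \<forall>n\<ge>N. cmod (mask_prod a B (n + k) (of_real x) - mask_prod a B k (of_real x))
     \<le> C * \<bar>x\<bar> / 2 ^ k"
    using mask_prod_tail[of k _ x] by (simp add: add.commute)
qed

lemma mask_limit_split:
  "mask_limit a B x = mask_prod a B k (of_real x) *
     tail_limit k (x / of_int (scale a k))"
proof (rule LIMSEQ_unique)
  interpret sh: digit_sequence "\<lambda>i. a (k + i)" "\<lambda>i. B (k + i)" R by (rule shift)
  show "(\<lambda>p. mask_prod a B (p + k) (of_real x)) \<longlonglongrightarrow> mask_limit a B x"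
    by (rule LIMSEQ_ignore_initial_segment[OF mask_prod_tendsto])
  have "(\<lambda>p. mask_prod a B k (of_real x) *
     mask_prod (\<lambda>i. a (k + i)) (\<lambda>i. B (k + i)) p (of_real (x / of_int (scale a k))))
     \<longlonglongrightarrow> mask_prod a B k (of_real x) *
     tail_limit k (x / of_int (scale a k))"
    by (intro tendsto_mult tendsto_const sh.mask_prod_tendsto)
  then show "(\<lambda>p. mask_prod a B (p + k) (of_real x)) \<longlonglongrightarrow> mask_prod a B k (of_real x) *
     tail_limit k (x / of_int (scale a k))"
    by (simp add: add.commute[of _ k] mask_prod_add)
qed

end

section \<open>Lower bounds for tails\<close>

locale residue_sequence = digit_sequence +
  fixes Q :: nat
  assumes distinct_mod: "\<And>i b b'. b \<in> B i \<Longrightarrow> b' \<in> B i \<Longrightarrow> b \<noteq> b' \<Longrightarrow> \<not> a i dvd b - b'"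
    and card_B_le: "\<And>i. card (B i) \<le> Q"
begin

lemma residue_shift: "residue_sequence (\<lambda>i. a (k + i)) (\<lambda>i. B (k + i)) R Q"
  by (rule residue_sequence.intro[OF shift], unfold_locales) (use distinct_mod card_B_le in auto)

text \<open>Chosen so that \<open>\<theta>\<^sup>2 < 1 / (q (q + 1))\<close> for \<open>0 < q \<le> Q\<close>.\<close>

definition \<theta> :: real where "\<theta> = 1 / (real Q + 1)"

lemma \<theta>_pos: "\<theta> > 0" and \<theta>_le_1: "\<theta> \<le> 1"
  by (simp_all add: \<theta>_def)

text \<open>By coprimality \<open>t * l\<close> runs through all residues modulo \<open>a i\<close>,
  on which the characters of digits that are distinct modulo \<open>a i\<close> are
  orthogonal.\<close>

lemma sum_residues_mask:
  fixes t :: nat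
  assumes "coprime (int t) (a i)"
  shows "(\<Sum>l<nat (a i). (cmod (mask (B i) (of_real ((y + real t * real l) / of_int (a i)))))\<^sup>2)
    = real_of_int (a i) / real (card (B i))"
proof -
  have "(\<Sum>l<nat (a i). cis (- (2 * pi * of_int (b - b') * (of_int (int t) * real l / of_int (a i))))) = 0"
    if "b \<in> B i" "b' \<in> B i" "b \<noteq> b'" for b b'
  proof (rule sum_cis_residues)
    show "a i > 0" using a_ge_2[of i] by simp
    show "\<not> a i dvd (b - b') * int t"
      using distinct_mod[OF that] assms by (simp add: coprime_dvd_mult_left_iff coprime_commute)
  qed
  from sum_norm_mask_squared[OF finite_B B_nonempty this, where y = "y / of_int (a i)"]
  show ?thesis using a_ge_2[of i] by (simp add: add_divide_distrib)
qed

text \<open>With \<open>q = card (B i)\<close> the squares sum to \<open>a / q\<close> and none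
  exceeds 1, while those below \<theta> contribute less than \<open>a / (q (q + 1))\<close>
  altogether. So more than \<open>a / (q + 1)\<close> residues remain: at least one, and at least
  two when \<open>a \<ge> q + 1\<close>.\<close>

lemma card_large_residues:
  fixes t :: nat
  assumes "coprime (int t) (a i)"
  shows "card {l \<in> {..<nat (a i)}. cmod (mask (B i) (of_real ((y + real t * real l) / of_int (a i)))) \<ge> \<theta>}
    \<ge> (if int (card (B i)) < a i then 2 else 1)"
proof -
  let ?m = "\<lambda>l. cmod (mask (B i) (of_real ((y + real t * real l) / of_int (a i))))"
  define S where "S = {l \<in> {..<nat (a i)}. ?m l \<ge> \<theta>}"
  define q where "q = card (B i)"
  have q: "q > 0" using finite_B B_nonempty by (simp add: q_def card_gt_0_iff)
  have a0: "real_of_int (a i) > 0" using a_ge_2[of i] by simp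
  have "real_of_int (a i) / q = (\<Sum>l<nat (a i). (?m l)\<^sup>2)"
    using sum_residues_mask[OF assms] by (simp add: q_def)
  also have "\<dots> = (\<Sum>l\<in>S. (?m l)\<^sup>2) + (\<Sum>l\<in>{..<nat (a i)} - S. (?m l)\<^sup>2)"
    by (subst add.commute, rule sum.subset_diff) (auto simp: S_def)
  also have "(\<Sum>l\<in>S. (?m l)\<^sup>2) \<le> (\<Sum>l\<in>S. 1)"
    by (intro sum_mono power_le_one norm_mask_of_real_le_1) simp
  also have "(\<Sum>l\<in>{..<nat (a i)} - S. (?m l)\<^sup>2) \<le> (\<Sum>l\<in>{..<nat (a i)} - S. \<theta>\<^sup>2)"
    by (intro sum_mono power_mono) (auto simp: S_def)
  also have "(\<Sum>l\<in>{..<nat (a i)} - S. \<theta>\<^sup>2) \<le> (\<Sum>l\<in>{..<nat (a i)}. \<theta>\<^sup>2)"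
    by (intro sum_mono2) auto
  finally have le: "real_of_int (a i) / q \<le> real (card S) + real_of_int (a i) * \<theta>\<^sup>2"
    using a0 by simp
  have th: "\<theta>\<^sup>2 < 1 / (real q * (real q + 1))"
  proof -
    have "real q * (real q + 1) < (real Q + 1) * (real Q + 1)"
      using card_B_le[of i] q by (intro mult_less_le_imp_less) (auto simp: q_def)
    then have "1 / ((real Q + 1) * (real Q + 1)) < 1 / (real q * (real q + 1))"
      using q by (intro divide_strict_left_mono) auto
    then show ?thesis by (simp add: \<theta>_def power2_eq_square)
  qed
  have "real_of_int (a i) * \<theta>\<^sup>2 < real_of_int (a i) * (1 / (real q * (real q + 1)))"
    using th a0 by (intro mult_strict_left_mono) auto
  moreover have "real_of_int (a i) / q - real_of_int (a i) * (1 / (real q * (real q + 1)))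
     = real_of_int (a i) / (real q + 1)"
  proof -
    have "1 / real q - 1 / (real q * (real q + 1)) = 1 / (real q + 1)"
      using q by (simp add: divide_simps)
    then have "real_of_int (a i) * (1 / real q - 1 / (real q * (real q + 1))) =
      real_of_int (a i) * (1 / (real q + 1))" by simp
    then show ?thesis by (simp add: right_diff_distrib)
  qed
  ultimately have gt: "real_of_int (a i) / (real q + 1) < real (card S)" using le by linarith
  have "card S \<ge> 1" using gt a0 by (cases "card S = 0") (auto simp: divide_less_0_iff)
  moreover have "card S \<ge> 2" if "int q < a i"
  proof -
    have "1 \<le> real_of_int (a i) / (real q + 1)" using that by (simp add: le_divide_eq)
    then show ?thesis using gt by linarith
  qed
  ultimately show ?thesis by (simp add: S_def q_def)
qed

text \<open>If \<open>x\<close> is a near-zero modulo \<open>t\<close> of the limit, then so are, one level deeper, those points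
  \<open>(x + t l) / a\<close> at which the mask is not small; their number at least doubles at each level
  where \<open>B\<close> is not a complete residue system.\<close>

lemma near_zero_descendants:
  fixes t :: nat
  assumes t: "t > 0" "\<And>i. coprime (int t) (a i)"
    and x: "0 \<le> x" "x < real t"
    and small: "\<And>\<kappa>::int. cmod (mask_limit a B (x + real t * of_int \<kappa>)) \<le> \<epsilon>"
  shows "\<exists>Y. finite Y \<and> Y \<subseteq> {0..<real t} \<and> Y \<subseteq> range (\<lambda>j::int. (x + real t * of_int j) / of_int (scale a i)) \<and>
     2 ^ card {j. j < i \<and> int (card (B j)) < a j} \<le> card Y \<and>
     (\<forall>y\<in>Y. \<forall>\<kappa>::int. cmod (tail_limit i (y + real t * of_int \<kappa>)) \<le> \<epsilon> / \<theta> ^ i)"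
proof (induction i)
  case 0
  have "{x} \<subseteq> range (\<lambda>j::int. (x + real t * of_int j) / of_int (scale a 0))"
    by (auto intro!: image_eqI[of _ _ 0])
  then show ?case using x small by (intro exI[of _ "{x}"]) auto
next
  case (Suc i)
  then obtain Y where Y: "finite Y" "Y \<subseteq> {0..<real t}"
    "Y \<subseteq> range (\<lambda>j::int. (x + real t * of_int j) / of_int (scale a i))"
    "2 ^ card {j. j < i \<and> int (card (B j)) < a j} \<le> card Y"
    "\<And>y \<kappa>. y \<in> Y \<Longrightarrow> cmod (tail_limit i (y + real t * of_int \<kappa>)) \<le> \<epsilon> / \<theta> ^ i"
    by blast
  have a0: "real_of_int (a i) > 0" using a_ge_2[of i] by simp
  define Ch where "Ch y = {l \<in> {..<nat (a i)}. cmod (mask (B i) (of_real ((y + real t * real l) / of_int (a i)))) \<ge> \<theta>}" for y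
  define g where "g = (\<lambda>(y, l). (y + real t * real l) / of_int (a i))"
  define Y' where "Y' = g ` (SIGMA y:Y. Ch y)"
  define m where "m = (if int (card (B i)) < a i then 2 else 1 :: nat)"
  have finCh: "finite (Ch y)" for y by (simp add: Ch_def)
  \<comment> \<open>Different pairs give different descendants: as \<open>y\<close> lies in
    \<open>[0, t)\<close>, the number \<open>y + t l\<close> determines \<open>l\<close> as its
    integer quotient by \<open>t\<close>.\<close>
  have inj: "inj_on g (SIGMA y:Y. Ch y)"
  proof (rule inj_onI, clarify)
    fix y l y' l' assume *: "y \<in> Y" "l \<in> Ch y" "y' \<in> Y" "l' \<in> Ch y'" "g (y, l) = g (y', l')"
    have eq: "y + real t * real l = y' + real t * real l'"
      using *(5) a0 by (simp add: g_def)
    have yt: "0 \<le> y" "y < real t" "0 \<le> y'" "y' < real t" using *(1,3) Y(2) by auto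
    have "real l = real l'"
    proof (rule ccontr)
      assume "real l \<noteq> real l'"
      then consider "real l + 1 \<le> real l'" | "real l' + 1 \<le> real l" by fastforce
      then show False
      proof cases
        case 1
        then have "real t * (real l + 1) \<le> real t * real l'" by (intro mult_left_mono) auto
        then show False using eq yt by (simp add: algebra_simps)
      next
        case 2
        then have "real t * (real l' + 1) \<le> real t * real l" by (intro mult_left_mono) auto
        then show False using eq yt by (simp add: algebra_simps)
      qed
    qed
    then show "y = y' \<and> l = l'" using eq by simp
  qed
  have "card Y' = card (SIGMA y:Y. Ch y)" unfolding Y'_def by (rule card_image[OF inj])
  also have "\<dots> = (\<Sum>y\<in>Y. card (Ch y))" using Y(1) finCh by simp
  also have "\<dots> \<ge> (\<Sum>y\<in>Y. m)"
    by (intro sum_mono) (use card_large_residues[OF t(2)] in \<open>simp add: Ch_def m_def\<close>)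
  finally have "card Y * m \<le> card Y'" by simp
  moreover have "2 ^ card {j. j < Suc i \<and> int (card (B j)) < a j} =
     2 ^ card {j. j < i \<and> int (card (B j)) < a j} * m"
  proof (cases "int (card (B i)) < a i")
    case True
    then have "{j. j < Suc i \<and> int (card (B j)) < a j} =
      insert i {j. j < i \<and> int (card (B j)) < a j}" by (auto simp: less_Suc_eq)
    then show ?thesis using True by (simp add: m_def)
  next
    case False
    then have "{j. j < Suc i \<and> int (card (B j)) < a j} = {j. j < i \<and> int (card (B j)) < a j}"
      using less_Suc_eq by auto
    then show ?thesis using False by (simp add: m_def)
  qed
  ultimately have card: "2 ^ card {j. j < Suc i \<and> int (card (B j)) < a j} \<le> card Y'"
    using mult_le_mono1[OF Y(4), of m] by linarith
  have mem: "y' \<in> {0..<real t} \<and>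
       y' \<in> range (\<lambda>j::int. (x + real t * of_int j) / of_int (scale a (Suc i))) \<and>
       cmod (tail_limit (Suc i) (y' + real t * of_int \<kappa>)) \<le> \<epsilon> / \<theta> ^ Suc i"
    if y': "y' \<in> Y'" for y' and \<kappa> :: int
  proof -
    obtain y l where y: "y \<in> Y" "l \<in> Ch y" "y' = (y + real t * real l) / of_int (a i)"
      using y' by (auto simp: Y'_def g_def)
    have yt: "0 \<le> y" "y < real t" using y(1) Y(2) by auto
    have l: "real l \<le> real_of_int (a i) - 1" using y(2) a_ge_2[of i] by (auto simp: Ch_def)
    have "real t * real l \<le> real t * (real_of_int (a i) - 1)" using l by (intro mult_left_mono) auto
    then have "y + real t * real l < real t * real_of_int (a i)" using yt by (simp add: algebra_simps)
    then have 1: "y' \<in> {0..<real t}" using yt a0 by (simp add: y(3) field_simps)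
    obtain j :: int where j: "y = (x + real t * of_int j) / of_int (scale a i)" using y(1) Y(3) by auto
    have s0: "real_of_int (scale a i) > 0" using scale_pos by simp
    have "y' = (x + real t * of_int (j + int l * scale a i)) / of_int (scale a (Suc i))"
      using s0 a0 by (simp add: y(3) j scale_Suc field_simps)
    then have 2: "y' \<in> range (\<lambda>j::int. (x + real t * of_int j) / of_int (scale a (Suc i)))" by blast
    interpret sh: digit_sequence "\<lambda>j. a (i + j)" "\<lambda>j. B (i + j)" R by (rule shift)
    \<comment> \<open>A translate of \<open>y\<close> by a multiple of \<open>t\<close> which
      division by \<open>a i\<close> sends to \<open>y' + t \<kappa>\<close>. Since
      \<open>t \<kappa>\<close> is an integer, the mask there equals the mask at \<open>y'\<close>;
      it is at least \<theta> and can be divided out for all \<kappa>.\<close>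
    define z where "z = y + real t * of_int (int l + a i * \<kappa>)"
    have z: "z / of_int (a i) = y' + real t * of_int \<kappa>"
      using a0 by (simp add: z_def y(3) field_simps)
    have "mask_prod (\<lambda>j. a (i + j)) (\<lambda>j. B (i + j)) 1 (of_real z) = mask (B i) (of_real (z / of_int (a i)))"
      by (simp add: mask_prod_def scale_def)
    also have "z / of_int (a i) = y' + real t * of_int \<kappa>" by (rule z)
    also have "mask (B i) (of_real \<dots>) = mask (B i) (of_real y' + of_int (int t * \<kappa>))" by simp
    also have "\<dots> = mask (B i) (of_real y')" by (rule mask_periodic)
    finally have "tail_limit i z =
       mask (B i) (of_real y') * tail_limit (Suc i) (y' + real t * of_int \<kappa>)"
      using sh.mask_limit_split[of z 1] z by (simp add: scale_def)
    then have "cmod (mask (B i) (of_real y')) *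
      cmod (tail_limit (Suc i) (y' + real t * of_int \<kappa>)) \<le> \<epsilon> / \<theta> ^ i"
      using Y(5)[OF y(1), of "int l + a i * \<kappa>"] by (simp add: z_def norm_mult)
    moreover have "\<theta> * cmod (tail_limit (Suc i) (y' + real t * of_int \<kappa>))
      \<le> cmod (mask (B i) (of_real y')) *
      cmod (tail_limit (Suc i) (y' + real t * of_int \<kappa>))"
      using y(2) by (intro mult_right_mono) (auto simp: Ch_def y(3))
    ultimately have "\<theta> * cmod (tail_limit (Suc i) (y' + real t * of_int \<kappa>))
      \<le> \<epsilon> / \<theta> ^ i" by linarith
    then have 3: "cmod (tail_limit (Suc i) (y' + real t * of_int \<kappa>)) \<le> \<epsilon> / \<theta> ^ Suc i"
      using \<theta>_pos by (simp add: field_simps)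
    show ?thesis using 1 2 3 by blast
  qed
  have "finite Y'" unfolding Y'_def using Y(1) finCh by blast
  then show ?case using card mem by (intro exI[of _ Y']) blast
qed

text \<open>A tail that is at most \<epsilon> on a whole coset of the multiples of \<open>t\<close>
  would have, up to \<open>W\<close> levels deeper, descendants that cannot all be near-zeros. The
  constants are chosen in the order \<open>n\<close> from \<open>C\<close> and \<open>t\<close>,
  \<open>W\<close> from \<open>n\<close>, \<open>s\<close> from \<open>W\<close>, and finally
  \<epsilon>.\<close>

lemma equipositive:
  fixes t :: nat
  assumes t: "t > 0" "\<And>i. coprime (int t) (a i)"
    and window: "\<And>G. \<exists>W. infinite {k. G \<le> card {j. j < W \<and> int (card (B (k + j))) < a (k + j)}}"
  obtains K \<epsilon> where "infinite K" "\<epsilon> > 0"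
    "\<And>k x. k \<in> K \<Longrightarrow> \<exists>\<kappa>::int. \<epsilon> < cmod (tail_limit k (x + real t * of_int \<kappa>))"
proof -
  have t0: "real t > 0" using t(1) by simp
  obtain n where n: "\<And>s. s > 0 \<Longrightarrow> \<exists>\<epsilon>>0. \<forall>f (Y::real set).
    f holomorphic_on UNIV \<longrightarrow> f 0 = 1 \<longrightarrow> (\<forall>z. cmod (f z) \<le> exp (C * cmod z)) \<longrightarrow>
    card Y = n \<longrightarrow> Y \<subseteq> {0..real t} \<longrightarrow> (\<forall>x\<in>Y. \<forall>y\<in>Y. x \<noteq> y \<longrightarrow> \<bar>x - y\<bar> \<ge> s) \<longrightarrow>
    (\<exists>y\<in>Y. cmod (f (of_real y)) > \<epsilon>)"
    by (rule near_zeros_bound[OF t0, of C]) (rule that)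
  obtain W where W: "infinite {k. n \<le> card {j. j < W \<and> int (card (B (k + j))) < a (k + j)}}"
    using window by blast
  \<comment> \<open>A letter above \<open>A\<close> satisfies \<open>C * t / a \<le> 1/4\<close>. If
    all letters of the window are at most \<open>A\<close>, the scale at its end is at most
    \<open>A ^ W\<close>, which gives the separation \<open>s\<close>. The two cases are needed
    because the letters \<open>a\<close> may be unbounded.\<close>
  define A where "A = max 1 (4 * C * real t)"
  have A: "A \<ge> 1" "4 * C * real t \<le> A" by (simp_all add: A_def)
  define s where "s = real t / A ^ W"
  have s: "s > 0" using A t(1) by (simp add: s_def)
  obtain \<epsilon>1 where \<epsilon>1: "\<epsilon>1 > 0" "\<And>f (Y::real set).
    f holomorphic_on UNIV \<Longrightarrow> f 0 = 1 \<Longrightarrow> (\<And>z. cmod (f z) \<le> exp (C * cmod z)) \<Longrightarrow>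
    card Y = n \<Longrightarrow> Y \<subseteq> {0..real t} \<Longrightarrow> (\<And>x y. x\<in>Y \<Longrightarrow> y\<in>Y \<Longrightarrow> x \<noteq> y \<Longrightarrow> \<bar>x - y\<bar> \<ge> s) \<Longrightarrow>
    (\<exists>y\<in>Y. cmod (f (of_real y)) > \<epsilon>1)"
    using n[OF s] by blast
  define \<epsilon> where "\<epsilon> = min (1 / 4) (\<epsilon>1 / 2) * \<theta> ^ W"
  have \<epsilon>: "\<epsilon> > 0" using \<epsilon>1 \<theta>_pos by (simp add: \<epsilon>_def)
  have \<epsilon>i: "\<epsilon> / \<theta> ^ i \<le> min (1 / 4) (\<epsilon>1 / 2)" if "i \<le> W" for i
  proof -
    have "\<theta> ^ W \<le> \<theta> ^ i" using that \<theta>_pos \<theta>_le_1 by (intro power_decreasing) auto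
    then have "\<epsilon> \<le> min (1 / 4) (\<epsilon>1 / 2) * \<theta> ^ i"
      unfolding \<epsilon>_def using \<epsilon>1 by (intro mult_left_mono) auto
    then show ?thesis by (simp only: pos_divide_le_eq[OF zero_less_power[OF \<theta>_pos]])
  qed
  define K where "K = {k. n \<le> card {j. j < W \<and> int (card (B (k + j))) < a (k + j)}}"
  show ?thesis
  proof (rule that[of K \<epsilon>])
    show "infinite K" using W by (simp add: K_def)
    show "\<epsilon> > 0" by fact
    fix k x assume k: "k \<in> K"
    interpret sh: residue_sequence "\<lambda>j. a (k + j)" "\<lambda>j. B (k + j)" R Q by (rule residue_shift)
    show "\<exists>\<kappa>::int. \<epsilon> < cmod (tail_limit k (x + real t * of_int \<kappa>))"
    proof (rule ccontr)
      assume "\<not> ?thesis"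
      then have small: "cmod (tail_limit k (x + real t * of_int \<kappa>)) \<le> \<epsilon>" for \<kappa> :: int
        by (simp add: not_less)
      define x0 where "x0 = x - real t * of_int \<lfloor>x / real t\<rfloor>"
      have x0: "0 \<le> x0" "x0 < real t"
        using floor_divide_lower[OF t0, of x] floor_divide_upper[OF t0, of x]
        by (simp_all add: x0_def algebra_simps)
      have small0: "cmod (tail_limit k (x0 + real t * of_int \<kappa>)) \<le> \<epsilon>" for \<kappa> :: int
        using small[of "\<kappa> - \<lfloor>x / real t\<rfloor>"] by (simp add: x0_def algebra_simps)
      note desc = sh.near_zero_descendants[OF t x0 small0]
      show False
      \<comment> \<open>At a large letter the point \<open>y / a (k + i)\<close> is so close to 0
        that the mask and the next tail are both within 1/4 of 1. Hence the tail at \<open>y\<close>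
        has modulus at least 1/2, although a descendant at this level allows at most 1/4.\<close>
      proof (cases "\<exists>i<W. real_of_int (a (k + i)) > A")
        case True
        then obtain i where i: "i < W" "real_of_int (a (k + i)) > A" by blast
        obtain Y where Y: "finite Y" "Y \<subseteq> {0..<real t}"
          "2 ^ card {j. j < i \<and> int (card (B (k + j))) < a (k + j)} \<le> card Y"
          "\<And>y \<kappa>. y \<in> Y \<Longrightarrow> cmod (sh.tail_limit i (y + real t * of_int \<kappa>)) \<le> \<epsilon> / \<theta> ^ i"
          using desc[of i] by blast
        have "Y \<noteq> {}" using Y(3) by auto
        then obtain y where y: "y \<in> Y" by blast
        then have yt: "0 \<le> y" "y < real t" using Y(2) by auto
        have "cmod (sh.tail_limit i y) \<le> \<epsilon> / \<theta> ^ i"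
          using Y(4)[OF y, of 0] by simp
        also have "\<dots> \<le> 1 / 4" using \<epsilon>i[of i] i by simp
        finally have le: "cmod (sh.tail_limit i y) \<le> 1 / 4" .
        interpret si: digit_sequence "\<lambda>j. a ((k + i) + j)" "\<lambda>j. B ((k + i) + j)" R by (rule shift)
        interpret sj: digit_sequence "\<lambda>j. a ((k + i) + (1 + j))" "\<lambda>j. B ((k + i) + (1 + j))" R
          by (rule si.shift)
        define u where "u = y / of_int (a (k + i))"
        have Cu: "C * \<bar>u\<bar> \<le> 1 / 4"
        proof -
          have "4 * C * y \<le> 4 * C * real t" using yt C_nonneg by (intro mult_left_mono) auto
          also have "\<dots> \<le> real_of_int (a (k + i))" using A i by linarith
          finally show ?thesis using yt a_ge_2[of "k + i"] by (simp add: u_def field_simps)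
        qed
        have "tail_limit (k + i) y =
          mask (B (k + i)) (of_real u) *
          mask_limit (\<lambda>j. a ((k + i) + (1 + j))) (\<lambda>j. B ((k + i) + (1 + j))) u"
          using si.mask_limit_split[of y 1] by (simp add: mask_prod_def scale_def u_def)
        moreover have "cmod (mask (B (k + i)) (of_real u) *
          mask_limit (\<lambda>j. a ((k + i) + (1 + j))) (\<lambda>j. B ((k + i) + (1 + j))) u - 1) \<le>
          cmod (mask (B (k + i)) (of_real u) - 1) +
          cmod (mask_limit (\<lambda>j. a ((k + i) + (1 + j))) (\<lambda>j. B ((k + i) + (1 + j))) u - 1)"
          (is "cmod (?m * ?F - 1) \<le> _")
        proof -
          have "?m * ?F - 1 = (?m - 1) * ?F + (?F - 1)" by (simp add: algebra_simps)
          then have "cmod (?m * ?F - 1) \<le> cmod (?m - 1) * cmod ?F + cmod (?F - 1)"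
            by (metis norm_mult norm_triangle_ineq)
          also have "cmod (?m - 1) * cmod ?F \<le> cmod (?m - 1)"
            by (intro mult_left_le sj.norm_mask_limit_le_1) simp
          finally show ?thesis by simp
        qed
        moreover have "cmod (mask (B (k + i)) (of_real u) - mask (B (k + i)) (of_real 0)) \<le> 2 * pi * R * \<bar>u - 0\<bar>"
          by (rule mask_lipschitz) (use B_bounded R_nonneg in auto)
        moreover have "cmod (mask_limit (\<lambda>j. a ((k + i) + (1 + j))) (\<lambda>j. B ((k + i) + (1 + j))) u - 1) \<le> C * \<bar>u\<bar>"
          by (rule sj.mask_limit_near_0)
        ultimately have "cmod (tail_limit (k + i) y - 1) \<le> 1 / 2"
          using Cu finite_B B_nonempty by (simp add: C_def)
        moreover have "cmod (tail_limit (k + i) y) \<ge>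
          cmod 1 - cmod (1 - tail_limit (k + i) y)"
          by norm
        ultimately show False using le by (simp add: norm_minus_commute add.assoc)
      next
        case False
        then have aA: "real_of_int (a (k + i)) \<le> A" if "i < W" for i using that by (meson not_less)
        obtain Y where Y: "finite Y" "Y \<subseteq> {0..<real t}"
          "Y \<subseteq> range (\<lambda>j::int. (x0 + real t * of_int j) / of_int (scale (\<lambda>j. a (k + j)) W))"
          "2 ^ card {j. j < W \<and> int (card (B (k + j))) < a (k + j)} \<le> card Y"
          "\<And>y \<kappa>. y \<in> Y \<Longrightarrow> cmod (mask_limit (\<lambda>j. a (k + (W + j))) (\<lambda>j. B (k + (W + j))) (y + real t * of_int \<kappa>)) \<le> \<epsilon> / \<theta> ^ W"
          using desc[of W] by blast
        have "n \<le> card {j. j < W \<and> int (card (B (k + j))) < a (k + j)}" using k by (simp add: K_def)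
        also have "\<dots> \<le> 2 ^ \<dots>" by (rule less_imp_le[OF less_exp])
        also have "\<dots> \<le> card Y" by (rule Y(4))
        finally obtain Z where Z: "Z \<subseteq> Y" "card Z = n" by (metis obtain_subset_with_card_n)
        have sc: "real_of_int (scale (\<lambda>j. a (k + j)) W) \<le> A ^ W"
        proof -
          have "real_of_int (scale (\<lambda>j. a (k + j)) W) = (\<Prod>i<W. real_of_int (a (k + i)))"
            by (simp add: scale_def)
          also have "\<dots> \<le> (\<Prod>i<W. A)"
            using aA a_ge_2 by (intro prod_mono) (auto intro: order_trans[of 0 2])
          finally show ?thesis by simp
        qed
        have s0: "real_of_int (scale (\<lambda>j. a (k + j)) W) > 0" using sh.scale_pos by simp
        have sep: "\<bar>y - y'\<bar> \<ge> s" if yy: "y \<in> Z" "y' \<in> Z" "y \<noteq> y'" for y y'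
        proof -
          let ?S = "real_of_int (scale (\<lambda>j. a (k + j)) W)"
          obtain j j' :: int where j: "y = (x0 + real t * of_int j) / ?S" "y' = (x0 + real t * of_int j') / ?S"
            using yy Z(1) Y(3) by (meson imageE subsetD)
          then have "j \<noteq> j'" using yy(3) by auto
          then have "1 \<le> \<bar>real_of_int j - of_int j'\<bar>" by linarith
          then have "real t * 1 \<le> real t * \<bar>real_of_int j - of_int j'\<bar>" by (intro mult_left_mono) auto
          moreover have "y - y' = real t * (real_of_int j - of_int j') / ?S"
            by (simp add: j algebra_simps flip: diff_divide_distrib)
          then have "\<bar>y - y'\<bar> = real t * \<bar>real_of_int j - of_int j'\<bar> / ?S"
            using s0 by (simp add: abs_mult)
          ultimately have "real t / ?S \<le> \<bar>y - y'\<bar>"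
            using s0 by (simp add: divide_right_mono)
          moreover have "s \<le> real t / ?S" unfolding s_def
            using sc s0 by (intro divide_left_mono) auto
          ultimately show ?thesis by linarith
        qed
        interpret sW: digit_sequence "\<lambda>j. a ((k + W) + j)" "\<lambda>j. B ((k + W) + j)" R by (rule shift)
        let ?F = "\<lambda>p. mask_prod (\<lambda>j. a ((k + W) + j)) (\<lambda>j. B ((k + W) + j)) p"
        \<comment> \<open>The bound on near-zeros asks for an entire function, so the tail limit is
          replaced by a finite product within \<open>\<epsilon>1 / 2\<close> of it on
          \<open>[0, t]\<close>.\<close>
        have "(\<lambda>p. C * real t / 2 ^ p) \<longlonglongrightarrow> 0" by real_asymp
        then have "\<forall>\<^sub>F p in sequentially. C * real t / 2 ^ p < \<epsilon>1 / 2"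
          using \<epsilon>1 by (intro order_tendstoD) auto
        then obtain p where p: "C * real t / 2 ^ p < \<epsilon>1 / 2"
          by (auto simp: eventually_sequentially)
        have "\<exists>y\<in>Z. cmod (?F p (of_real y)) > \<epsilon>1"
        proof (rule \<epsilon>1(2))
          show "?F p holomorphic_on UNIV" by (rule sW.holomorphic_mask_prod)
          show "?F p 0 = 1" by (rule sW.mask_prod_0)
          show "cmod (?F p z) \<le> exp (C * cmod z)" for z by (rule sW.norm_mask_prod_le_exp)
          show "card Z = n" by fact
          show "Z \<subseteq> {0..real t}" using Z(1) Y(2) by auto
          show "\<bar>y - y'\<bar> \<ge> s" if "y \<in> Z" "y' \<in> Z" "y \<noteq> y'" for y y' using sep that by blast
        qed
        then obtain y where y: "y \<in> Z" "cmod (?F p (of_real y)) > \<epsilon>1" by blast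
        have yt: "0 \<le> y" "y < real t" using y Z Y(2) by auto
        have "cmod (tail_limit (k + W) y) \<le> \<epsilon> / \<theta> ^ W"
          using Y(5)[of y 0] y Z by (auto simp: add.assoc)
        also have "\<dots> \<le> \<epsilon>1 / 2" using \<epsilon>i[of W] by simp
        finally have 1: "cmod (tail_limit (k + W) y) \<le> \<epsilon>1 / 2" .
        have "cmod (tail_limit (k + W) y - ?F p (of_real y)) \<le> C * \<bar>y\<bar> / 2 ^ p"
          by (rule sW.mask_limit_approx)
        also have "\<dots> \<le> C * real t / 2 ^ p"
          using yt C_nonneg by (intro divide_right_mono mult_left_mono) auto
        finally have 2: "cmod (tail_limit (k + W) y - ?F p (of_real y)) < \<epsilon>1 / 2"
          using p by linarith
        have "cmod (?F p (of_real y)) \<le> cmod (tail_limit (k + W) y) +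
           cmod (tail_limit (k + W) y - ?F p (of_real y))"
          by norm
        then show False using 1 2 y(2) by linarith
      qed
    qed
  qed
qed

end

section \<open>Common spectra of all dilations\<close>

locale spectral_sequence = digit_sequence +
  fixes L :: "nat \<Rightarrow> int set" and E :: "nat set"
  assumes finite_L: "\<And>i. finite (L i)"
    and zero_in_L: "\<And>i. 0 \<in> L i"
    and one_in_E: "1 \<in> E"
    and E_pos: "0 \<notin> E"
    and parseval_L: "\<And>i t y. t \<in> E \<Longrightarrow>
      (\<Sum>l\<in>L i. (cmod (mask (B i) (of_real (y + real t * of_int l / of_int (a i)))))\<^sup>2) = 1"
begin

text \<open>For each \<open>t\<close> in \<open>E\<close> this is the Jorgensen-Pedersen criterion
  for \<open>t \<Lambda>\<close> to be a spectrum of the \<open>k\<close>-th finite convolution; one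
  set has to satisfy it for all \<open>t\<close> simultaneously.\<close>

definition parseval :: "nat \<Rightarrow> int set \<Rightarrow> bool" where
  "parseval k \<Lambda> \<longleftrightarrow> finite \<Lambda> \<and>
     (\<forall>t\<in>E. \<forall>x. (\<Sum>\<nu>\<in>\<Lambda>. (cmod (mask_prod a B k (of_real (x + real t * of_int \<nu>))))\<^sup>2) = 1)"

lemma parsevalD:
  "parseval k \<Lambda> \<Longrightarrow> t \<in> E \<Longrightarrow>
    (\<Sum>\<nu>\<in>\<Lambda>. (cmod (mask_prod a B k (of_real (x + real t * of_int \<nu>))))\<^sup>2) = 1"
  by (simp add: parseval_def)

text \<open>At \<open>x = - t \<nu>'\<close> the term of \<open>\<nu>'\<close> is already 1, so all
  the others vanish.\<close>

lemma parseval_orthogonal: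
  assumes "parseval k \<Lambda>" "t \<in> E" "\<nu> \<in> \<Lambda>" "\<nu>' \<in> \<Lambda>" "\<nu> \<noteq> \<nu>'"
  shows "mask_prod a B k (of_real (real t * of_int (\<nu> - \<nu>'))) = 0"
proof -
  have fin: "finite \<Lambda>" using assms(1) by (simp add: parseval_def)
  let ?f = "\<lambda>\<mu>. (cmod (mask_prod a B k (of_real (- (real t * of_int \<nu>') + real t * of_int \<mu>))))\<^sup>2"
  have "1 = (\<Sum>\<mu>\<in>\<Lambda>. ?f \<mu>)" by (rule parsevalD[OF assms(1,2), symmetric])
  also have "\<dots> = ?f \<nu>' + (\<Sum>\<mu>\<in>\<Lambda> - {\<nu>'}. ?f \<mu>)" using fin assms(4) by (rule sum.remove)
  finally have "(\<Sum>\<mu>\<in>\<Lambda> - {\<nu>'}. ?f \<mu>) = 0" by simp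
  then have "\<forall>\<mu>\<in>\<Lambda> - {\<nu>'}. ?f \<mu> = 0" using fin by (subst (asm) sum_nonneg_eq_0_iff) auto
  then have "?f \<nu> = 0" using assms(3,5) by blast
  then show ?thesis by (simp add: algebra_simps)
qed

text \<open>At the difference of two frequencies that are congruent modulo the scale the product is
  1 by periodicity, whereas orthogonality for the dilation 1 makes it 0 unless they
  coincide.\<close>

lemma parseval_separated:
  assumes "parseval k \<Lambda>" "\<nu> \<in> \<Lambda>" "\<nu>' \<in> \<Lambda>" "\<nu> + scale a k * j = \<nu>' + scale a k * j'"
  shows "\<nu> = \<nu>'"
proof (rule ccontr)
  assume "\<nu> \<noteq> \<nu>'"
  then have "mask_prod a B k (of_real (real 1 * of_int (\<nu> - \<nu>'))) = 0"
    by (rule parseval_orthogonal[OF assms(1) one_in_E assms(2,3)])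
  moreover have "\<nu> - \<nu>' = scale a k * (j' - j)" using assms(4) by (simp add: algebra_simps)
  ultimately have "mask_prod a B k (0 + of_int (scale a k) * of_int (j' - j)) = 0" by simp
  then have "(1::complex) = 0" by (simp only: mask_prod_periodic mask_prod_0)
  then show False by simp
qed

lemma mask_prod_translate:
  "mask_prod a B k (of_real (x + real t * of_int (\<nu> + scale a k * j))) =
     mask_prod a B k (of_real (x + real t * of_int \<nu>))"
proof -
  have "complex_of_real (x + real t * of_int (\<nu> + scale a k * j)) =
    of_real (x + real t * of_int \<nu>) + of_int (scale a k) * of_int (int t * j)"
    by (simp add: algebra_simps)
  then show ?thesis by (simp only: mask_prod_periodic)
qed

text \<open>Each frequency may be moved by its own multiple of the scale: the product does not see
  the moves, also after dilation by an integer \<open>t\<close>, and separation excludes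
  collisions.\<close>

lemma parseval_translate:
  assumes "parseval k \<Lambda>"
  shows "parseval k ((\<lambda>\<nu>. \<nu> + scale a k * \<kappa> \<nu>) ` \<Lambda>)"
proof -
  have "inj_on (\<lambda>\<nu>. \<nu> + scale a k * \<kappa> \<nu>) \<Lambda>"
    by (rule inj_onI) (rule parseval_separated[OF assms])
  then have "(\<Sum>\<nu>\<in>(\<lambda>\<nu>. \<nu> + scale a k * \<kappa> \<nu>) ` \<Lambda>.
      (cmod (mask_prod a B k (of_real (x + real t * of_int \<nu>))))\<^sup>2) =
    (\<Sum>\<nu>\<in>\<Lambda>. (cmod (mask_prod a B k (of_real (x + real t * of_int \<nu>))))\<^sup>2)" for x t
    by (rule sum.reindex_cong[OF _ refl]) (simp only: mask_prod_translate)
  then show ?thesis using assms unfolding parseval_def by (simp only:) blast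
qed

text \<open>The new set consists of the sums \<open>\<nu> + scale a k * l\<close> with
  \<open>l\<close> in \<open>L k\<close>. It contains \<Lambda> because \<open>0 \<in> L k\<close>,
  and its identity factors through Parseval for the single digit set \<open>B k\<close>.\<close>

lemma parseval_Suc:
  assumes "parseval k \<Lambda>"
  obtains \<Lambda>' where "\<Lambda> \<subseteq> \<Lambda>'" "parseval (Suc k) \<Lambda>'"
proof -
  define g where "g = (\<lambda>(\<nu>, l). \<nu> + scale a k * l)"
  have inj: "inj_on g (\<Lambda> \<times> L k)"
  proof (rule inj_onI, clarify)
    fix \<nu> l \<nu>' l' assume *: "\<nu> \<in> \<Lambda>" "\<nu>' \<in> \<Lambda>" "g (\<nu>, l) = g (\<nu>', l')"
    then have "\<nu> = \<nu>'" using parseval_separated[OF assms *(1,2)] by (simp add: g_def)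
    then show "\<nu> = \<nu>' \<and> l = l'" using *(3) scale_pos[of k] by (simp add: g_def)
  qed
  have "(\<Sum>\<nu>\<in>g ` (\<Lambda> \<times> L k). (cmod (mask_prod a B (Suc k) (of_real (x + real t * of_int \<nu>))))\<^sup>2) = 1"
    if t: "t \<in> E" for t x
  proof -
    have split: "(cmod (mask_prod a B (Suc k) (of_real (x + real t * of_int (g (\<nu>, l))))))\<^sup>2 =
      (cmod (mask_prod a B k (of_real (x + real t * of_int \<nu>))))\<^sup>2 *
      (cmod (mask (B k) (of_real ((x + real t * of_int \<nu>) / of_int (scale a (Suc k))
          + real t * of_int l / of_int (a k)))))\<^sup>2" for \<nu> l
    proof -
      have "(x + real t * of_int (\<nu> + scale a k * l)) / of_int (scale a (Suc k)) =
        (x + real t * of_int \<nu>) / of_int (scale a (Suc k)) + real t * of_int l / of_int (a k)"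
        using scale_pos[of k] a_ge_2[of k] by (simp add: scale_Suc field_simps)
      moreover have "mask_prod a B (Suc k) (of_real y) =
        mask_prod a B k (of_real y) * mask (B k) (of_real (y / of_int (scale a (Suc k))))" for y
        by (simp add: mask_prod_def)
      ultimately have "mask_prod a B (Suc k) (of_real (x + real t * of_int (\<nu> + scale a k * l))) =
        mask_prod a B k (of_real (x + real t * of_int \<nu>)) *
        mask (B k) (of_real ((x + real t * of_int \<nu>) / of_int (scale a (Suc k))
          + real t * of_int l / of_int (a k)))"
        by (simp only: mask_prod_translate)
      then show ?thesis by (simp only: g_def prod.case norm_mult power_mult_distrib)
    qed
    have "(\<Sum>\<nu>\<in>g ` (\<Lambda> \<times> L k). (cmod (mask_prod a B (Suc k) (of_real (x + real t * of_int \<nu>))))\<^sup>2) =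
      (\<Sum>(\<nu>, l)\<in>\<Lambda> \<times> L k. (cmod (mask_prod a B (Suc k) (of_real (x + real t * of_int (g (\<nu>, l))))))\<^sup>2)"
      by (rule sum.reindex_cong[OF inj refl]) (simp only: case_prod_beta prod.collapse)
    also have "\<dots> = (\<Sum>\<nu>\<in>\<Lambda>. \<Sum>l\<in>L k. (cmod (mask_prod a B (Suc k) (of_real (x + real t * of_int (g (\<nu>, l))))))\<^sup>2)"
      by (rule sum.cartesian_product[symmetric])
    also have "\<dots> = (\<Sum>\<nu>\<in>\<Lambda>. (cmod (mask_prod a B k (of_real (x + real t * of_int \<nu>))))\<^sup>2)"
      by (simp only: split sum_distrib_left[symmetric] parseval_L[OF t] mult_1_right)
    also have "\<dots> = 1" using assms t by (simp add: parseval_def)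
    finally show ?thesis .
  qed
  moreover have "finite (g ` (\<Lambda> \<times> L k))" using assms finite_L by (simp add: parseval_def)
  ultimately have "parseval (Suc k) (g ` (\<Lambda> \<times> L k))" by (simp add: parseval_def)
  moreover have "\<Lambda> \<subseteq> g ` (\<Lambda> \<times> L k)"
  proof
    fix \<nu> assume "\<nu> \<in> \<Lambda>"
    then have "(\<nu>, 0) \<in> \<Lambda> \<times> L k" "g (\<nu>, 0) = \<nu>" using zero_in_L by (auto simp: g_def)
    then show "\<nu> \<in> g ` (\<Lambda> \<times> L k)" by (metis imageI)
  qed
  ultimately show ?thesis using that by blast
qed

lemma parseval_extend:
  assumes "parseval k \<Lambda>"
  shows "\<exists>\<Lambda>'. \<Lambda> \<subseteq> \<Lambda>' \<and> parseval (k + p) \<Lambda>'"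
proof (induction p)
  case 0
  then show ?case using assms by auto
next
  case (Suc p)
  then obtain \<Lambda>' where "\<Lambda> \<subseteq> \<Lambda>'" "parseval (k + p) \<Lambda>'" by blast
  with parseval_Suc[of "k + p" \<Lambda>'] show ?case by (metis add_Suc_right order_trans)
qed

text \<open>The frequencies in \<Lambda> must stay fixed for the union to be increasing; at a large
  scale they are so close to 0 after rescaling that the tail is at least 1/2 there. Only the new
  ones are moved, to points supplied by \<open>equi\<close>.\<close>

lemma parseval_stage:
  assumes P: "parseval k \<Lambda>" and t: "t \<in> E" and K: "infinite K"
    and equi: "\<And>k x. k \<in> K \<Longrightarrow> \<exists>\<kappa>::int. \<epsilon> < cmod (tail_limit k (x + real t * of_int \<kappa>))"
  shows "\<exists>k' \<Lambda>'. k < k' \<and> \<Lambda> \<subseteq> \<Lambda>' \<and> parseval k' \<Lambda>' \<and>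
    (\<forall>\<nu>\<in>\<Lambda>'. min \<epsilon> (1 / 2) \<le> cmod (tail_limit k' (real t * of_int \<nu> / of_int (scale a k'))))"
proof -
  have fin: "finite \<Lambda>" using P by (simp add: parseval_def)
  define b where "b = C * real t * (\<Sum>\<nu>\<in>\<Lambda>. \<bar>real_of_int \<nu>\<bar>)"
  have "(\<lambda>k. b / 2 ^ k) \<longlonglongrightarrow> 0" by real_asymp
  then have "\<forall>\<^sub>F k in sequentially. b / 2 ^ k < 1 / 2" by (rule order_tendstoD) simp
  then obtain k0 where k0: "\<And>k. k \<ge> k0 \<Longrightarrow> b / 2 ^ k < 1 / 2" by (auto simp: eventually_sequentially)
  obtain k' where k': "k' \<in> K" "max (Suc k) k0 \<le> k'"
    using K by (meson infinite_nat_iff_unbounded_le)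
  interpret sh: digit_sequence "\<lambda>j. a (k' + j)" "\<lambda>j. B (k' + j)" R by (rule shift)
  let ?F = "tail_limit k'"
  have S: "real_of_int (scale a k') > 0" "2 ^ k' \<le> real_of_int (scale a k')"
    by (rule real_scale_pos, rule real_scale_ge)
  obtain D where D: "\<Lambda> \<subseteq> D" "parseval k' D"
    using parseval_extend[OF P, of "k' - k"] k' by auto
  have "\<exists>f. \<forall>\<nu>. \<epsilon> < cmod (?F (real t * of_int \<nu> / of_int (scale a k') + real t * of_int (f \<nu>)))"
    by (rule choice) (use equi[OF k'(1)] in blast)
  then obtain f :: "int \<Rightarrow> int" where
    f: "\<And>\<nu>. \<epsilon> < cmod (?F (real t * of_int \<nu> / of_int (scale a k') + real t * of_int (f \<nu>)))" by blast
  define \<kappa> where "\<kappa> \<nu> = (if \<nu> \<in> \<Lambda> then 0 else f \<nu>)" for \<nu>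
  define \<Lambda>' where "\<Lambda>' = (\<lambda>\<nu>. \<nu> + scale a k' * \<kappa> \<nu>) ` D"
  have "\<Lambda> \<subseteq> \<Lambda>'"
  proof
    fix \<nu> assume "\<nu> \<in> \<Lambda>"
    then show "\<nu> \<in> \<Lambda>'" unfolding \<Lambda>'_def using D(1) by (intro image_eqI[of _ _ \<nu>]) (auto simp: \<kappa>_def)
  qed
  moreover have "parseval k' \<Lambda>'" unfolding \<Lambda>'_def by (rule parseval_translate[OF D(2)])
  moreover have "min \<epsilon> (1 / 2) \<le> cmod (?F (real t * of_int \<mu> / of_int (scale a k')))"
    if mu: "\<mu> \<in> \<Lambda>'" for \<mu>
  proof -
    obtain \<nu> where l: "\<mu> = \<nu> + scale a k' * \<kappa> \<nu>" using mu by (auto simp: \<Lambda>'_def)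
    show ?thesis
    proof (cases "\<nu> \<in> \<Lambda>")
      case True
      then have mu: "\<mu> = \<nu>" by (simp add: l \<kappa>_def)
      have "cmod (?F (real t * of_int \<mu> / of_int (scale a k')) - 1) \<le> C * \<bar>real t * of_int \<mu> / of_int (scale a k')\<bar>"
        by (rule sh.mask_limit_near_0)
      also have "\<dots> = C * real t * \<bar>of_int \<mu>\<bar> / of_int (scale a k')"
        using S by (simp add: abs_mult)
      also have "\<dots> \<le> b / of_int (scale a k')"
      proof -
        have "\<bar>real_of_int \<mu>\<bar> \<le> (\<Sum>\<nu>\<in>\<Lambda>. \<bar>real_of_int \<nu>\<bar>)"
          using True fin unfolding mu by (intro member_le_sum) auto
        then show ?thesis unfolding b_def using S C_nonneg
          by (intro divide_right_mono mult_left_mono) auto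
      qed
      also have "\<dots> \<le> b / 2 ^ k'"
        using S C_nonneg by (intro divide_left_mono) (auto simp: b_def intro!: mult_nonneg_nonneg sum_nonneg)
      also have "\<dots> < 1 / 2" using k0 k' by simp
      finally have "cmod (?F (real t * of_int \<mu> / of_int (scale a k')) - 1) < 1 / 2" .
      moreover have "cmod 1 \<le> cmod (?F (real t * of_int \<mu> / of_int (scale a k'))) +
         cmod (?F (real t * of_int \<mu> / of_int (scale a k')) - 1)" by norm
      ultimately show ?thesis by simp
    next
      case False
      have "real t * of_int \<mu> / of_int (scale a k') =
        real t * of_int \<nu> / of_int (scale a k') + real t * of_int (f \<nu>)"
        using S False by (simp add: l \<kappa>_def field_simps)
      then show ?thesis using f[of \<nu>] by simp
    qed
  qed
  ultimately show ?thesis using k' by (intro exI[of _ k'] exI[of _ \<Lambda>']) auto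
qed

text \<open>The stages run through \<open>E\<close> in such a way that every element of \<open>E\<close> recurs infinitely often,
  so that at each of them only one dilation has to be controlled.\<close>

lemma common_spectrum:
  assumes equi: "\<And>t. t \<in> E \<Longrightarrow> \<exists>K \<epsilon>. infinite K \<and> \<epsilon> > 0 \<and>
    (\<forall>k\<in>K. \<forall>x. \<exists>\<kappa>::int. \<epsilon> < cmod (tail_limit k (x + real t * of_int \<kappa>)))"
  obtains \<Lambda> :: "int set" where
    "\<And>t \<nu> \<nu>'. t \<in> E \<Longrightarrow> \<nu> \<in> \<Lambda> \<Longrightarrow> \<nu>' \<in> \<Lambda> \<Longrightarrow> \<nu> \<noteq> \<nu>' \<Longrightarrow> mask_limit a B (real t * of_int (\<nu> - \<nu>')) = 0"
    "\<And>t x e. t \<in> E \<Longrightarrow> e > 0 \<Longrightarrow> \<exists>F. finite F \<and> F \<subseteq> \<Lambda> \<and>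
       (\<Sum>\<nu>\<in>F. (cmod (mask_limit a B (x + real t * of_int \<nu>)))\<^sup>2) > 1 - e"
proof -
  have "\<forall>t. \<exists>K \<epsilon>. t \<in> E \<longrightarrow> infinite K \<and> \<epsilon> > 0 \<and>
    (\<forall>k\<in>K. \<forall>x. \<exists>\<kappa>::int. \<epsilon> < cmod (tail_limit k (x + real t * of_int \<kappa>)))"
    using equi by blast
  then obtain K \<epsilon> where K: "\<And>t. t \<in> E \<Longrightarrow> infinite (K t)" and \<epsilon>: "\<And>t. t \<in> E \<Longrightarrow> \<epsilon> t > 0"
    and eq: "\<And>t k x. t \<in> E \<Longrightarrow> k \<in> K t \<Longrightarrow>
      \<exists>\<kappa>::int. \<epsilon> t < cmod (tail_limit k (x + real t * of_int \<kappa>))"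
    by metis
  \<comment> \<open>The first components of decoded pairs run through every natural number
    infinitely often; values outside \<open>E\<close> are replaced by 1. Step \<open>j\<close>
    produces the data of index \<open>Suc j\<close>, adapted to \<open>T j\<close>.\<close>
  define T where "T j = (if fst (prod_decode j) \<in> E then fst (prod_decode j) else 1)" for j
  have T: "T j \<in> E" for j using one_in_E by (simp add: T_def)
  have Tinf: "\<exists>j\<ge>J. T j = t" if "t \<in> E" for t J
  proof -
    have "T (prod_encode (t, J)) = t" using that by (simp add: T_def)
    then show ?thesis using le_prod_encode_2[of J t] by blast
  qed
  define good where "good j k' \<Lambda>' \<longleftrightarrow> (\<forall>\<nu>\<in>\<Lambda>'. min (\<epsilon> (T j)) (1 / 2) \<le>
    cmod (tail_limit k' (real (T j) * of_int \<nu> / of_int (scale a k'))))" for j k' \<Lambda>'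
  have "\<exists>f. \<forall>j. (case f j of (k, \<Lambda>) \<Rightarrow> parseval k \<Lambda>) \<and>
    (case f j of (k, \<Lambda>) \<Rightarrow> case f (Suc j) of (k', \<Lambda>') \<Rightarrow> k < k' \<and> \<Lambda> \<subseteq> \<Lambda>' \<and> good j k' \<Lambda>')"
  proof (rule dependent_nat_choice)
    have "parseval 0 {0}" by (simp add: parseval_def mask_prod_def)
    then show "\<exists>x. case x of (k, \<Lambda>) \<Rightarrow> parseval k \<Lambda>" by blast
  next
    fix x :: "nat \<times> int set" and j assume "case x of (k, \<Lambda>) \<Rightarrow> parseval k \<Lambda>"
    then obtain k \<Lambda> where x: "x = (k, \<Lambda>)" "parseval k \<Lambda>" by (cases x) auto
    obtain k' \<Lambda>' where "k < k'" "\<Lambda> \<subseteq> \<Lambda>'" "parseval k' \<Lambda>'" "good j k' \<Lambda>'"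
      using parseval_stage[OF x(2) T[of j] K[OF T] eq[OF T]] unfolding good_def by blast
    then show "\<exists>y. (case y of (k, \<Lambda>) \<Rightarrow> parseval k \<Lambda>) \<and>
      (case x of (k, \<Lambda>) \<Rightarrow> case y of (k', \<Lambda>') \<Rightarrow> k < k' \<and> \<Lambda> \<subseteq> \<Lambda>' \<and> good j k' \<Lambda>')"
      using x by (intro exI[of _ "(k', \<Lambda>')"]) simp
  qed
  then obtain f where f: "\<forall>j. (case f j of (k, \<Lambda>) \<Rightarrow> parseval k \<Lambda>) \<and>
    (case f j of (k, \<Lambda>) \<Rightarrow> case f (Suc j) of (k', \<Lambda>') \<Rightarrow> k < k' \<and> \<Lambda> \<subseteq> \<Lambda>' \<and> good j k' \<Lambda>')"
    by (elim exE) (rule that)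
  define k where "k j = fst (f j)" for j
  define M where "M j = snd (f j)" for j
  have P: "parseval (k j) (M j)" for j using f[rule_format, of j] by (simp add: k_def M_def case_prod_beta)
  have step: "k j < k (Suc j)" "M j \<subseteq> M (Suc j)" "good j (k (Suc j)) (M (Suc j))" for j
    using f[rule_format, of j] by (simp_all add: k_def M_def case_prod_beta)
  have k_mono: "strict_mono k" using step(1) by (simp add: strict_mono_Suc_iff)
  have M_mono: "M i \<subseteq> M j" if "i \<le> j" for i j using step(2) that by (rule lift_Suc_mono_le)
  have finM: "finite (M j)" for j using P by (simp add: parseval_def)
  define \<Lambda> where "\<Lambda> = (\<Union>j. M j)"
  have split: "mask_limit a B x = mask_prod a B (k j) (of_real x) *
     tail_limit (k j) (x / of_int (scale a (k j)))" for x j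
    by (rule mask_limit_split)
  have bessel: "(\<Sum>\<nu>\<in>M j. (cmod (mask_limit a B (x + real t * of_int \<nu>)))\<^sup>2) \<le> 1" if t: "t \<in> E" for t x j
  proof -
    interpret sh: digit_sequence "\<lambda>i. a (k j + i)" "\<lambda>i. B (k j + i)" R by (rule shift)
    have "(\<Sum>\<nu>\<in>M j. (cmod (mask_limit a B (x + real t * of_int \<nu>)))\<^sup>2) \<le>
      (\<Sum>\<nu>\<in>M j. (cmod (mask_prod a B (k j) (of_real (x + real t * of_int \<nu>))))\<^sup>2)"
      by (intro sum_mono power_mono, subst split[of _ j])
         (auto simp: norm_mult intro!: mult_left_le sh.norm_mask_limit_le_1)
    also have "\<dots> = 1" using P[of j] t by (simp add: parseval_def)
    finally show ?thesis .
  qed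
  show ?thesis
  proof (rule that[of \<Lambda>])
    fix t \<nu> \<nu>' assume *: "t \<in> E" "\<nu> \<in> \<Lambda>" "\<nu>' \<in> \<Lambda>" "\<nu> \<noteq> \<nu>'"
    then obtain i i' where "\<nu> \<in> M i" "\<nu>' \<in> M i'" by (auto simp: \<Lambda>_def)
    then have "\<nu> \<in> M (max i i')" "\<nu>' \<in> M (max i i')"
      using M_mono[of i "max i i'"] M_mono[of i' "max i i'"] by auto
    then have "mask_prod a B (k (max i i')) (of_real (real t * of_int (\<nu> - \<nu>'))) = 0"
      using parseval_orthogonal[OF P *(1)] *(4) by blast
    then show "mask_limit a B (real t * of_int (\<nu> - \<nu>')) = 0"
      by (subst split[of _ "max i i'"]) simp
  next
    fix t x and e :: real assume t: "t \<in> E" and e: "e > 0"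
    \<comment> \<open>The partial sums increase and are at most 1 by Bessel, so the frequencies
      added after \<open>J\<close> contribute little. At a later stage adapted to \<open>t\<close>
      the modulus of the product is at most that of the limit divided by \<eta>, so these
      frequencies carry little of the Parseval sum of that stage either, while on \<open>M J\<close>
      product and limit nearly agree.\<close>
    define S where "S j = (\<Sum>\<nu>\<in>M j. (cmod (mask_limit a B (x + real t * of_int \<nu>)))\<^sup>2)" for j
    define \<eta> where "\<eta> = min (\<epsilon> t) (1 / 2) / 2"
    have \<eta>: "\<eta> > 0" using \<epsilon>[OF t] by (simp add: \<eta>_def)
    have Smono: "S i \<le> S j" if "i \<le> j" for i j
      unfolding S_def using M_mono[OF that] finM by (intro sum_mono2) auto
    have "convergent S"
    proof (rule Bseq_mono_convergent)
      have "S j \<ge> 0" for j unfolding S_def by (intro sum_nonneg) simp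
      then show "Bseq S" using bessel[OF t] by (intro BseqI'[of _ 1]) (simp add: S_def)
      show "\<forall>m n. m \<le> n \<longrightarrow> S m \<le> S n" using Smono by blast
    qed
    then have "Cauchy S" by (rule convergent_Cauchy)
    moreover have "e * \<eta>\<^sup>2 / 3 > 0" using e \<eta> by simp
    ultimately obtain J where J: "\<And>m n. m \<ge> J \<Longrightarrow> n \<ge> J \<Longrightarrow> dist (S m) (S n) < e * \<eta>\<^sup>2 / 3"
      unfolding Cauchy_def by blast
    have "(\<lambda>n. \<Sum>\<nu>\<in>M J. (cmod (mask_prod a B n (of_real (x + real t * of_int \<nu>))))\<^sup>2) \<longlonglongrightarrow> S J"
      unfolding S_def by (intro tendsto_sum tendsto_power tendsto_norm mask_prod_tendsto)
    then have "\<forall>\<^sub>F n in sequentially. (\<Sum>\<nu>\<in>M J. (cmod (mask_prod a B n (of_real (x + real t * of_int \<nu>))))\<^sup>2) < S J + e / 3"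
      using e by (intro order_tendstoD) auto
    then obtain n1 where n1: "\<And>n. n \<ge> n1 \<Longrightarrow>
      (\<Sum>\<nu>\<in>M J. (cmod (mask_prod a B n (of_real (x + real t * of_int \<nu>))))\<^sup>2) < S J + e / 3"
      by (auto simp: eventually_sequentially)
    have "(\<lambda>n. C * \<bar>x\<bar> / 2 ^ n) \<longlonglongrightarrow> 0" by real_asymp
    then have "\<forall>\<^sub>F n in sequentially. C * \<bar>x\<bar> / 2 ^ n < \<eta>" using \<eta> by (intro order_tendstoD) auto
    then obtain n2 where n2: "\<And>n. n \<ge> n2 \<Longrightarrow> C * \<bar>x\<bar> / 2 ^ n < \<eta>" by (auto simp: eventually_sequentially)
    obtain j where j: "j \<ge> max J (max n1 n2)" "T j = t" using Tinf[OF t] by blast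
    define n where "n = k (Suc j)"
    have "Suc j \<le> n" unfolding n_def by (rule strict_mono_imp_increasing[OF k_mono])
    then have n: "n \<ge> n1" "n \<ge> n2" using j by auto
    interpret sh: digit_sequence "\<lambda>i. a (n + i)" "\<lambda>i. B (n + i)" R by (rule shift)
    let ?F = "tail_limit n"
    have sub: "M J \<subseteq> M (Suc j)" using M_mono j by simp
    \<comment> \<open>The stage controls the tail at \<open>t \<nu>\<close> divided by the scale,
      with bound \<open>2 * \<eta>\<close>; the additional shift by \<open>x\<close> divided by the
      scale costs less than \<eta>.\<close>
    have low: "\<eta> \<le> cmod (?F ((x + real t * of_int \<nu>) / of_int (scale a n)))" if l: "\<nu> \<in> M (Suc j)" for \<nu>
    proof -
      have S: "real_of_int (scale a n) > 0" "2 ^ n \<le> real_of_int (scale a n)"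
        by (rule real_scale_pos, rule real_scale_ge)
      have "2 * \<eta> \<le> cmod (?F (real t * of_int \<nu> / of_int (scale a n)))"
        using step(3)[of j] l j(2) by (auto simp: good_def n_def \<eta>_def)
      moreover have "cmod (?F (real t * of_int \<nu> / of_int (scale a n))
         - ?F ((x + real t * of_int \<nu>) / of_int (scale a n))) \<le>
        C * \<bar>real t * of_int \<nu> / of_int (scale a n) - (x + real t * of_int \<nu>) / of_int (scale a n)\<bar>"
        by (rule sh.mask_limit_lipschitz)
      moreover have "C * \<bar>real t * of_int \<nu> / of_int (scale a n) - (x + real t * of_int \<nu>) / of_int (scale a n)\<bar> =
        C * (\<bar>x\<bar> / of_int (scale a n))" using S by (simp add: add_divide_distrib)
      moreover have "C * (\<bar>x\<bar> / of_int (scale a n)) \<le> C * (\<bar>x\<bar> / 2 ^ n)"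
        using S C_nonneg by (intro mult_left_mono divide_left_mono) auto
      moreover have "C * (\<bar>x\<bar> / 2 ^ n) < \<eta>" using n2[OF n(2)] by simp
      moreover have "cmod (?F (real t * of_int \<nu> / of_int (scale a n))) \<le>
        cmod (?F ((x + real t * of_int \<nu>) / of_int (scale a n))) +
        cmod (?F (real t * of_int \<nu> / of_int (scale a n)) - ?F ((x + real t * of_int \<nu>) / of_int (scale a n)))"
        by norm
      ultimately show ?thesis by linarith
    qed
    let ?p = "\<lambda>\<nu>. (cmod (mask_prod a B n (of_real (x + real t * of_int \<nu>))))\<^sup>2"
    let ?q = "\<lambda>\<nu>. (cmod (mask_limit a B (x + real t * of_int \<nu>)))\<^sup>2"
    have pq: "?p \<nu> \<le> ?q \<nu> / \<eta>\<^sup>2" if l: "\<nu> \<in> M (Suc j)" for \<nu>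
    proof -
      have "?q \<nu> = ?p \<nu> * (cmod (?F ((x + real t * of_int \<nu>) / of_int (scale a n))))\<^sup>2"
        by (subst mask_limit_split[of _ n]) (simp add: norm_mult power_mult_distrib)
      also have "\<dots> \<ge> ?p \<nu> * \<eta>\<^sup>2"
        using low[OF l] \<eta> by (intro mult_left_mono power_mono) auto
      finally show ?thesis using \<eta> by (simp add: le_divide_eq)
    qed
    have "1 = (\<Sum>\<nu>\<in>M (Suc j). ?p \<nu>)" using P[of "Suc j"] t by (simp add: parseval_def n_def)
    also have "\<dots> = (\<Sum>\<nu>\<in>M (Suc j) - M J. ?p \<nu>) + (\<Sum>\<nu>\<in>M J. ?p \<nu>)"
      by (rule sum.subset_diff[OF sub finM])
    also have "(\<Sum>\<nu>\<in>M (Suc j) - M J. ?p \<nu>) \<le> (\<Sum>\<nu>\<in>M (Suc j) - M J. ?q \<nu> / \<eta>\<^sup>2)"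
      by (intro sum_mono pq) auto
    also have "\<dots> = (S (Suc j) - S J) / \<eta>\<^sup>2"
      using sum.subset_diff[OF sub finM, of ?q] by (simp add: S_def flip: sum_divide_distrib)
    also have "(S (Suc j) - S J) / \<eta>\<^sup>2 < e / 3"
    proof -
      have "\<bar>S (Suc j) - S J\<bar> < e * \<eta>\<^sup>2 / 3"
        using J[of "Suc j" J] j by (simp add: dist_real_def)
      then have "S (Suc j) - S J < e * \<eta>\<^sup>2 / 3" by linarith
      then show ?thesis using \<eta> by (simp add: divide_less_eq)
    qed
    finally have "1 < e / 3 + (\<Sum>\<nu>\<in>M J. ?p \<nu>)" by simp
    then have "1 - e < S J" using n1[OF n(1)] e by linarith
    then show "\<exists>F. finite F \<and> F \<subseteq> \<Lambda> \<and>
       (\<Sum>\<nu>\<in>F. (cmod (mask_limit a B (x + real t * of_int \<nu>)))\<^sup>2) > 1 - e"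
      using finM by (intro exI[of _ "M J"]) (auto simp: S_def \<Lambda>_def)
  qed
qed

end

section \<open>Fourier transforms of infinite convolutions\<close>

lemma real_distribution_convolution:
  assumes "real_distribution M" "real_distribution N"
  shows "real_distribution (M \<star> N)"
proof -
  interpret M: real_distribution M by fact
  interpret N: real_distribution N by fact
  interpret MN: pair_prob_space M N ..
  show ?thesis unfolding convolution_def
    by (intro MN.real_distribution_distr) simp
qed

lemma char_convolution:
  assumes "real_distribution M" "real_distribution N"
  shows "char (M \<star> N) t = char M t * char N t"
proof -
  interpret M: real_distribution M by fact
  interpret N: real_distribution N by fact
  interpret MN: pair_prob_space M N ..
  have int: "integrable (M \<Otimes>\<^sub>M N) (\<lambda>z. iexp (t * (fst z + snd z)))"
    by (rule MN.integrable_const_bound[of _ 1]) auto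
  have "char (M \<star> N) t = (\<integral>z. iexp (t * (fst z + snd z)) \<partial>(M \<Otimes>\<^sub>M N))"
    unfolding char_def convolution_def by (subst integral_distr) (auto simp: case_prod_beta)
  also have "\<dots> = (\<integral>x. (\<integral>y. iexp (t * (x + y)) \<partial>N) \<partial>M)"
    using MN.integral_fst'[OF int] by simp
  also have "\<dots> = (\<integral>x. iexp (t * x) * (\<integral>y. iexp (t * y) \<partial>N) \<partial>M)"
    by (simp add: ring_distribs exp_add)
  also have "\<dots> = char M t * char N t" by (simp add: char_def)
  finally show ?thesis .
qed

lemma AE_convolution_abs_le:
  assumes "real_distribution M" "real_distribution N"
    and "AE x in M. \<bar>x\<bar> \<le> r" "AE x in N. \<bar>x\<bar> \<le> s"
  shows "AE x in M \<star> N. \<bar>x\<bar> \<le> r + s"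
proof -
  interpret M: real_distribution M by fact
  interpret N: real_distribution N by fact
  interpret MN: pair_prob_space M N ..
  have "AE z in M \<Otimes>\<^sub>M N. \<bar>fst z + snd z\<bar> \<le> r + s"
  proof (rule MN.AE_pair_measure)
    show "AE x in M. AE y in N. \<bar>fst (x, y) + snd (x, y)\<bar> \<le> r + s"
      using assms(3)
    proof eventually_elim
      case (elim x)
      show ?case using assms(4) by eventually_elim (use elim in auto)
    qed
  qed measurable
  then show ?thesis unfolding convolution_def
    by (subst AE_distr_iff) (auto simp: case_prod_beta)
qed

lemma real_distribution_uniform_dirac: "real_distribution (uniform_dirac D)"
  unfolding uniform_dirac_def by (rule prob_space.real_distribution_distr[OF prob_space_measure_pmf]) simp

lemma char_uniform_dirac:
  assumes "finite D" "D \<noteq> {}"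
  shows "char (uniform_dirac D) t = (\<Sum>d\<in>D. iexp (t * d)) / of_nat (card D)"
proof -
  have "char (uniform_dirac D) t = (\<integral>x. iexp (t * x) \<partial>measure_pmf (pmf_of_set D))"
    unfolding char_def uniform_dirac_def by (subst integral_distr) auto
  also have "\<dots> = (\<Sum>d\<in>D. pmf (pmf_of_set D) d *\<^sub>R iexp (t * d))"
    by (rule integral_measure_pmf[OF assms(1)]) (use assms in auto)
  also have "\<dots> = (\<Sum>d\<in>D. iexp (t * d)) / of_nat (card D)"
    unfolding sum_divide_distrib
    by (intro sum.cong refl) (use assms in \<open>simp add: scaleR_conv_of_real\<close>)
  finally show ?thesis .
qed

lemma AE_uniform_dirac:
  assumes "finite D" "D \<noteq> {}" "\<And>d. d \<in> D \<Longrightarrow> P d" "Measurable.pred borel P"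
  shows "AE x in uniform_dirac D. P x"
  unfolding uniform_dirac_def
  by (subst AE_distr_iff) (use assms in \<open>auto simp: AE_measure_pmf_iff\<close>)

lemma finite_convolution_char:
  assumes "\<And>k. real_distribution (\<nu> k)"
  shows "real_distribution (finite_convolution \<nu> k)"
    and "char (finite_convolution \<nu> k) t = (\<Prod>i<k. char (\<nu> i) t)"
proof (induction k)
  case 0
  {
    case 1
    show ?case
      by (simp add: real_distribution_def real_distribution_axioms_def prob_space_return)
  next
    case 2
    show ?case by (simp add: char_def integral_return)
  }
next
  case (Suc k)
  {
    case 1
    show ?case using Suc(1) assms by (simp add: real_distribution_convolution)
  next
    case 2
    show ?case using Suc assms by (simp add: char_convolution)
  }
qed

text \<open>Weak convergence fixes the characteristic function of the limit and hence the limit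
  itself, which resolves the definite description.\<close>

lemma infinite_convolution_eqI:
  assumes "real_distribution \<mu>" "weak_conv_m (finite_convolution \<nu>) \<mu>"
    and "\<And>k. real_distribution (\<nu> k)"
  shows "infinite_convolution \<nu> = \<mu>"
  unfolding infinite_convolution_def
proof (rule the_equality)
  fix \<mu>' assume \<mu>': "real_distribution \<mu>' \<and> weak_conv_m (finite_convolution \<nu>) \<mu>'"
  have "char \<mu>' t = char \<mu> t" for t
    by (rule LIMSEQ_unique[OF levy_continuity1 levy_continuity1, of "finite_convolution \<nu>"])
       (use assms \<mu>' finite_convolution_char in auto)
  then show "\<mu>' = \<mu>" using Levy_uniqueness[of \<mu>' \<mu>] \<mu>' assms(1) by auto
qed (use assms in auto)

section \<open>Existence, Fourier transform and support of the infinite convolution\<close>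

context digit_sequence
begin

definition digit_dirac :: "nat \<Rightarrow> real measure" where
  "digit_dirac k = uniform_dirac ((\<lambda>b. real_of_int b / of_int (scale a (Suc k))) ` B k)"

definition digit_measure :: "real measure" where
  "digit_measure = infinite_convolution digit_dirac"

lemma real_distribution_digit_dirac: "real_distribution (digit_dirac k)"
  unfolding digit_dirac_def by (rule real_distribution_uniform_dirac)

text \<open>The argument \<open>- (2 * pi * x)\<close> converts the convention of
  \<open>char\<close>, with kernel \<open>iexp (t * x)\<close>, to the normalisation of
  \<open>mask\<close>.\<close>

lemma char_digit_dirac:
  "char (digit_dirac k) (- (2 * pi * x)) = mask (B k) (of_real (x / of_int (scale a (Suc k))))"
proof -
  have inj: "inj_on (\<lambda>b. real_of_int b / of_int (scale a (Suc k))) (B k)"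
    using scale_pos[of "Suc k"] by (auto intro!: inj_onI)
  have "char (digit_dirac k) (- (2 * pi * x)) =
    (\<Sum>b\<in>B k. iexp (- (2 * pi * x) * (real_of_int b / of_int (scale a (Suc k))))) / of_nat (card (B k))"
    unfolding digit_dirac_def
    by (subst char_uniform_dirac) (use finite_B B_nonempty in \<open>auto simp: sum.reindex[OF inj] card_image[OF inj]\<close>)
  also have "\<dots> = mask (B k) (of_real (x / of_int (scale a (Suc k))))"
    unfolding mask_of_real cis_conv_exp by (intro arg_cong2[of _ _ _ _ "(/)"] sum.cong refl) (simp add: mult_ac)
  finally show ?thesis .
qed

lemma real_distribution_finite_convolution: "real_distribution (finite_convolution digit_dirac k)"
  by (rule finite_convolution_char(1)) (rule real_distribution_digit_dirac)

lemma char_finite_convolution_digit: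
  "char (finite_convolution digit_dirac k) (- (2 * pi * x)) = mask_prod a B k (of_real x)"
  by (simp add: finite_convolution_char(2)[OF real_distribution_digit_dirac] mask_prod_def
      char_digit_dirac)

lemma AE_finite_convolution_digit:
  "AE x in finite_convolution digit_dirac k. \<bar>x\<bar> \<le> R"
proof -
  have "AE x in finite_convolution digit_dirac k. \<bar>x\<bar> \<le> (\<Sum>i<k. R * (1 / real_of_int (scale a (Suc i))))"
  proof (induction k)
    case 0
    show ?case unfolding finite_convolution.simps by (simp add: AE_return)
  next
    case (Suc k)
    have "AE x in digit_dirac k. \<bar>x\<bar> \<le> R * (1 / real_of_int (scale a (Suc k)))"
      unfolding digit_dirac_def
    proof (rule AE_uniform_dirac)
      fix d assume "d \<in> (\<lambda>b. real_of_int b / of_int (scale a (Suc k))) ` B k"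
      then obtain b where b: "b \<in> B k" "d = real_of_int b / of_int (scale a (Suc k))" by blast
      then show "\<bar>d\<bar> \<le> R * (1 / real_of_int (scale a (Suc k)))"
        using B_bounded[OF b(1)] scale_pos[of "Suc k"] by (simp add: divide_right_mono)
    qed (use finite_B B_nonempty in auto)
    from AE_convolution_abs_le[OF real_distribution_finite_convolution real_distribution_digit_dirac Suc this]
    show ?case unfolding finite_convolution.simps sum.lessThan_Suc .
  qed
  moreover have "(\<Sum>i<k. R * (1 / real_of_int (scale a (Suc i)))) \<le> R"
    using mult_left_mono[OF sum_inverse_scale_le[of k] R_nonneg]
    by (simp only: sum_distrib_left[symmetric] mult_1_right)
  ultimately show ?thesis by (auto elim!: eventually_mono)
qed

text \<open>All finite convolutions live on \<open>[- R, R]\<close>, so a subsequence converges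
  weakly. The transform of its limit is \<open>mask_limit\<close>, to which the transforms of the
  full sequence converge, and Levy continuity yields weak convergence of the full sequence.\<close>

lemma digit_measure_limit:
  "real_distribution digit_measure \<and> weak_conv_m (finite_convolution digit_dirac) digit_measure"
proof -
  note rd = real_distribution_finite_convolution
  have "tight (finite_convolution digit_dirac)"
    unfolding tight_def
  proof (intro conjI allI impI rd)
    fix \<epsilon> :: real assume "\<epsilon> > 0"
    \<comment> \<open>\<open>tight\<close> uses half-open intervals, so the left end is moved out to
      keep a possible atom at \<open>- R\<close>.\<close>
    have "measure (finite_convolution digit_dirac n) {- R - 1<..R} = 1" for n
    proof -
      interpret real_distribution "finite_convolution digit_dirac n" by (rule rd)
      show ?thesis using AE_finite_convolution_digit[of n]
        by (subst prob_eq_1) (auto elim!: eventually_mono)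
    qed
    then show "\<exists>a b. a < b \<and> (\<forall>n. 1 - \<epsilon> < measure (finite_convolution digit_dirac n) {a<..b})"
      using R_nonneg \<open>\<epsilon> > 0\<close> by (intro exI[of _ "- R - 1"] exI[of _ R]) auto
  qed
  then obtain r M where r: "strict_mono r" "real_distribution M"
    "weak_conv_m (finite_convolution digit_dirac \<circ> id \<circ> r) M"
    using tight_imp_convergent_subsubsequence[of _ id] strict_mono_id by blast
  have "char M t = mask_limit a B (- t / (2 * pi))" for t
  proof (rule LIMSEQ_unique)
    show "(\<lambda>n. char ((finite_convolution digit_dirac \<circ> id \<circ> r) n) t) \<longlonglongrightarrow> char M t"
      by (rule levy_continuity1) (use r rd in \<open>auto simp: o_def\<close>)
    have "char (finite_convolution digit_dirac k) t = mask_prod a B k (of_real (- t / (2 * pi)))" for k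
      using char_finite_convolution_digit[of k "- t / (2 * pi)"] by simp
    then show "(\<lambda>n. char ((finite_convolution digit_dirac \<circ> id \<circ> r) n) t) \<longlonglongrightarrow> mask_limit a B (- t / (2 * pi))"
      using LIMSEQ_subseq_LIMSEQ[OF mask_prod_tendsto[of "- t / (2 * pi)"] r(1)] by (simp add: o_def)
  qed
  then have "(\<lambda>n. char (finite_convolution digit_dirac n) t) \<longlonglongrightarrow> char M t" for t
    using mask_prod_tendsto[of "- t / (2 * pi)"] char_finite_convolution_digit[of _ "- t / (2 * pi)"] by simp
  then have "weak_conv_m (finite_convolution digit_dirac) M"
    by (intro levy_continuity rd r)
  then show ?thesis using infinite_convolution_eqI[OF r(2) _ real_distribution_digit_dirac] r(2)
    by (simp add: digit_measure_def)
qed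

lemma char_digit_measure: "char digit_measure (- (2 * pi * x)) = mask_limit a B x"
proof (rule LIMSEQ_unique)
  show "(\<lambda>n. char (finite_convolution digit_dirac n) (- (2 * pi * x))) \<longlonglongrightarrow> char digit_measure (- (2 * pi * x))"
    by (rule levy_continuity1) (use digit_measure_limit real_distribution_finite_convolution in auto)
  show "(\<lambda>n. char (finite_convolution digit_dirac n) (- (2 * pi * x))) \<longlonglongrightarrow> mask_limit a B x"
    using mask_prod_tendsto by (simp add: char_finite_convolution_digit)
qed

text \<open>The support bound passes to the weak limit by testing with a bounded continuous function
  whose zero set is exactly \<open>[- R, R]\<close>.\<close>

lemma AE_digit_measure: "AE x in digit_measure. \<bar>x\<bar> \<le> R"
proof -
  interpret real_distribution digit_measure using digit_measure_limit by blast
  define f where "f x = max 0 (min 1 (\<bar>x\<bar> - R))" for x :: real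
  have cont: "isCont f x" for x unfolding f_def by (intro continuous_intros)
  then have meas[measurable]: "f \<in> borel_measurable borel"
    by (intro borel_measurable_continuous_onI continuous_at_imp_continuous_on) auto
  have "(\<lambda>n. integral\<^sup>L (finite_convolution digit_dirac n) f) \<longlonglongrightarrow> integral\<^sup>L digit_measure f"
    by (rule weak_conv_imp_integral_bdd_continuous_conv[where B = 1])
       (use digit_measure_limit real_distribution_finite_convolution cont in \<open>auto simp: f_def\<close>)
  moreover have "integral\<^sup>L (finite_convolution digit_dirac n) f = 0" for n
    using AE_finite_convolution_digit[of n]
    by (intro integral_eq_zero_AE) (auto simp: f_def elim!: eventually_mono)
  ultimately have "integral\<^sup>L digit_measure f = 0" by (simp add: LIMSEQ_const_iff)
  moreover have "integrable digit_measure f"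
    by (rule integrable_const_bound[of _ 1]) (auto simp: f_def)
  ultimately have "AE x in digit_measure. f x = 0"
    by (subst (asm) integral_nonneg_eq_0_iff_AE) (auto simp: f_def)
  then show ?thesis by eventually_elim (auto simp: f_def max_def min_def split: if_splits)
qed

end

lemma mu_conv_eq_digit_measure:
  assumes "digit_sequence (\<lambda>i. N (\<omega> i) ^ n i) (\<lambda>i. B (\<omega> i)) R"
  shows "mu_conv N B n \<omega> = digit_sequence.digit_measure (\<lambda>i. N (\<omega> i) ^ n i) (\<lambda>i. B (\<omega> i))"
proof -
  interpret digit_sequence "\<lambda>i. N (\<omega> i) ^ n i" "\<lambda>i. B (\<omega> i)" R by fact
  have "digit_dirac = (\<lambda>k. uniform_dirac
     ((\<lambda>b. real_of_int b / (\<Prod>i\<le>k. real_of_int (N (\<omega> i)) ^ n i)) ` B (\<omega> k)))"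
    by (rule ext) (simp add: digit_dirac_def scale_def lessThan_Suc_atMost)
  then show ?thesis by (simp add: mu_conv_def digit_measure_def)
qed

section \<open>Completeness of exponentials\<close>

lemma expo_eq_iexp: "expo s x = iexp (- (2 * pi * s) * x)"
  by (simp add: expo_def algebra_simps)

lemma expo_add: "expo (s + t) x = expo s x * expo t x"
  by (simp add: expo_def algebra_simps flip: exp_add)

lemma expo_0 [simp]: "expo 0 x = 1"
  by (simp add: expo_def)

lemma norm_expo [simp]: "cmod (expo s x) = 1"
  by (simp add: expo_eq_iexp)

lemma cnj_expo: "cnj (expo s x) = expo (- s) x"
  by (simp add: expo_eq_iexp exp_cnj)

lemma expo_cnj_expo: "expo s x * cnj (expo t x) = expo (s - t) x"
  using expo_add[of s "- t" x] by (simp add: cnj_expo)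

lemma continuous_expo: "continuous_on A (expo s)"
  unfolding expo_def by (intro continuous_intros)

lemma measurable_expo [measurable]: "expo s \<in> borel_measurable borel"
  by (rule borel_measurable_continuous_onI[OF continuous_expo])

definition trig_polys :: "real set \<Rightarrow> (real \<Rightarrow> complex) set" where
  "trig_polys S = {f. \<exists>F c. finite F \<and> F \<subseteq> S \<and> f = (\<lambda>x. \<Sum>s\<in>F. c s * expo s x)}"

lemma trig_polys_expo: "s \<in> S \<Longrightarrow> expo s \<in> trig_polys S"
  unfolding trig_polys_def by (intro CollectI exI[of _ "{s}"] exI[of _ "\<lambda>_. 1"]) auto

lemma trig_polys_0: "(\<lambda>x. 0) \<in> trig_polys S"
  unfolding trig_polys_def by (intro CollectI exI[of _ "{}"]) auto

lemma trig_polys_scale: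
  assumes "f \<in> trig_polys S"
  shows "(\<lambda>x. c * f x) \<in> trig_polys S"
proof -
  obtain F d where F: "finite F" "F \<subseteq> S" "f = (\<lambda>x. \<Sum>s\<in>F. d s * expo s x)"
    using assms by (auto simp: trig_polys_def)
  then show ?thesis unfolding trig_polys_def
    by (intro CollectI exI[of _ F] exI[of _ "\<lambda>s. c * d s"]) (simp add: sum_distrib_left mult.assoc)
qed

lemma trig_polys_add:
  assumes "f \<in> trig_polys S" "g \<in> trig_polys S"
  shows "(\<lambda>x. f x + g x) \<in> trig_polys S"
proof -
  obtain F c where F: "finite F" "F \<subseteq> S" "f = (\<lambda>x. \<Sum>s\<in>F. c s * expo s x)"
    using assms(1) by (auto simp: trig_polys_def)
  obtain G d where G: "finite G" "G \<subseteq> S" "g = (\<lambda>x. \<Sum>s\<in>G. d s * expo s x)"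
    using assms(2) by (auto simp: trig_polys_def)
  let ?c = "\<lambda>s. if s \<in> F then c s else 0" and ?d = "\<lambda>s. if s \<in> G then d s else 0"
  have "f x + g x = (\<Sum>s\<in>F \<union> G. (?c s + ?d s) * expo s x)" for x
  proof -
    have "f x = (\<Sum>s\<in>F \<union> G. ?c s * expo s x)" unfolding F(3)
      using F(1) G(1) by (intro sum.mono_neutral_cong_left) auto
    moreover have "g x = (\<Sum>s\<in>F \<union> G. ?d s * expo s x)" unfolding G(3)
      using F(1) G(1) by (intro sum.mono_neutral_cong_left) auto
    ultimately show ?thesis by (simp only: ring_distribs sum.distrib)
  qed
  then show ?thesis unfolding trig_polys_def
    using F(1,2) G(1,2) by (intro CollectI exI[of _ "F \<union> G"] exI[of _ "\<lambda>s. ?c s + ?d s"]) auto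
qed

lemma trig_polys_sum:
  assumes "\<And>i. i \<in> I \<Longrightarrow> f i \<in> trig_polys S"
  shows "(\<lambda>x. \<Sum>i\<in>I. f i x) \<in> trig_polys S"
  using assms
  by (induction I rule: infinite_finite_induct) (auto simp: trig_polys_0 intro: trig_polys_add)

lemma trig_polys_mult:
  assumes "f \<in> trig_polys UNIV" "g \<in> trig_polys UNIV"
  shows "(\<lambda>x. f x * g x) \<in> trig_polys UNIV"
proof -
  obtain F c where F: "finite F" "f = (\<lambda>x. \<Sum>s\<in>F. c s * expo s x)"
    using assms(1) by (auto simp: trig_polys_def)
  obtain G d where G: "finite G" "g = (\<lambda>x. \<Sum>s\<in>G. d s * expo s x)"
    using assms(2) by (auto simp: trig_polys_def)
  have "(\<lambda>x. \<Sum>s\<in>F. \<Sum>t\<in>G. (c s * d t) * expo (s + t) x) \<in> trig_polys UNIV"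
    by (intro trig_polys_sum trig_polys_scale trig_polys_expo) simp
  moreover have "(\<lambda>x. \<Sum>s\<in>F. \<Sum>t\<in>G. (c s * d t) * expo (s + t) x) = (\<lambda>x. f x * g x)"
    by (rule ext) (simp add: F(2) G(2) sum_product expo_add mult_ac)
  ultimately show ?thesis by simp
qed

lemma trig_polys_measurable: "f \<in> trig_polys S \<Longrightarrow> f \<in> borel_measurable borel"
  by (auto simp: trig_polys_def)

lemma trig_polys_continuous: "f \<in> trig_polys S \<Longrightarrow> continuous_on A f"
  by (auto simp: trig_polys_def intro!: continuous_intros continuous_on_subset[OF continuous_expo])

text \<open>Stone-Weierstrass for the real-valued trigonometric polynomials with arbitrary real
  frequencies, an algebra because frequencies add under multiplication.\<close>

lemma trig_polys_dense_continuous: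
  fixes f :: "real \<Rightarrow> real"
  assumes "continuous_on {- r..r} f" "e > 0"
  obtains g :: "real \<Rightarrow> real" where "(\<lambda>x. of_real (g x)) \<in> trig_polys UNIV"
    "\<And>x. x \<in> {- r..r} \<Longrightarrow> \<bar>f x - g x\<bar> < e"
proof -
  let ?P = "\<lambda>g::real \<Rightarrow> real. (\<lambda>x. complex_of_real (g x)) \<in> trig_polys UNIV"
  have "\<exists>g. ?P g \<and> (\<forall>x\<in>{- r..r}. \<bar>f x - g x\<bar> < e)"
  proof (rule Stone_Weierstrass_HOL)
    show "compact {- r..r}" by simp
    show "?P (\<lambda>x. c)" for c
      using trig_polys_scale[OF trig_polys_expo[of 0 UNIV], of "of_real c"] by simp
    show "continuous_on {- r..r} g" if "?P g" for g
      using continuous_on_Re[OF trig_polys_continuous[OF that]] by simp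
    show "?P (\<lambda>x. g x + h x)" if "?P g \<and> ?P h" for g h
      using that trig_polys_add by auto
    show "?P (\<lambda>x. g x * h x)" if "?P g \<and> ?P h" for g h
      using that trig_polys_mult by auto
    show "\<exists>g. ?P g \<and> g x \<noteq> g y" if xy: "x \<in> {- r..r} \<and> y \<in> {- r..r} \<and> x \<noteq> y" for x y
    proof -
      \<comment> \<open>A quarter period between \<open>x\<close> and \<open>y\<close> makes the
        sine 0 at \<open>x\<close> and 1 at \<open>y\<close>.\<close>
      define \<alpha> where "\<alpha> = (1 / 4) / (y - x)"
      define g where "g z = sin (2 * pi * \<alpha> * (z - x))" for z
      have eq: "of_real (g z) = \<i> / 2 * (expo (- \<alpha>) x * expo \<alpha> z) + (- \<i> / 2) * (expo \<alpha> x * expo (- \<alpha>) z)" for z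
      proof -
        have "expo (- \<alpha>) x * expo \<alpha> z = cis (- (2 * pi * \<alpha> * (z - x)))"
          "expo \<alpha> x * expo (- \<alpha>) z = cis (2 * pi * \<alpha> * (z - x))"
          unfolding expo_def cis_conv_exp exp_add[symmetric]
          by (rule arg_cong[of _ _ exp], simp add: algebra_simps)+
        then show ?thesis by (simp add: g_def complex_eq_iff)
      qed
      have "(\<lambda>z. (\<i> / 2 * expo (- \<alpha>) x) * expo \<alpha> z + (- \<i> / 2 * expo \<alpha> x) * expo (- \<alpha>) z) \<in> trig_polys UNIV"
        by (intro trig_polys_add trig_polys_scale trig_polys_expo) auto
      then have "?P g" by (simp add: eq mult.assoc)
      moreover have \<alpha>: "\<alpha> * (y - x) = 1 / 4" using xy by (simp add: \<alpha>_def)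
      have "2 * pi * \<alpha> * (y - x) = pi / 2" unfolding mult.assoc \<alpha> by simp
      then have "g y = 1" unfolding g_def by (simp only: sin_pi_half)
      moreover have "g x = 0" by (simp add: g_def)
      ultimately show ?thesis by auto
    qed
  qed (use assms in auto)
  then show ?thesis using that by blast
qed

text \<open>These ramps serve twice: to approximate indicators by continuous functions, and to
  obtain measurability of the random measure.\<close>

lemma ramp_tendsto_indicator:
  fixes b x :: real
  shows "(\<lambda>n. max 0 (min 1 (1 - real n * (x - b)))) \<longlonglongrightarrow> indicator {..b} x"
proof (cases "x \<le> b")
  case True
  then have "max 0 (min 1 (1 - real n * (x - b))) = 1" for n
    by (simp add: min_def mult_nonneg_nonpos)
  then show ?thesis using True by simp
next
  case False
  have "filterlim (\<lambda>n. real n * (x - b)) at_top sequentially" using False by real_asymp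
  then have "\<forall>\<^sub>F n in sequentially. 1 \<le> real n * (x - b)" by (simp add: filterlim_at_top)
  then have "\<forall>\<^sub>F n in sequentially. max 0 (min 1 (1 - real n * (x - b))) = 0"
    by eventually_elim simp
  then show ?thesis using False by (simp add: tendsto_eventually)
qed

section \<open>The L2-closure of the trigonometric polynomials with given frequencies\<close>

context real_distribution
begin

lemma borel_measurable_eq_borel: "borel_measurable M = borel_measurable borel"
  by (rule measurable_cong_sets) simp_all

text \<open>Membership in the L2-closure of \<open>trig_polys S\<close>. The nonnegative integral is
  essential: a Bochner integral of a non-integrable square would be 0 and pass for a perfect
  approximation.\<close>

definition approximable :: "real set \<Rightarrow> (real \<Rightarrow> complex) \<Rightarrow> bool" where
  "approximable S f \<longleftrightarrow> f \<in> borel_measurable borel \<and>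
     (\<forall>\<epsilon>>0. \<exists>g\<in>trig_polys S. (\<integral>\<^sup>+x. ennreal ((cmod (f x - g x))\<^sup>2) \<partial>M) < ennreal \<epsilon>)"

lemma nn_integral_norm_add_squared_less:
  assumes [measurable]: "f \<in> borel_measurable borel" "g \<in> borel_measurable borel"
    and h: "\<And>x. h x = f x + g x" and \<epsilon>: "\<epsilon> > 0"
    and f: "(\<integral>\<^sup>+x. ennreal ((cmod (f x))\<^sup>2) \<partial>M) < ennreal (\<epsilon> / 4)"
    and g: "(\<integral>\<^sup>+x. ennreal ((cmod (g x))\<^sup>2) \<partial>M) < ennreal (\<epsilon> / 4)"
  shows "(\<integral>\<^sup>+x. ennreal ((cmod (h x))\<^sup>2) \<partial>M) < ennreal \<epsilon>"
proof -
  have "(cmod (h x))\<^sup>2 \<le> 2 * (cmod (f x))\<^sup>2 + 2 * (cmod (g x))\<^sup>2" for x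
  proof -
    have "(cmod (h x))\<^sup>2 \<le> (cmod (f x) + cmod (g x))\<^sup>2"
      unfolding h by (intro power_mono norm_triangle_ineq) simp
    also have "\<dots> \<le> 2 * (cmod (f x))\<^sup>2 + 2 * (cmod (g x))\<^sup>2"
      using sum_squares_bound[of "cmod (f x)" "cmod (g x)"] by (simp add: power2_sum)
    finally show ?thesis .
  qed
  then have "(\<integral>\<^sup>+x. ennreal ((cmod (h x))\<^sup>2) \<partial>M) \<le>
    (\<integral>\<^sup>+x. 2 * ennreal ((cmod (f x))\<^sup>2) + 2 * ennreal ((cmod (g x))\<^sup>2) \<partial>M)"
    by (intro nn_integral_mono) (simp add: ennreal_mult'[symmetric] ennreal_plus[symmetric]
        ennreal_numeral[symmetric] del: ennreal_plus ennreal_numeral)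
  also have "\<dots> = 2 * (\<integral>\<^sup>+x. ennreal ((cmod (f x))\<^sup>2) \<partial>M) + 2 * (\<integral>\<^sup>+x. ennreal ((cmod (g x))\<^sup>2) \<partial>M)"
    by (subst nn_integral_add) (auto simp: nn_integral_cmult)
  also have "\<dots> < 2 * ennreal (\<epsilon> / 4) + 2 * ennreal (\<epsilon> / 4)"
    by (intro add_strict_mono ennreal_mult_strict_left_mono f g) auto
  also have "\<dots> = ennreal \<epsilon>"
    using \<epsilon> by (simp add: ennreal_mult'[symmetric] ennreal_plus[symmetric]
        ennreal_numeral[symmetric] del: ennreal_plus ennreal_numeral)
  finally show ?thesis .
qed

lemma approximable_limit:
  assumes [measurable]: "f \<in> borel_measurable borel"
    and lim: "\<And>\<epsilon>::real. \<epsilon> > 0 \<Longrightarrow> \<exists>h. approximable S h \<and> (\<integral>\<^sup>+x. ennreal ((cmod (f x - h x))\<^sup>2) \<partial>M) < ennreal \<epsilon>"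
  shows "approximable S f"
  unfolding approximable_def
proof (intro conjI allI impI)
  fix \<epsilon> :: real assume "\<epsilon> > 0"
  then have "\<epsilon> / 4 > 0" by simp
  from lim[OF this] obtain h where h: "approximable S h"
    "(\<integral>\<^sup>+x. ennreal ((cmod (f x - h x))\<^sup>2) \<partial>M) < ennreal (\<epsilon> / 4)" by blast
  then obtain g where g: "g \<in> trig_polys S" "(\<integral>\<^sup>+x. ennreal ((cmod (h x - g x))\<^sup>2) \<partial>M) < ennreal (\<epsilon> / 4)"
    using \<open>\<epsilon> / 4 > 0\<close> unfolding approximable_def by blast
  have [measurable]: "h \<in> borel_measurable borel" "g \<in> borel_measurable borel"
    using h(1) g(1) by (auto simp: approximable_def trig_polys_measurable)
  have "(\<integral>\<^sup>+x. ennreal ((cmod (f x - g x))\<^sup>2) \<partial>M) < ennreal \<epsilon>"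
    by (rule nn_integral_norm_add_squared_less[OF _ _ _ \<open>\<epsilon> > 0\<close> h(2) g(2)]) auto
  then show "\<exists>g\<in>trig_polys S. (\<integral>\<^sup>+x. ennreal ((cmod (f x - g x))\<^sup>2) \<partial>M) < ennreal \<epsilon>"
    using g(1) by blast
qed fact

lemma approximable_trig_poly: "g \<in> trig_polys S \<Longrightarrow> approximable S g"
  unfolding approximable_def by (auto intro!: bexI[of _ g] trig_polys_measurable)

lemma approximable_add:
  assumes "approximable S f" "approximable S g"
  shows "approximable S (\<lambda>x. f x + g x)"
proof -
  have [measurable]: "f \<in> borel_measurable borel" "g \<in> borel_measurable borel"
    using assms by (auto simp: approximable_def)
  show ?thesis
  proof (rule approximable_limit)
    fix \<epsilon> :: real assume "\<epsilon> > 0"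
    then have e: "\<epsilon> / 4 > 0" by simp
    obtain p where p: "p \<in> trig_polys S" "(\<integral>\<^sup>+x. ennreal ((cmod (f x - p x))\<^sup>2) \<partial>M) < ennreal (\<epsilon> / 4)"
      using assms(1) e unfolding approximable_def by blast
    obtain q where q: "q \<in> trig_polys S" "(\<integral>\<^sup>+x. ennreal ((cmod (g x - q x))\<^sup>2) \<partial>M) < ennreal (\<epsilon> / 4)"
      using assms(2) e unfolding approximable_def by blast
    have [measurable]: "p \<in> borel_measurable borel" "q \<in> borel_measurable borel"
      using p q by (auto simp: trig_polys_measurable)
    have "(\<integral>\<^sup>+x. ennreal ((cmod (f x + g x - (p x + q x)))\<^sup>2) \<partial>M) < ennreal \<epsilon>"
      by (rule nn_integral_norm_add_squared_less[OF _ _ _ \<open>\<epsilon> > 0\<close> p(2) q(2)]) auto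
    then show "\<exists>h. approximable S h \<and> (\<integral>\<^sup>+x. ennreal ((cmod (f x + g x - h x))\<^sup>2) \<partial>M) < ennreal \<epsilon>"
      using p q by (intro exI[of _ "\<lambda>x. p x + q x"] conjI approximable_trig_poly trig_polys_add) auto
  qed simp
qed

lemma approximable_scale:
  assumes "approximable S f"
  shows "approximable S (\<lambda>x. c * f x)"
proof -
  have [measurable]: "f \<in> borel_measurable borel" using assms by (auto simp: approximable_def)
  \<comment> \<open>The summand 1 keeps \<open>b\<close> positive when \<open>c = 0\<close>.\<close>
  define b where "b = (cmod c)\<^sup>2 + 1"
  have b: "b > 0" "(cmod c)\<^sup>2 \<le> b" by (auto simp: b_def intro: add_nonneg_pos)
  show ?thesis
  proof (rule approximable_limit)
    fix \<epsilon> :: real assume "\<epsilon> > 0"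
    then have "\<epsilon> / b > 0" using b by simp
    then obtain p where p: "p \<in> trig_polys S" "(\<integral>\<^sup>+x. ennreal ((cmod (f x - p x))\<^sup>2) \<partial>M) < ennreal (\<epsilon> / b)"
      using assms unfolding approximable_def by blast
    have [measurable]: "p \<in> borel_measurable borel" using p by (auto simp: trig_polys_measurable)
    have "(cmod (c * f x - c * p x))\<^sup>2 \<le> b * (cmod (f x - p x))\<^sup>2" for x
    proof -
      have "(cmod (c * f x - c * p x))\<^sup>2 = (cmod c)\<^sup>2 * (cmod (f x - p x))\<^sup>2"
        by (simp add: norm_mult power_mult_distrib flip: right_diff_distrib)
      then show ?thesis using b by (simp add: mult_right_mono)
    qed
    then have "(\<integral>\<^sup>+x. ennreal ((cmod (c * f x - c * p x))\<^sup>2) \<partial>M) \<le> (\<integral>\<^sup>+x. ennreal b * ennreal ((cmod (f x - p x))\<^sup>2) \<partial>M)"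
      using b by (intro nn_integral_mono) (simp add: ennreal_mult'[symmetric] ennreal_leI)
    also have "\<dots> = ennreal b * (\<integral>\<^sup>+x. ennreal ((cmod (f x - p x))\<^sup>2) \<partial>M)"
      by (rule nn_integral_cmult) simp
    also have "\<dots> < ennreal b * ennreal (\<epsilon> / b)"
      using b by (intro ennreal_mult_strict_left_mono p) auto
    also have "\<dots> = ennreal \<epsilon>" using b \<open>\<epsilon> > 0\<close> by (simp add: ennreal_mult'[symmetric])
    finally show "\<exists>h. approximable S h \<and> (\<integral>\<^sup>+x. ennreal ((cmod (c * f x - h x))\<^sup>2) \<partial>M) < ennreal \<epsilon>"
      using p by (intro exI[of _ "\<lambda>x. c * p x"] conjI approximable_trig_poly trig_polys_scale) auto
  qed simp
qed

lemma approximable_sum: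
  assumes "\<And>i. i \<in> I \<Longrightarrow> approximable S (f i)"
  shows "approximable S (\<lambda>x. \<Sum>i\<in>I. f i x)"
  using assms
  by (induction I rule: infinite_finite_induct)
     (auto intro: approximable_add approximable_trig_poly trig_polys_0)

text \<open>The limit principle behind half-lines, countable disjoint unions and square-integrable
  functions alike; \<open>w\<close> dominates the error rather than the sequence.\<close>

lemma approximable_dominated:
  fixes f :: "nat \<Rightarrow> real \<Rightarrow> complex" and w :: "real \<Rightarrow> real"
  assumes f: "\<And>n. approximable S (f n)"
    and [measurable]: "h \<in> borel_measurable borel" "w \<in> borel_measurable borel"
    and lim: "\<And>x. (\<lambda>n. f n x) \<longlonglongrightarrow> h x"
    and dom: "\<And>n x. cmod (h x - f n x) \<le> w x"
    and w: "integrable M (\<lambda>x. (w x)\<^sup>2)"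
  shows "approximable S h"
proof (rule approximable_limit)
  fix \<epsilon> :: real assume "\<epsilon> > 0"
  have [measurable]: "f n \<in> borel_measurable borel" for n using f by (auto simp: approximable_def)
  have "(\<lambda>n. \<integral>\<^sup>+x. ennreal ((cmod (h x - f n x))\<^sup>2) \<partial>M) \<longlonglongrightarrow> (\<integral>\<^sup>+x. 0 \<partial>M)"
  proof (rule nn_integral_dominated_convergence[where w = "\<lambda>x. ennreal ((w x)\<^sup>2)"])
    show "AE x in M. ennreal ((cmod (h x - f j x))\<^sup>2) \<le> ennreal ((w x)\<^sup>2)" for j
      using dom by (intro AE_I2 ennreal_leI power_mono) auto
    show "(\<integral>\<^sup>+x. ennreal ((w x)\<^sup>2) \<partial>M) < \<infinity>"
      using w by (subst nn_integral_eq_integral) auto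
    show "AE x in M. (\<lambda>i. ennreal ((cmod (h x - f i x))\<^sup>2)) \<longlonglongrightarrow> 0"
    proof (rule AE_I2)
      fix x
      have "(\<lambda>i. (cmod (h x - f i x))\<^sup>2) \<longlonglongrightarrow> (cmod (h x - h x))\<^sup>2"
        by (intro tendsto_intros lim)
      then show "(\<lambda>i. ennreal ((cmod (h x - f i x))\<^sup>2)) \<longlonglongrightarrow> 0"
        by (simp add: ennreal_0[symmetric] del: ennreal_0)
    qed
  qed measurable
  then have "\<forall>\<^sub>F n in sequentially. (\<integral>\<^sup>+x. ennreal ((cmod (h x - f n x))\<^sup>2) \<partial>M) < ennreal \<epsilon>"
    using \<open>\<epsilon> > 0\<close> by (intro order_tendstoD) auto
  then show "\<exists>h'. approximable S h' \<and> (\<integral>\<^sup>+x. ennreal ((cmod (h x - h' x))\<^sup>2) \<partial>M) < ennreal \<epsilon>"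
    using f by (auto simp: eventually_sequentially)
qed fact

text \<open>Once all exponentials lie in the closure, so do in turn continuous functions
  (Stone-Weierstrass on the bounded support), half-lines, Borel sets (Dynkin's \<pi>-\<lambda>
  argument), simple functions and finally \<open>f\<close>.\<close>

lemma approximable_of_dense_sums:
  assumes bounded: "AE x in M. \<bar>x\<bar> \<le> r"
    and expo: "\<And>s. approximable S (expo s)"
    and f: "square_integrable M f"
  shows "approximable S f"
proof -
  have trig: "approximable S g" if g: "g \<in> trig_polys UNIV" for g
  proof -
    obtain F c where F: "finite F" "g = (\<lambda>x. \<Sum>s\<in>F. c s * expo s x)"
      using g by (auto simp: trig_polys_def)
    show ?thesis unfolding F(2) by (intro approximable_sum approximable_scale expo)
  qed
  have cont: "approximable S (\<lambda>x. of_real (g x))" if g: "continuous_on UNIV g" for g :: "real \<Rightarrow> real"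
  proof (rule approximable_limit)
    have [measurable]: "g \<in> borel_measurable borel" by (rule borel_measurable_continuous_onI[OF g])
    show "(\<lambda>x. complex_of_real (g x)) \<in> borel_measurable borel" by simp
    fix \<epsilon> :: real assume e: "\<epsilon> > 0"
    define d where "d = sqrt (\<epsilon> / 2)"
    have d: "d > 0" "d\<^sup>2 = \<epsilon> / 2" using e by (simp_all add: d_def)
    obtain h where h: "(\<lambda>x. complex_of_real (h x)) \<in> trig_polys UNIV"
      "\<And>x. x \<in> {- r..r} \<Longrightarrow> \<bar>g x - h x\<bar> < d"
      using trig_polys_dense_continuous[OF continuous_on_subset[OF g subset_UNIV] d(1)] by blast
    have "(\<integral>\<^sup>+x. ennreal ((cmod (of_real (g x) - of_real (h x)))\<^sup>2) \<partial>M) \<le> (\<integral>\<^sup>+x. ennreal (\<epsilon> / 2) \<partial>M)"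
    proof (rule nn_integral_mono_AE)
      show "AE x in M. ennreal ((cmod (of_real (g x) - of_real (h x)))\<^sup>2) \<le> ennreal (\<epsilon> / 2)"
        using bounded
      proof eventually_elim
        case (elim x)
        then have "\<bar>g x - h x\<bar> < d" by (intro h(2)) auto
        then have "(cmod (of_real (g x) - of_real (h x)))\<^sup>2 \<le> d\<^sup>2"
          by (intro power_mono) (auto simp flip: of_real_diff)
        then show ?case using d by (intro ennreal_leI) simp
      qed
    qed
    also have "\<dots> = ennreal (\<epsilon> / 2)" using emeasure_space_1 by simp
    also have "\<dots> < ennreal \<epsilon>" using e by (simp add: ennreal_less_iff)
    finally show "\<exists>h. approximable S h \<and> (\<integral>\<^sup>+x. ennreal ((cmod (of_real (g x) - h x))\<^sup>2) \<partial>M) < ennreal \<epsilon>"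
      using trig[OF h(1)] by blast
  qed
  have halfline: "approximable S (indicator {..b})" for b
  proof (rule approximable_dominated[where w = "\<lambda>_. 1"])
    let ?g = "\<lambda>n x. max 0 (min 1 (1 - real n * (x - b)))"
    show "approximable S (\<lambda>x. of_real (?g n x))" for n
      by (intro cont continuous_intros)
    show "indicator {..b} \<in> borel_measurable borel" by simp
    show "(\<lambda>n. complex_of_real (?g n x)) \<longlonglongrightarrow> indicator {..b} x" for x
    proof -
      have "(\<lambda>n. complex_of_real (?g n x)) \<longlonglongrightarrow> complex_of_real (indicator {..b} x)"
        by (rule tendsto_of_real[OF ramp_tendsto_indicator])
      moreover have "complex_of_real (indicator {..b} x) = indicator {..b} x" by (simp add: indicator_def)
      ultimately show ?thesis by (simp only:)
    qed
    show "cmod (indicator {..b} x - of_real (?g n x)) \<le> 1" for n x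
    proof -
      have "indicator {..b} x - of_real (?g n x) = complex_of_real (indicator {..b} x - ?g n x)"
        by (simp add: indicator_def)
      then have "cmod (indicator {..b} x - of_real (?g n x)) = \<bar>indicator {..b} x - ?g n x\<bar>"
        by (simp only: norm_of_real)
      also have "\<dots> \<le> 1" by (auto simp: indicator_def)
      finally show ?thesis .
    qed
  qed simp_all
  have ind: "approximable S (indicator A)" if A: "A \<in> sets borel" for A
  proof -
    have gen: "A \<in> sigma_sets UNIV (range (\<lambda>b::real. {..b}))"
      using A by (simp add: borel_eq_atMost)
    have stable: "Int_stable (range (\<lambda>b::real. {..b}))"
      by (auto simp: Int_stable_def)
    have "range (\<lambda>b::real. {..b}) \<subseteq> Pow UNIV" by simp
    from stable this gen show ?thesis
    proof (induction rule: sigma_sets_induct_disjoint)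
      case (basic A)
      then show ?case using halfline by auto
    next
      case empty
      show ?case using trig[OF trig_polys_0] by (simp add: fun_eq_iff)
    next
      case (compl A)
      have "indicator (UNIV - A) = (\<lambda>x. expo 0 x + (- 1) * (indicator A x :: complex))"
        by (auto simp: fun_eq_iff indicator_def)
      then show ?case using approximable_add[OF expo[of 0] approximable_scale[OF compl(2), of "- 1"]]
        by simp
    next
      case (union A)
      show ?case
      proof (rule approximable_dominated[where w = "\<lambda>_. 1"])
        show "approximable S (\<lambda>x. \<Sum>i<n. indicator (A i) x)" for n
          by (intro approximable_sum union)
        have "A i \<in> sets borel" for i using union(2) by (auto simp: borel_eq_atMost)
        then show "indicator (\<Union>i. A i) \<in> borel_measurable borel"
          by (intro borel_measurable_indicator) auto
        show "(\<lambda>n. \<Sum>i<n. indicator (A i) x :: complex) \<longlonglongrightarrow> indicator (\<Union>i. A i) x" for x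
        proof -
          have "(\<lambda>i. indicator (A i) x :: real) sums indicator (\<Union>i. A i) x"
            by (rule indicator_sums) (use union(1) in \<open>auto simp: disjoint_family_on_def\<close>)
          then have "(\<lambda>i. complex_of_real (indicator (A i) x)) sums of_real (indicator (\<Union>i. A i) x)"
            by (rule sums_of_real)
          moreover have "complex_of_real (indicator D x) = indicator D x" for D
            by (simp add: indicator_def)
          ultimately show ?thesis by (simp only: sums_def)
        qed
        have sum_eq: "(\<Sum>i<n. indicator (A i) x :: complex) = indicator (\<Union>i<n. A i) x" for n x
          by (subst indicator_UN_disjoint)
             (use union(1) in \<open>auto simp: disjoint_family_on_def\<close>)
        show "cmod (indicator (\<Union>i. A i) x - (\<Sum>i<n. indicator (A i) x)) \<le> 1" for n x
          unfolding sum_eq by (auto simp: indicator_def)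
      qed simp_all
    qed
  qed
  have fm [measurable]: "f \<in> borel_measurable borel" using f by (simp add: square_integrable_def borel_measurable_eq_borel)
  then have "f \<in> borel_measurable M" by simp
  from borel_measurable_implies_sequence_metric[OF this, of 0]
  obtain F where F: "\<And>i. simple_function M (F i)" "\<And>x. (\<lambda>i. F i x) \<longlonglongrightarrow> f x"
    "\<And>i x. cmod (F i x) \<le> 2 * cmod (f x)"
    by (auto simp: dist_norm)
  show ?thesis
  proof (rule approximable_dominated)
    fix i
    have fin: "finite (range (F i))" using simple_functionD(1)[OF F(1)[of i]] by simp
    have "F i = (\<lambda>x. \<Sum>y\<in>range (F i). y * indicator (F i -` {y}) x)"
    proof
      fix x
      have "(\<Sum>y\<in>range (F i). y * indicator (F i -` {y}) x) = (\<Sum>y\<in>range (F i). if y = F i x then y else 0)"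
        by (intro sum.cong) (auto simp: indicator_def)
      then show "F i x = (\<Sum>y\<in>range (F i). y * indicator (F i -` {y}) x)" using fin by simp
    qed
    moreover have "F i -` {y} \<in> sets borel" for y
      using simple_functionD(2)[OF F(1)[of i], of "{y}"] by simp
    ultimately show "approximable S (F i)"
      using approximable_sum[of "range (F i)" S "\<lambda>y x. y * indicator (F i -` {y}) x"]
        approximable_scale ind by simp
  next
    show "cmod (f x - F i x) \<le> 3 * cmod (f x)" for i x
      using norm_triangle_ineq4[of "f x" "F i x"] F(3)[of i x] by linarith
    show "integrable M (\<lambda>x. (3 * cmod (f x))\<^sup>2)"
      using f by (simp add: square_integrable_def power_mult_distrib)
  qed (use F(2) in auto)
qed

lemma integrable_expo: "integrable M (expo s)"
  by (rule integrable_const_bound[of _ 1]) auto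

lemma integral_expo: "(\<integral>x. expo s x \<partial>M) = char M (- (2 * pi * s))"
  by (simp add: char_def expo_eq_iexp)

lemma integral_expo_minus: "(\<integral>x. expo (- s) x \<partial>M) = cnj (\<integral>x. expo s x \<partial>M)"
  using Bochner_Integration.integral_cnj[of M "expo s"] by (simp add: cnj_expo)

text \<open>Pythagoras: the \<open>c s\<close> are the Fourier coefficients of
  \<open>expo \<xi>\<close>, so the sum is its orthogonal projection onto the span of the
  exponentials in \<open>F\<close>.\<close>

lemma integral_expo_approximation:
  assumes F: "finite F"
    and orth: "\<And>s t. s \<in> F \<Longrightarrow> t \<in> F \<Longrightarrow> s \<noteq> t \<Longrightarrow> (\<integral>x. expo (s - t) x \<partial>M) = 0"
    and c: "\<And>s. c s = (\<integral>x. expo (\<xi> - s) x \<partial>M)"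
  shows "(\<integral>x. (cmod (expo \<xi> x - (\<Sum>s\<in>F. c s * expo s x)))\<^sup>2 \<partial>M) = 1 - (\<Sum>s\<in>F. (cmod (c s))\<^sup>2)"
proof -
  have pointwise: "complex_of_real ((cmod (expo \<xi> x - (\<Sum>s\<in>F. c s * expo s x)))\<^sup>2) =
    1 - (\<Sum>s\<in>F. cnj (c s) * expo (\<xi> - s) x) - (\<Sum>s\<in>F. c s * expo (s - \<xi>) x)
      + (\<Sum>s\<in>F. \<Sum>t\<in>F. c s * cnj (c t) * expo (s - t) x)" for x
  proof -
    have "complex_of_real ((cmod (expo \<xi> x - (\<Sum>s\<in>F. c s * expo s x)))\<^sup>2) =
      (expo \<xi> x - (\<Sum>s\<in>F. c s * expo s x)) * (cnj (expo \<xi> x) - (\<Sum>t\<in>F. cnj (c t) * cnj (expo t x)))"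
      by (simp only: complex_norm_square complex_cnj_diff cnj_sum complex_cnj_mult)
    also have "\<dots> = expo \<xi> x * cnj (expo \<xi> x) - (\<Sum>t\<in>F. cnj (c t) * (expo \<xi> x * cnj (expo t x)))
      - (\<Sum>s\<in>F. c s * (expo s x * cnj (expo \<xi> x)))
      + (\<Sum>s\<in>F. c s * expo s x) * (\<Sum>t\<in>F. cnj (c t) * cnj (expo t x))"
      by (simp add: algebra_simps sum_distrib_left sum_distrib_right)
    also have "(\<Sum>s\<in>F. c s * expo s x) * (\<Sum>t\<in>F. cnj (c t) * cnj (expo t x)) =
      (\<Sum>s\<in>F. \<Sum>t\<in>F. c s * cnj (c t) * (expo s x * cnj (expo t x)))"
      by (simp add: sum_product mult_ac)
    finally show ?thesis by (simp only: expo_cnj_expo) simp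
  qed
  have ft_diff: "(\<integral>x. expo (s - \<xi>) x \<partial>M) = cnj (c s)" for s
    using integral_expo_minus[of "\<xi> - s"] by (simp add: c)
  have orth': "(\<integral>x. expo (s - t) x \<partial>M) = (if s = t then 1 else 0)" if "s \<in> F" "t \<in> F" for s t
    using orth[OF that] prob_space by auto
  have int: "integrable M (\<lambda>x. z * expo s x)" for z s
    by (intro integrable_mult_right integrable_expo)
  have "complex_of_real (\<integral>x. (cmod (expo \<xi> x - (\<Sum>s\<in>F. c s * expo s x)))\<^sup>2 \<partial>M) =
    (\<integral>x. 1 - (\<Sum>s\<in>F. cnj (c s) * expo (\<xi> - s) x) - (\<Sum>s\<in>F. c s * expo (s - \<xi>) x)
      + (\<Sum>s\<in>F. \<Sum>t\<in>F. c s * cnj (c t) * expo (s - t) x) \<partial>M)"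
    by (subst integral_complex_of_real[symmetric]) (simp only: pointwise)
  also have "\<dots> = 1 - (\<Sum>s\<in>F. cnj (c s) * (\<integral>x. expo (\<xi> - s) x \<partial>M))
      - (\<Sum>s\<in>F. c s * (\<integral>x. expo (s - \<xi>) x \<partial>M))
      + (\<Sum>s\<in>F. \<Sum>t\<in>F. c s * cnj (c t) * (\<integral>x. expo (s - t) x \<partial>M))"
    using prob_space by (simp add: int integral_sum Bochner_Integration.integral_sum)
  also have "\<dots> = 1 - (\<Sum>s\<in>F. cnj (c s) * c s) - (\<Sum>s\<in>F. c s * cnj (c s)) + (\<Sum>s\<in>F. c s * cnj (c s))"
  proof -
    have "(\<Sum>s\<in>F. \<Sum>t\<in>F. c s * cnj (c t) * (\<integral>x. expo (s - t) x \<partial>M)) =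
      (\<Sum>s\<in>F. \<Sum>t\<in>F. if s = t then c s * cnj (c t) else 0)"
      by (intro sum.cong refl) (simp add: orth')
    also have "\<dots> = (\<Sum>s\<in>F. c s * cnj (c s))" using F by simp
    finally show ?thesis by (simp only: ft_diff c[symmetric])
  qed
  also have "\<dots> = complex_of_real (1 - (\<Sum>s\<in>F. (cmod (c s))\<^sup>2))"
  proof -
    have "(\<Sum>s\<in>F. cnj (c s) * c s) = (\<Sum>s\<in>F. c s * cnj (c s))" by (simp only: mult.commute)
    moreover have "complex_of_real (\<Sum>s\<in>F. (cmod (c s))\<^sup>2) = (\<Sum>s\<in>F. c s * cnj (c s))"
      by (simp only: of_real_sum complex_norm_square)
    ultimately show ?thesis by (simp only: of_real_diff of_real_1) simp
  qed
  finally show ?thesis by (simp only: of_real_eq_iff)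
qed

text \<open>The sufficient half of the Jorgensen-Pedersen criterion: Parseval for the exponentials
  alone puts each of them into the closure of the span, and these already generate all of
  L2.\<close>

lemma is_spectrumI:
  assumes S: "countable S" and bounded: "AE x in M. \<bar>x\<bar> \<le> r"
    and orth: "\<And>s t. s \<in> S \<Longrightarrow> t \<in> S \<Longrightarrow> s \<noteq> t \<Longrightarrow> char M (- (2 * pi * (s - t))) = 0"
    and total: "\<And>\<xi> e. e > 0 \<Longrightarrow> \<exists>F. finite F \<and> F \<subseteq> S \<and>
      (\<Sum>s\<in>F. (cmod (char M (- (2 * pi * (s + \<xi>)))))\<^sup>2) > 1 - e"
  shows "is_spectrum M S"
proof -
  have orth': "(\<integral>x. expo (s - t) x \<partial>M) = 0" if "s \<in> S" "t \<in> S" "s \<noteq> t" for s t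
    using orth[OF that] by (simp add: integral_expo)
  have "approximable S (expo \<xi>)" for \<xi>
    unfolding approximable_def
  proof (intro conjI allI impI)
    fix \<epsilon> :: real assume \<epsilon>: "\<epsilon> > 0"
    obtain F where F: "finite F" "F \<subseteq> S"
      "(\<Sum>s\<in>F. (cmod (char M (- (2 * pi * (s + (- \<xi>))))))\<^sup>2) > 1 - \<epsilon>"
      using total[OF \<epsilon>] by blast
    define c where "c s = (\<integral>x. expo (\<xi> - s) x \<partial>M)" for s
    have norm_c: "cmod (c s) = cmod (char M (- (2 * pi * (s + (- \<xi>)))))" for s
      using integral_expo_minus[of "s - \<xi>"] by (simp add: c_def integral_expo)
    define g where "g x = (\<Sum>s\<in>F. c s * expo s x)" for x
    have g: "g \<in> trig_polys S" unfolding trig_polys_def g_def using F by blast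
    then have [measurable]: "g \<in> borel_measurable borel" by (rule trig_polys_measurable)
    have bound: "cmod (expo \<xi> x - g x) \<le> 1 + (\<Sum>s\<in>F. cmod (c s))" for x
    proof -
      have "cmod (g x) \<le> (\<Sum>s\<in>F. cmod (c s))"
        unfolding g_def by (rule sum_norm_le) (simp add: norm_mult)
      then show ?thesis using norm_triangle_ineq4[of "expo \<xi> x" "g x"] by simp
    qed
    have "integrable M (\<lambda>x. (cmod (expo \<xi> x - g x))\<^sup>2)"
      by (rule integrable_const_bound[of _ "(1 + (\<Sum>s\<in>F. cmod (c s)))\<^sup>2"])
         (auto intro!: power_mono bound)
    then have "(\<integral>\<^sup>+x. ennreal ((cmod (expo \<xi> x - g x))\<^sup>2) \<partial>M) =
      ennreal (\<integral>x. (cmod (expo \<xi> x - g x))\<^sup>2 \<partial>M)"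
      by (rule nn_integral_eq_integral) simp
    also have "(\<integral>x. (cmod (expo \<xi> x - g x))\<^sup>2 \<partial>M) = 1 - (\<Sum>s\<in>F. (cmod (c s))\<^sup>2)"
      unfolding g_def by (rule integral_expo_approximation) (use F orth' in \<open>auto simp: c_def\<close>)
    also have "ennreal \<dots> < ennreal \<epsilon>"
      using F(3) \<epsilon> unfolding norm_c by (intro ennreal_lessI) auto
    finally show "\<exists>g\<in>trig_polys S. (\<integral>\<^sup>+x. ennreal ((cmod (expo \<xi> x - g x))\<^sup>2) \<partial>M) < ennreal \<epsilon>"
      using g by blast
  qed simp
  then have approx: "approximable S f" if "square_integrable M f" for f
    using approximable_of_dense_sums[OF bounded _ that] by blast
  show ?thesis unfolding is_spectrum_def
  proof (intro conjI ballI allI impI S)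
    fix s t assume "s \<in> S" "t \<in> S"
    then show "(\<integral>x. expo s x * cnj (expo t x) \<partial>M) = (if s = t then 1 else 0)"
      using orth' prob_space by (auto simp: expo_cnj_expo)
  next
    fix f and \<epsilon> :: real assume f: "square_integrable M f" and \<epsilon>: "\<epsilon> > 0"
    have [measurable]: "f \<in> borel_measurable borel" using f by (simp add: square_integrable_def borel_measurable_eq_borel)
    have "\<epsilon>\<^sup>2 > 0" using \<epsilon> by simp
    then obtain g where g: "g \<in> trig_polys S" "(\<integral>\<^sup>+x. ennreal ((cmod (f x - g x))\<^sup>2) \<partial>M) < ennreal (\<epsilon>\<^sup>2)"
      using approx[OF f] unfolding approximable_def by blast
    obtain F c where F: "finite F" "F \<subseteq> S" "g = (\<lambda>x. \<Sum>s\<in>F. c s * expo s x)"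
      using g(1) by (auto simp: trig_polys_def)
    have [measurable]: "g \<in> borel_measurable borel" by (rule trig_polys_measurable[OF g(1)])
    have "(\<integral>x. (cmod (f x - g x))\<^sup>2 \<partial>M) = enn2real (\<integral>\<^sup>+x. ennreal ((cmod (f x - g x))\<^sup>2) \<partial>M)"
      by (rule integral_eq_nn_integral) auto
    also have "\<dots> < \<epsilon>\<^sup>2"
    proof (rule ccontr)
      assume "\<not> ?thesis"
      then have "ennreal (\<epsilon>\<^sup>2) \<le> ennreal (enn2real (\<integral>\<^sup>+x. ennreal ((cmod (f x - g x))\<^sup>2) \<partial>M))"
        by (intro ennreal_leI) simp
      also have "\<dots> = (\<integral>\<^sup>+x. ennreal ((cmod (f x - g x))\<^sup>2) \<partial>M)"
        using g(2) by (intro ennreal_enn2real) (auto intro: less_trans)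
      finally show False using g(2) by simp
    qed
    finally show "\<exists>F c. finite F \<and> F \<subseteq> S \<and> (\<integral>x. (cmod (f x - (\<Sum>s\<in>F. c s * expo s x)))\<^sup>2 \<partial>M) < \<epsilon>\<^sup>2"
      using F by blast
  qed
qed

end

section \<open>Measurability\<close>

lemma space_seq_borel: "space (seq_borel m) = seq_space m"
proof -
  interpret Metric_space "seq_space m" seq_dist by (rule Metric_space_seq_dist)
  have "{U. openin mtopology U} \<subseteq> Pow (seq_space m)" using openin_subset by force
  then show ?thesis by (simp add: seq_borel_def space_measure_of)
qed

text \<open>The preimage of any set is open, because all members of the ball of radius
  \<open>(1/2) ^ k\<close> around a sequence share its first \<open>k\<close> letters.\<close>

lemma measurable_of_prefix:
  assumes agree: "\<And>\<alpha> \<beta>. \<alpha> \<in> seq_space m \<Longrightarrow> \<beta> \<in> seq_space m \<Longrightarrow> (\<And>i. i < k \<Longrightarrow> \<alpha> i = \<beta> i) \<Longrightarrow> f \<alpha> = f \<beta>"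
    and "\<And>\<alpha>. \<alpha> \<in> seq_space m \<Longrightarrow> f \<alpha> \<in> space M"
  shows "f \<in> measurable (seq_borel m) M"
proof (rule measurableI)
  show "f \<alpha> \<in> space M" if "\<alpha> \<in> space (seq_borel m)" for \<alpha>
    using that assms(2) by (simp add: space_seq_borel)
  fix A
  interpret Metric_space "seq_space m" seq_dist by (rule Metric_space_seq_dist)
  have sub: "{U. openin mtopology U} \<subseteq> Pow (seq_space m)" using openin_subset by force
  have "openin mtopology (f -` A \<inter> seq_space m)"
    unfolding openin_mtopology
  proof (intro conjI allI impI)
    fix \<alpha> assume a: "\<alpha> \<in> f -` A \<inter> seq_space m"
    have "mball \<alpha> ((1/2) ^ k) \<subseteq> f -` A \<inter> seq_space m"
    proof
      fix \<beta> assume b: "\<beta> \<in> mball \<alpha> ((1/2) ^ k)"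
      then have bs: "\<beta> \<in> seq_space m" "seq_dist \<alpha> \<beta> < (1/2) ^ k" by auto
      have "\<alpha> i = \<beta> i" if i: "i < k" for i
      proof (rule ccontr)
        assume ne: "\<alpha> i \<noteq> \<beta> i"
        then have "(LEAST j. \<alpha> j \<noteq> \<beta> j) \<le> i" by (rule Least_le)
        then have "(1/2::real) ^ k \<le> (1/2) ^ (LEAST j. \<alpha> j \<noteq> \<beta> j)"
          using i by (intro power_decreasing) auto
        moreover have "\<alpha> \<noteq> \<beta>" using ne by auto
        ultimately show False using bs(2) by (simp add: seq_dist_def)
      qed
      then have "f \<alpha> = f \<beta>" using agree a bs(1) by blast
      then show "\<beta> \<in> f -` A \<inter> seq_space m" using a bs(1) by auto
    qed
    then show "\<exists>r>0. mball \<alpha> r \<subseteq> f -` A \<inter> seq_space m"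
      by (intro exI[of _ "(1/2) ^ k"]) simp
  qed simp
  then show "f -` A \<inter> space (seq_borel m) \<in> sets (seq_borel m)"
    unfolding space_seq_borel using sub by (simp add: seq_borel_def sets_measure_of)
qed

lemma finite_convolution_cong:
  "(\<And>i. i < k \<Longrightarrow> \<nu> i = \<nu>' i) \<Longrightarrow> finite_convolution \<nu> k = finite_convolution \<nu>' k"
  by (induction k) auto

text \<open>Integrals of bounded continuous functions are limits of integrals against finite
  convolutions, which depend on finitely many letters. Ramps then give the half-lines, an
  intersection-stable generator of the Borel sets.\<close>

lemma random_measure_mu_conv:
  assumes P: "sets P = sets (seq_borel m)"
    and seq: "\<And>\<omega>. \<omega> \<in> seq_space m \<Longrightarrow> digit_sequence (\<lambda>i. N (\<omega> i) ^ n i) (\<lambda>i. B (\<omega> i)) R"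
  shows "random_measure P (mu_conv N B n)"
proof -
  define D where "D \<omega> k = uniform_dirac
     ((\<lambda>b. real_of_int b / (\<Prod>i\<le>k. real_of_int (N (\<omega> i)) ^ n i)) ` B (\<omega> k))" for \<omega> :: "nat \<Rightarrow> nat" and k
  have limit: "real_distribution (mu_conv N B n \<omega>)" "weak_conv_m (finite_convolution (D \<omega>)) (mu_conv N B n \<omega>)"
    "\<And>k. real_distribution (finite_convolution (D \<omega>) k)" if \<omega>: "\<omega> \<in> seq_space m" for \<omega>
  proof -
    interpret digit_sequence "\<lambda>i. N (\<omega> i) ^ n i" "\<lambda>i. B (\<omega> i)" R by (rule seq[OF \<omega>])
    have D: "digit_dirac = D \<omega>"
      by (rule ext) (simp add: digit_dirac_def scale_def lessThan_Suc_atMost D_def)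
    have "mu_conv N B n \<omega> = digit_measure"
      by (rule mu_conv_eq_digit_measure) (rule digit_sequence_axioms)
    then show "real_distribution (mu_conv N B n \<omega>)" "weak_conv_m (finite_convolution (D \<omega>)) (mu_conv N B n \<omega>)"
      "real_distribution (finite_convolution (D \<omega>) k)" for k
      using digit_measure_limit real_distribution_finite_convolution by (simp_all add: D)
  qed
  have space_P: "space P = seq_space m" using sets_eq_imp_space_eq[OF P] by (simp add: space_seq_borel)
  have int: "(\<lambda>\<omega>. integral\<^sup>L (mu_conv N B n \<omega>) f) \<in> borel_measurable P"
    if f: "\<And>x. isCont f x" "\<And>x. norm (f x) \<le> 1" for f :: "real \<Rightarrow> real"
  proof (rule borel_measurable_LIMSEQ_real)
    fix \<omega> assume "\<omega> \<in> space P"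
    then have "\<omega> \<in> seq_space m" by (simp add: space_P)
    then show "(\<lambda>k. integral\<^sup>L (finite_convolution (D \<omega>) k) f) \<longlonglongrightarrow> integral\<^sup>L (mu_conv N B n \<omega>) f"
      by (intro weak_conv_imp_integral_bdd_continuous_conv[where B = 1] limit f)
  next
    fix k
    have "(\<lambda>\<omega>. integral\<^sup>L (finite_convolution (D \<omega>) k) f) \<in> measurable (seq_borel m) borel"
    proof (rule measurable_of_prefix[of _ k])
      fix \<alpha> \<beta> :: "nat \<Rightarrow> nat" assume "\<And>i. i < k \<Longrightarrow> \<alpha> i = \<beta> i"
      then have "finite_convolution (D \<alpha>) k = finite_convolution (D \<beta>) k"
        by (intro finite_convolution_cong) (simp add: D_def)
      then show "integral\<^sup>L (finite_convolution (D \<alpha>) k) f = integral\<^sup>L (finite_convolution (D \<beta>) k) f" by simp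
    qed simp
    then show "(\<lambda>\<omega>. integral\<^sup>L (finite_convolution (D \<omega>) k) f) \<in> borel_measurable P"
      by (simp add: measurable_cong_sets[OF P refl])
  qed
  have halfline: "(\<lambda>\<omega>. measure (mu_conv N B n \<omega>) {..b}) \<in> borel_measurable P" for b
  proof (rule borel_measurable_LIMSEQ_real)
    let ?g = "\<lambda>p x. max 0 (min 1 (1 - real p * (x - b)))"
    show "(\<lambda>\<omega>. integral\<^sup>L (mu_conv N B n \<omega>) (?g p)) \<in> borel_measurable P" for p
    proof (rule int)
      show "isCont (?g p) x" for x by (intro continuous_intros)
      show "norm (?g p x) \<le> 1" for x by auto
    qed
    fix \<omega> assume "\<omega> \<in> space P"
    then interpret real_distribution "mu_conv N B n \<omega>" using limit by (simp add: space_P)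
    have "(\<lambda>p. integral\<^sup>L (mu_conv N B n \<omega>) (?g p)) \<longlonglongrightarrow> integral\<^sup>L (mu_conv N B n \<omega>) (indicator {..b})"
    proof (rule integral_dominated_convergence[where w = "\<lambda>_. 1"])
      show "AE x in mu_conv N B n \<omega>. (\<lambda>p. ?g p x) \<longlonglongrightarrow> indicator {..b} x"
        by (intro AE_I2 ramp_tendsto_indicator)
    qed auto
    then show "(\<lambda>p. integral\<^sup>L (mu_conv N B n \<omega>) (?g p)) \<longlonglongrightarrow> measure (mu_conv N B n \<omega>) {..b}"
      by simp
  qed
  have "mu_conv N B n \<in> measurable P (subprob_algebra borel)"
  proof (rule measurable_subprob_algebra_generated)
    show "sets borel = sigma_sets UNIV (range (\<lambda>b::real. {..b}))" by (simp add: borel_eq_atMost)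
    show "Int_stable (range (\<lambda>b::real. {..b}))" by (auto simp: Int_stable_def)
    show "range (\<lambda>b::real. {..b}) \<subseteq> Pow UNIV" by simp
    fix \<omega> assume "\<omega> \<in> space P"
    then interpret real_distribution "mu_conv N B n \<omega>" using limit by (simp add: space_P)
    show "subprob_space (mu_conv N B n \<omega>)" by (rule prob_space_imp_subprob_space) (rule prob_space_axioms)
    show "sets (mu_conv N B n \<omega>) = sets borel" by simp
  next
    fix A assume "A \<in> range (\<lambda>b::real. {..b})"
    then obtain b where b: "A = {..b}" by blast
    have "(\<lambda>\<omega>. ennreal (measure (mu_conv N B n \<omega>) A)) \<in> borel_measurable P"
      unfolding b using halfline by simp
    moreover have "emeasure (mu_conv N B n \<omega>) A = ennreal (measure (mu_conv N B n \<omega>) A)"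
      if "\<omega> \<in> space P" for \<omega>
    proof -
      interpret real_distribution "mu_conv N B n \<omega>" using limit that by (simp add: space_P)
      show ?thesis by (rule emeasure_eq_measure)
    qed
    ultimately show "(\<lambda>\<omega>. emeasure (mu_conv N B n \<omega>) A) \<in> borel_measurable P"
      by (simp cong: measurable_cong)
  next
    have "emeasure (mu_conv N B n \<omega>) UNIV = 1" if "\<omega> \<in> space P" for \<omega>
    proof -
      interpret real_distribution "mu_conv N B n \<omega>" using limit that by (simp add: space_P)
      show ?thesis using emeasure_space_1 by simp
    qed
    then show "(\<lambda>\<omega>. emeasure (mu_conv N B n \<omega>) UNIV) \<in> borel_measurable P"
      by (simp cong: measurable_cong)
  qed
  then have "(\<lambda>\<omega>. emeasure (mu_conv N B n \<omega>) A) \<in> borel_measurable P" if "A \<in> sets borel" for A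
    using that by (rule measurable_emeasure_kernel)
  moreover have "sets (mu_conv N B n \<omega>) = sets borel" if "\<omega> \<in> space P" for \<omega>
  proof -
    interpret real_distribution "mu_conv N B n \<omega>" using limit that by (simp add: space_P)
    show ?thesis by simp
  qed
  ultimately show ?thesis by (simp add: random_measure_def)
qed

section \<open>Singular limits of tails\<close>

text \<open>The squared moduli of the mask over all residues sum to
  \<open>a / card B \<le> 1\<close>, and the residue 0 alone contributes 1.\<close>

lemma mask_complete_residues:
  assumes a: "a \<ge> 2" and B: "finite B" "B \<noteq> {}"
    and distinct: "\<And>b b'. b \<in> B \<Longrightarrow> b' \<in> B \<Longrightarrow> b \<noteq> b' \<Longrightarrow> \<not> a dvd b - b'"
    and card: "a \<le> int (card B)" and q: "\<not> a dvd q"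
  shows "mask B (of_int q / of_int a) = 0"
proof -
  define m where "m l = (cmod (mask B (of_real (0 + real l / of_int a))))\<^sup>2" for l
  have orth: "(\<Sum>l<nat a. cis (- (2 * pi * of_int (b - b') * (real l / of_int a)))) = 0"
    if "b \<in> B" "b' \<in> B" "b \<noteq> b'" for b b'
    using sum_cis_residues[of a "b - b'" 1] a distinct[OF that] by simp
  have sum: "(\<Sum>l<nat a. m l) = real (nat a) / real (card B)"
    using sum_norm_mask_squared[OF B orth, where y = 0] by (simp add: m_def)
  have cB: "real (card B) > 0" using B by (simp add: card_gt_0_iff)
  have "m 0 = 1" using B by (simp add: m_def)
  moreover have "(\<Sum>l<nat a. m l) = m 0 + (\<Sum>l\<in>{..<nat a} - {0}. m l)"
    using a by (intro sum.remove) auto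
  moreover have "real (nat a) / real (card B) \<le> 1" using card a cB by (simp add: divide_le_eq)
  ultimately have "(\<Sum>l\<in>{..<nat a} - {0}. m l) \<le> 0" using sum by linarith
  then have z: "(\<Sum>l\<in>{..<nat a} - {0}. m l) = 0"
    by (intro antisym sum_nonneg) (auto simp: m_def)
  have zero: "m l = 0" if "l \<in> {..<nat a} - {0}" for l
    using z that by (subst (asm) sum_nonneg_eq_0_iff) (auto simp: m_def)
  define l where "l = nat (q mod a)"
  have l: "int l = q mod a" using a by (simp add: l_def)
  then have "l < nat a" using a pos_mod_bound[of a q] by linarith
  moreover have "l \<noteq> 0" using l q by (auto simp: dvd_eq_mod_eq_0)
  ultimately have "l \<in> {..<nat a} - {0}" by simp
  then have "mask B (of_real (real l / of_int a)) = 0" using zero[of l] by (simp add: m_def)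
  moreover have "of_int q / of_int a = complex_of_real (real l / of_int a) + of_int (q div a)"
  proof -
    have "q = int l + a * (q div a)" by (simp add: l)
    then have "complex_of_int q = of_nat l + of_int a * of_int (q div a)"
      by (metis of_int_add of_int_mult of_int_of_nat_eq)
    then show ?thesis using a by (simp add: field_simps)
  qed
  ultimately show ?thesis by (simp only: mask_periodic)
qed

text \<open>Divide \<open>q\<close> by successive \<open>a i\<close> as long as this is possible.
  Each division at least halves \<open>\<bar>q\<bar>\<close>, so within \<open>W\<close> steps some
  \<open>a i\<close> fails to divide, and the mask of that step vanishes.\<close>

lemma (in residue_sequence) mask_prod_complete_residues:
  assumes "\<And>i. a i \<le> int (card (B i))" "q \<noteq> 0" "\<bar>q\<bar> < 2 ^ W"
  shows "mask_prod a B W (of_int q) = 0"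
  using assms residue_sequence_axioms
proof (induction W arbitrary: a B q)
  case 0
  then show ?case by simp
next
  case (Suc W)
  interpret rs: residue_sequence a B R Q by fact
  have split: "mask_prod a B (1 + W) z = mask_prod a B 1 z *
     mask_prod (\<lambda>i. a (1 + i)) (\<lambda>i. B (1 + i)) W (z / of_int (scale a 1))" for z
    by (rule rs.mask_prod_add)
  have one: "mask_prod a B 1 z = mask (B 0) (z / of_int (a 0))" "scale a 1 = a 0" for z
    by (simp_all add: mask_prod_def scale_def)
  show ?case
  proof (cases "a 0 dvd q")
    case False
    have "mask (B 0) (of_int q / of_int (a 0)) = 0"
      by (rule mask_complete_residues[OF rs.a_ge_2 rs.finite_B rs.B_nonempty rs.distinct_mod Suc.prems(1) False])
    then show ?thesis using split[of "of_int q"] one by simp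
  next
    case True
    then obtain q' where q': "q = a 0 * q'" by blast
    have a0: "a 0 \<ge> 2" by (rule rs.a_ge_2)
    have "q' \<noteq> 0" using Suc.prems(2) q' by auto
    moreover have "\<bar>q'\<bar> < 2 ^ W"
    proof -
      have "2 * \<bar>q'\<bar> \<le> a 0 * \<bar>q'\<bar>" using a0 by (intro mult_right_mono) auto
      also have "\<dots> = \<bar>q\<bar>" using a0 by (simp add: q' abs_mult)
      also have "\<dots> < 2 * 2 ^ W" using Suc.prems(3) by simp
      finally show ?thesis by simp
    qed
    ultimately have "mask_prod (\<lambda>i. a (1 + i)) (\<lambda>i. B (1 + i)) W (of_int q') = 0"
      by (intro Suc.IH rs.residue_shift Suc.prems(1))
    moreover have "of_int q / of_int (scale a 1) = (of_int q' :: complex)"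
      unfolding one q' using a0 by simp
    ultimately show ?thesis using split[of "of_int q"] by simp
  qed
qed

text \<open>Sequential compactness of the sequence space by diagonal extraction; coordinate
  \<open>i\<close> is constant along the diagonal from index \<open>Suc i\<close> on.\<close>

lemma finite_alphabet_subsequence:
  fixes x :: "nat \<Rightarrow> nat \<Rightarrow> nat"
  assumes "\<And>j i. x j i \<in> {1..m}"
  obtains r y where "strict_mono r" "\<And>i. \<forall>\<^sub>F j in sequentially. x (r j) i = y i" "\<And>i. y i \<in> {1..m}"
proof -
  interpret subseqs "\<lambda>n s. \<exists>c. \<forall>j. x (s j) n = c"
  proof
    fix n and s :: "nat \<Rightarrow> nat" assume "strict_mono s"
    have "finite ((\<lambda>j. x (s j) n) ` UNIV)" by (rule finite_subset[of _ "{1..m}"]) (use assms in auto)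
    then obtain j0 where inf: "infinite {j \<in> UNIV. x (s j) n = x (s j0) n}"
      using pigeonhole_infinite[of UNIV "\<lambda>j. x (s j) n"] by auto
    define r where "r = enumerate {j. x (s j) n = x (s j0) n}"
    have inf': "infinite {j. x (s j) n = x (s j0) n}" using inf by simp
    have "strict_mono r" unfolding r_def by (rule strict_mono_enumerate[OF inf'])
    moreover have "x (s (r j)) n = x (s j0) n" for j
      using enumerate_in_set[OF inf', of j] by (simp add: r_def)
    ultimately show "\<exists>r'::nat \<Rightarrow> nat. strict_mono r' \<and> (\<exists>c. \<forall>j. x ((s \<circ> r') j) n = c)"
      by (metis comp_apply)
  qed
  have "\<exists>c. \<forall>j. x ((diagseq \<circ> (+) (Suc i)) j) i = c" for i
    by (rule diagseq_holds) (metis comp_apply)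
  then obtain y where y: "\<And>i j. x (diagseq (Suc i + j)) i = y i" by (metis comp_apply)
  show ?thesis
  proof (rule that[of diagseq y])
    show "strict_mono diagseq" by (rule subseq_diagseq)
    show "\<forall>\<^sub>F j in sequentially. x (diagseq j) i = y i" for i
      unfolding eventually_sequentially
    proof (intro exI allI impI)
      fix j assume "Suc i \<le> j"
      then show "x (diagseq j) i = y i" using y[where i = i and j = "j - Suc i"] by simp
    qed
    show "y i \<in> {1..m}" for i using assms[of "diagseq (Suc i + 0)" i] unfolding y .
  qed
qed

section \<open>Zeros of the characteristic function preclude singularity\<close>

context real_distribution
begin

lemma integral_norm_trig_poly:
  assumes F: "finite F"
    and orth: "\<And>s t. s \<in> F \<Longrightarrow> t \<in> F \<Longrightarrow> s \<noteq> t \<Longrightarrow> (\<integral>x. expo (s - t) x \<partial>M) = 0"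
  shows "(\<integral>x. (cmod (\<Sum>s\<in>F. c s * expo s x))\<^sup>2 \<partial>M) = (\<Sum>s\<in>F. (cmod (c s))\<^sup>2)"
proof -
  have pointwise: "complex_of_real ((cmod (\<Sum>s\<in>F. c s * expo s x))\<^sup>2) =
    (\<Sum>s\<in>F. \<Sum>t\<in>F. c s * cnj (c t) * expo (s - t) x)" for x
    unfolding complex_norm_square cnj_sum sum_product
    by (intro sum.cong refl) (simp add: expo_cnj_expo[symmetric] mult_ac)
  have orth': "(\<integral>x. expo (s - t) x \<partial>M) = (if s = t then 1 else 0)" if "s \<in> F" "t \<in> F" for s t
    using orth[OF that] prob_space by auto
  have "complex_of_real (\<integral>x. (cmod (\<Sum>s\<in>F. c s * expo s x))\<^sup>2 \<partial>M) =
    (\<integral>x. (\<Sum>s\<in>F. \<Sum>t\<in>F. c s * cnj (c t) * expo (s - t) x) \<partial>M)"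
    by (subst integral_complex_of_real[symmetric]) (simp only: pointwise)
  also have "\<dots> = (\<Sum>s\<in>F. \<Sum>t\<in>F. c s * cnj (c t) * (\<integral>x. expo (s - t) x \<partial>M))"
    by (simp add: integrable_expo Bochner_Integration.integral_sum)
  also have "\<dots> = (\<Sum>s\<in>F. \<Sum>t\<in>F. if s = t then c s * cnj (c t) else 0)"
    by (intro sum.cong refl) (simp add: orth')
  also have "\<dots> = (\<Sum>s\<in>F. c s * cnj (c s))" using F by simp
  also have "\<dots> = complex_of_real (\<Sum>s\<in>F. (cmod (c s))\<^sup>2)"
    by (simp only: of_real_sum complex_norm_square)
  finally show ?thesis by (simp only: of_real_eq_iff)
qed

text \<open>A Fejer kernel of period \<open>1 / \<sigma>\<close> that is large on the given interval.\<close>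

lemma measure_interval_le:
  assumes \<sigma>: "\<sigma> > 0" and zero: "\<And>q::int. q \<noteq> 0 \<Longrightarrow> char M (- (2 * pi * (\<sigma> * of_int q))) = 0"
    and n: "n > 0"
  shows "measure M {y - 1 / (6 * real n * \<sigma>)..y + 1 / (6 * real n * \<sigma>)} \<le> 4 / real n"
proof -
  \<comment> \<open>The exponentials with frequencies \<open>\<sigma> * k\<close>,
    \<open>k < n\<close>, are orthonormal by the zeros. For \<open>x\<close> within \<open>h\<close>
    of \<open>y\<close> each phase is at most \<open>2 * pi * \<sigma> * n * h = pi / 3\<close>,
    with cosine 1/2, so \<open>cmod (g x) \<ge> 1/2\<close>, against a squared norm of
    \<open>1 / n\<close>.\<close>
  define h where "h = 1 / (6 * real n * \<sigma>)"
  define F where "F = (\<lambda>k. \<sigma> * real k) ` {..<n}"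
  define c where "c s = expo (- s) y / of_nat n" for s
  define g where "g x = (\<Sum>s\<in>F. c s * expo s x)" for x
  have inj: "inj_on (\<lambda>k. \<sigma> * real k) {..<n}" using \<sigma> by (auto intro!: inj_onI)
  have [measurable]: "g \<in> borel_measurable borel" unfolding g_def by measurable
  have "(\<integral>x. (cmod (g x))\<^sup>2 \<partial>M) = (\<Sum>s\<in>F. (cmod (c s))\<^sup>2)"
    unfolding g_def
  proof (rule integral_norm_trig_poly)
    show "finite F" by (simp add: F_def)
    fix s t assume "s \<in> F" "t \<in> F" "s \<noteq> t"
    then obtain i j :: nat where ij: "s = \<sigma> * real i" "t = \<sigma> * real j" "i \<noteq> j" by (auto simp: F_def)
    then have "s - t = \<sigma> * of_int (int i - int j)" "int i - int j \<noteq> 0" by (simp_all add: algebra_simps)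
    then show "(\<integral>x. expo (s - t) x \<partial>M) = 0" using zero by (simp only: integral_expo)
  qed
  also have "\<dots> = (\<Sum>k<n. (1 / real n)\<^sup>2)"
    unfolding F_def by (subst sum.reindex[OF inj]) (simp add: c_def norm_divide)
  also have "\<dots> = 1 / real n" using n by (simp add: power2_eq_square)
  finally have int: "(\<integral>x. (cmod (g x))\<^sup>2 \<partial>M) = 1 / real n" .
  have large: "1 / 2 \<le> cmod (g x)" if x: "x \<in> {y - h..y + h}" for x
  proof -
    have "g x = (\<Sum>k<n. expo (\<sigma> * real k) (x - y) / of_nat n)"
      unfolding g_def F_def sum.reindex[OF inj] o_def c_def
      by (intro sum.cong refl) (simp add: expo_def algebra_simps flip: exp_add)
    then have "Re (g x) = (\<Sum>k<n. cos (2 * pi * (\<sigma> * real k) * (x - y)) / real n)"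
      by (simp add: expo_def Re_exp mult.assoc)
    also have "\<dots> \<ge> (\<Sum>k<n. (1 / 2) / real n)"
    proof (intro sum_mono divide_right_mono)
      fix k assume "k \<in> {..<n}"
      have "\<bar>2 * pi * (\<sigma> * real k) * (x - y)\<bar> = 2 * pi * (\<sigma> * real k) * \<bar>x - y\<bar>"
        using \<sigma> by (simp add: abs_mult)
      also have "\<dots> \<le> 2 * pi * (\<sigma> * real n) * h"
        using x \<sigma> \<open>k \<in> {..<n}\<close> by (intro mult_mono mult_left_mono) auto
      also have "\<dots> = pi / 3" using \<sigma> n by (simp add: h_def)
      finally have "\<bar>2 * pi * (\<sigma> * real k) * (x - y)\<bar> \<le> pi / 3" .
      then have "cos (pi / 3) \<le> cos \<bar>2 * pi * (\<sigma> * real k) * (x - y)\<bar>"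
        by (intro cos_monotone_0_pi_le) auto
      then show "1 / 2 \<le> cos (2 * pi * (\<sigma> * real k) * (x - y))" by (simp add: cos_60)
    qed simp
    finally have "1 / 2 \<le> Re (g x)" using n by simp
    then show ?thesis using complex_Re_le_cmod[of "g x"] by linarith
  qed
  have bound: "cmod (g x) \<le> (\<Sum>s\<in>F. cmod (c s))" for x
    unfolding g_def by (rule sum_norm_le) (simp add: norm_mult)
  have integ: "integrable M (\<lambda>x. (cmod (g x))\<^sup>2)"
    by (rule integrable_const_bound[of _ "(\<Sum>s\<in>F. cmod (c s))\<^sup>2"]) (auto intro!: power_mono bound)
  have "measure M {y - h..y + h} / 4 = (\<integral>x. indicator {y - h..y + h} x * (1 / 4) \<partial>M)" by simp
  also have "\<dots> \<le> (\<integral>x. (cmod (g x))\<^sup>2 \<partial>M)"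
  proof (rule integral_mono)
    show "integrable M (\<lambda>x. indicator {y - h..y + h} x * (1 / 4) :: real)"
      by (rule integrable_const_bound[of _ 1]) (auto simp: indicator_def)
    show "indicator {y - h..y + h} x * (1 / 4) \<le> (cmod (g x))\<^sup>2" for x
      using power_mono[OF large[of x], of 2] by (auto simp: indicator_def power2_eq_square)
  qed (rule integ)
  finally show ?thesis using int by (simp add: h_def)
qed

text \<open>Let \<open>u n y\<close> be \<open>1 / h n\<close> times the Lebesgue measure of the
  part of \<open>U\<close> in the window around \<open>y\<close>. By Fubini its integral against
  \<open>M\<close> is an integral over \<open>U\<close> of window masses, which \<open>le\<close>
  bounds. As \<open>U\<close> is open, \<open>u n\<close> is eventually at least 1 at each point of
  \<open>U\<close>, and Fatou concludes.\<close>

lemma emeasure_open_le: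
  assumes U: "open U" and D: "D > 0"
    and h: "\<And>n::nat. h n > 0" "h \<longlonglongrightarrow> 0"
    and le: "\<And>n y. measure M {y - h n..y + h n} \<le> D * h n"
  shows "emeasure M U \<le> ennreal D * emeasure lborel U"
proof -
  interpret ps: pair_sigma_finite lborel M
    by (rule pair_sigma_finite.intro) (rule lborel.sigma_finite_measure_axioms, rule sigma_finite_measure_axioms)
  have [measurable]: "U \<in> sets borel" using U by simp
  define u where "u n y = (\<integral>\<^sup>+x. indicator U x * indicator {y - h n..y + h n} x * ennreal (1 / h n) \<partial>lborel)" for n y
  define f where "f n x y = indicator U x * indicator {z. \<bar>fst z - snd z\<bar> \<le> h n} (x, y) * ennreal (1 / h n)"
    for n and x y :: real
  have fm [measurable]: "case_prod (f n) \<in> borel_measurable (lborel \<Otimes>\<^sub>M M)" for n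
  proof -
    have "case_prod (f n) \<in> borel_measurable (borel \<Otimes>\<^sub>M borel)" unfolding f_def by measurable
    then show ?thesis by (simp add: measurable_cong_sets[OF sets_pair_measure_cong[OF sets_lborel events_eq_borel] refl])
  qed
  have u_eq: "u n y = (\<integral>\<^sup>+x. f n x y \<partial>lborel)" for n y
    unfolding u_def f_def by (intro nn_integral_cong) (auto simp: indicator_def abs_le_iff)
  have int_u: "(\<integral>\<^sup>+y. u n y \<partial>M) \<le> ennreal D * emeasure lborel U" for n
  proof -
    have "(\<integral>\<^sup>+y. u n y \<partial>M) = (\<integral>\<^sup>+x. (\<integral>\<^sup>+y. f n x y \<partial>M) \<partial>lborel)"
      unfolding u_eq by (rule ps.Fubini'[OF fm])
    also have "\<dots> \<le> (\<integral>\<^sup>+x. ennreal D * indicator U x \<partial>lborel)"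
    proof (rule nn_integral_mono)
      fix x :: real
      have "(\<integral>\<^sup>+y. f n x y \<partial>M) = (\<integral>\<^sup>+y. (indicator U x * ennreal (1 / h n)) * indicator {x - h n..x + h n} y \<partial>M)"
        unfolding f_def by (intro nn_integral_cong) (auto simp: indicator_def abs_le_iff)
      also have "\<dots> = (indicator U x * ennreal (1 / h n)) * emeasure M {x - h n..x + h n}"
        by (rule nn_integral_cmult_indicator) simp
      also have "\<dots> \<le> (indicator U x * ennreal (1 / h n)) * ennreal (D * h n)"
        using le[of x n] by (intro mult_left_mono) (auto simp: emeasure_eq_measure ennreal_leI)
      also have "\<dots> = (ennreal (D * h n) * ennreal (1 / h n)) * indicator U x" by (simp only: mult_ac)
      also have "ennreal (D * h n) * ennreal (1 / h n) = ennreal D"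
        using h(1)[of n] D by (simp add: ennreal_mult'[symmetric])
      finally show "(\<integral>\<^sup>+y. f n x y \<partial>M) \<le> ennreal D * indicator U x" .
    qed
    also have "\<dots> = ennreal D * emeasure lborel U" by (rule nn_integral_cmult_indicator) simp
    finally show ?thesis .
  qed
  have u_lim: "indicator U y \<le> liminf (\<lambda>n. u n y)" for y
  proof (cases "y \<in> U")
    case True
    then obtain e where e: "e > 0" "ball y e \<subseteq> U" using U openE by blast
    have "\<forall>\<^sub>F n in sequentially. h n < e" using h(2) e(1) by (rule order_tendstoD)
    then have "\<forall>\<^sub>F n in sequentially. 1 \<le> u n y"
    proof eventually_elim
      case (elim n)
      have "{y - h n..y + h n} \<subseteq> U"
        using elim e(2) by (auto simp: dist_real_def abs_less_iff intro!: subsetD[OF e(2)])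
      then have "u n y = (\<integral>\<^sup>+x. ennreal (1 / h n) * indicator {y - h n..y + h n} x \<partial>lborel)"
        unfolding u_def by (intro nn_integral_cong) (auto simp: indicator_def)
      also have "\<dots> = ennreal (1 / h n) * ennreal (2 * h n)"
        using h(1)[of n] by (simp add: nn_integral_cmult_indicator)
      also have "\<dots> = ennreal 2" using h(1)[of n] by (simp add: ennreal_mult'[symmetric])
      finally show ?case by simp
    qed
    then have "1 \<le> liminf (\<lambda>n. u n y)" by (rule Liminf_bounded)
    then show ?thesis using True by simp
  qed simp
  have um: "u n \<in> borel_measurable M" for n
    unfolding u_eq using fm by (intro lborel.borel_measurable_nn_integral) (auto simp: case_prod_beta')
  have "emeasure M U = (\<integral>\<^sup>+y. indicator U y \<partial>M)" by simp
  also have "\<dots> \<le> (\<integral>\<^sup>+y. liminf (\<lambda>n. u n y) \<partial>M)" by (intro nn_integral_mono u_lim)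
  also have "\<dots> \<le> liminf (\<lambda>n. \<integral>\<^sup>+y. u n y \<partial>M)" by (rule nn_integral_liminf[OF um])
  also have "\<dots> \<le> limsup (\<lambda>n. \<integral>\<^sup>+y. u n y \<partial>M)" by (rule Liminf_le_Limsup) simp
  also have "\<dots> \<le> ennreal D * emeasure lborel U" by (rule Limsup_bounded) (use int_u in simp)
  finally show ?thesis .
qed

lemma not_singular_of_char_zeros:
  assumes \<sigma>: "\<sigma> > 0" and zero: "\<And>q::int. q \<noteq> 0 \<Longrightarrow> char M (- (2 * pi * (\<sigma> * of_int q))) = 0"
  shows "\<not> mutually_singular M lborel"
proof
  assume "mutually_singular M lborel"
  then obtain A where A: "A \<in> sets M" "emeasure M A = 0" "emeasure lborel (UNIV - A) = 0"
    by (auto simp: mutually_singular_def)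
  have Ab: "A \<in> sets borel" using A(1) by simp
  \<comment> \<open>With these window sizes the interval bound \<open>4 / Suc n\<close> reads
    \<open>24 * \<sigma> * h n\<close>. The constant \<open>e\<close> is chosen to make
    \<open>24 * \<sigma> * e = 1/2\<close>, less than the full mass that \<open>U\<close> must
    carry.\<close>
  define h where "h n = 1 / (6 * real (Suc n) * \<sigma>)" for n
  define e where "e = 1 / (48 * \<sigma>)"
  have e: "e > 0" using \<sigma> by (simp add: e_def)
  have "UNIV - A \<in> sets lebesgue" using Ab by auto
  then obtain U where U: "open U" "UNIV - A \<subseteq> U" "emeasure lebesgue (U - (UNIV - A)) < ennreal e"
    using sets_lebesgue_outer_open[OF _ e] by metis
  have Ub: "U \<in> sets borel" using U(1) by simp
  have "emeasure lborel U \<le> emeasure lborel (UNIV - A) + emeasure lborel (U - (UNIV - A))"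
    using Ab Ub U(2) by (subst plus_emeasure) (auto intro!: emeasure_mono)
  also have "\<dots> < ennreal e" using U(3) A(3) Ab Ub by simp
  finally have le: "emeasure lborel U < ennreal e" .
  have "emeasure M U \<le> ennreal (24 * \<sigma>) * emeasure lborel U"
  proof (rule emeasure_open_le[OF U(1), where h = h])
    show "24 * \<sigma> > 0" using \<sigma> by simp
    show "h n > 0" for n using \<sigma> by (simp add: h_def)
    show "h \<longlonglongrightarrow> 0" unfolding h_def using \<sigma> by real_asymp
    show "measure M {y - h n..y + h n} \<le> 24 * \<sigma> * h n" for n y
    proof -
      have "24 * \<sigma> * h n = 4 / real (Suc n)" using \<sigma> by (simp add: h_def divide_simps)
      then show ?thesis using measure_interval_le[OF \<sigma> zero, of "Suc n" y] by (simp add: h_def)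
    qed
  qed
  also have "\<dots> \<le> ennreal (24 * \<sigma>) * ennreal e" using le by (intro mult_left_mono) auto
  also have "\<dots> = ennreal (1 / 2)" using \<sigma> by (simp add: e_def ennreal_mult'[symmetric])
  finally have "emeasure M U \<le> ennreal (1 / 2)" .
  moreover have "emeasure M UNIV \<le> emeasure M A + emeasure M U"
    using emeasure_subadditive[of A M U] emeasure_mono[of UNIV "A \<union> U" M] A(1) Ub U(2) by force
  moreover have "emeasure M UNIV = 1" using emeasure_space_1 by simp
  ultimately have "ennreal 1 \<le> ennreal (1 / 2)" using A(2) by simp
  then show False by (subst (asm) ennreal_le_iff) auto
qed

end

text \<open>The shifted sequences have a letterwise limit \<open>\<omega>'\<close> along a
  subsequence. If infinitely many letters of \<open>\<omega>'\<close> have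
  \<open>card B < N\<close>, any \<open>G\<close> of them reappear together at infinitely many
  shifts. Otherwise all digit sets of \<open>\<omega>'\<close> from some \<open>p\<close> on are
  complete residue systems, which gives the transform zeros that contradict singularity.\<close>

lemma window_of_non_degenerate:
  fixes N :: "nat \<Rightarrow> int"
  assumes \<omega>: "\<omega> \<in> seq_space m"
    and seq: "\<And>\<omega>. \<omega> \<in> seq_space m \<Longrightarrow> residue_sequence (\<lambda>i. N (\<omega> i)) (\<lambda>i. B (\<omega> i)) R Q"
    and nd: "non_degenerate N B \<omega>"
  shows "\<exists>W. infinite {k. G \<le> card {j. j < W \<and> int (card (B (\<omega> (k + j)))) < N (\<omega> (k + j))}}"
proof -
  obtain k \<eta> where k: "strict_mono k" and \<eta>: "real_distribution \<eta>"
    "weak_conv_m (\<lambda>j. nu_tail N B (k j) \<omega>) \<eta>" "mutually_singular \<eta> lborel"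
    using nd by (auto simp: non_degenerate_def)
  interpret \<eta>: real_distribution \<eta> by fact
  have sh: "(\<lambda>i. \<omega> (l + i)) \<in> seq_space m" for l using \<omega> by (simp add: seq_space_def)
  obtain r \<omega>' where r: "strict_mono r" "\<And>i. \<forall>\<^sub>F j in sequentially. \<omega> (k (r j) + i) = \<omega>' i"
    "\<And>i. \<omega>' i \<in> {1..m}"
    using finite_alphabet_subsequence[of "\<lambda>j i. \<omega> (k j + i)" m] \<omega> by (auto simp: seq_space_def)
  have agree: "\<forall>\<^sub>F j in sequentially. \<forall>i<W. \<omega> (k (r j) + i) = \<omega>' i" for W
  proof (induction W)
    case (Suc W)
    from eventually_conj[OF this r(2)[of W]] show ?case
      by (rule eventually_mono) (auto simp: less_Suc_eq)
  qed simp
  have \<omega>': "(\<lambda>i. \<omega>' (l + i)) \<in> seq_space m" for l using r(3) by (simp add: seq_space_def)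
  define good where "good i \<longleftrightarrow> int (card (B (\<omega>' i))) < N (\<omega>' i)" for i
  show ?thesis
  proof (cases "finite {i. good i}")
    case False
    then obtain F where F: "finite F" "card F = G" "F \<subseteq> {i. good i}"
      using infinite_arbitrarily_large by blast
    define W where "W = Suc (Max (insert 0 F))"
    have FW: "i < W" if "i \<in> F" for i
      using that F(1) by (simp add: W_def less_Suc_eq_le)
    obtain J where J: "\<And>j i. j \<ge> J \<Longrightarrow> i < W \<Longrightarrow> \<omega> (k (r j) + i) = \<omega>' i"
      using agree[of W] by (auto simp: eventually_sequentially)
    have "(\<lambda>j. k (r j)) ` {J..} \<subseteq> {k. G \<le> card {j. j < W \<and> int (card (B (\<omega> (k + j)))) < N (\<omega> (k + j))}}"
    proof clarify
      fix j assume "J \<le> j"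
      then have "F \<subseteq> {i. i < W \<and> int (card (B (\<omega> (k (r j) + i)))) < N (\<omega> (k (r j) + i))}"
        using F(3) FW J by (auto simp: good_def)
      then show "G \<le> card {i. i < W \<and> int (card (B (\<omega> (k (r j) + i)))) < N (\<omega> (k (r j) + i))}"
        using F(2) by (metis (no_types, lifting) card_mono finite_nat_set_iff_bounded mem_Collect_eq)
    qed
    moreover have "infinite ((\<lambda>j. k (r j)) ` {J..})"
    proof
      have "inj (\<lambda>j. k (r j))" using strict_mono_o[OF k r(1)] by (simp add: o_def strict_mono_imp_inj_on)
      then have "inj_on (\<lambda>j. k (r j)) {J..}" by (rule inj_on_subset) simp
      moreover assume "finite ((\<lambda>j. k (r j)) ` {J..})"
      ultimately have "finite {J..}" by (rule finite_imageD[rotated])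
      then show False by (simp add: infinite_Ici)
    qed
    ultimately show ?thesis by (meson finite_subset)
  next
    case True
    then obtain p where p: "\<And>i. i \<ge> p \<Longrightarrow> \<not> good i"
      by (metis finite_nat_set_iff_bounded mem_Collect_eq not_less)
    define a where "a i = N (\<omega>' i)" for i
    define D where "D i = B (\<omega>' i)" for i
    interpret rs: residue_sequence a D R Q
      unfolding a_def D_def using seq[OF \<omega>'[of 0]] by simp
    interpret rp: residue_sequence "\<lambda>i. a (p + i)" "\<lambda>i. D (p + i)" R Q by (rule rs.residue_shift)
    define \<sigma> where "\<sigma> = real_of_int (scale a p)"
    have \<sigma>: "\<sigma> > 0" using rs.scale_pos by (simp add: \<sigma>_def)
    have "char \<eta> (- (2 * pi * (\<sigma> * of_int q))) = 0" if q: "q \<noteq> 0" for q :: int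
    proof -
      define x where "x = \<sigma> * of_int q"
      obtain W0 :: nat where W0: "\<bar>q\<bar> < 2 ^ W0"
      proof -
        have "\<bar>q\<bar> < 2 ^ nat \<bar>q\<bar>" using less_exp[of "nat \<bar>q\<bar>"] 
          by (metis abs_ge_zero int_nat_eq nat_less_iff of_nat_numeral of_nat_power zless_nat_conj of_nat_less_iff)
        then show ?thesis by (rule that)
      qed
      have vanish: "mask_prod a D (p + W) (of_real x) = 0" if W: "W \<ge> W0" for W
      proof -
        have "(2::int) ^ W0 \<le> 2 ^ W" using W by (intro power_increasing) auto
        then have "\<bar>q\<bar> < 2 ^ W" using W0 by linarith
        then have "mask_prod (\<lambda>i. a (p + i)) (\<lambda>i. D (p + i)) W (of_int q) = 0"
          using p q by (intro rp.mask_prod_complete_residues) (auto simp: good_def a_def D_def not_less)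
        moreover have "complex_of_real x / of_int (scale a p) = of_int q"
          using \<sigma> by (simp add: x_def \<sigma>_def)
        ultimately show ?thesis by (simp add: rs.mask_prod_add)
      qed
      \<comment> \<open>The limit measure is not identified with the convolution along
        \<open>\<omega>'\<close>: at late indices the first \<open>p + W\<close> letters agree with
        \<open>\<omega>'\<close>, so the transform of the tail is this close to a product that
        vanishes.\<close>
      have bound: "cmod (char \<eta> (- (2 * pi * x))) \<le> rs.C * \<bar>x\<bar> / 2 ^ (p + W)" if W: "W \<ge> W0" for W
      proof (rule LIMSEQ_le_const2)
        have rd: "real_distribution (nu_tail N B (k j) \<omega>)" for j
        proof -
          interpret rk: residue_sequence "\<lambda>i. N (\<omega> (k j + i))" "\<lambda>i. B (\<omega> (k j + i))" R Q by (rule seq[OF sh])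
          show ?thesis unfolding nu_tail_def
            using rk.digit_measure_limit mu_conv_eq_digit_measure[of N "\<lambda>i. \<omega> (k j + i)" "\<lambda>_. 1" B R]
              rk.digit_sequence_axioms by simp
        qed
        have "(\<lambda>j. char (nu_tail N B (k j) \<omega>) (- (2 * pi * x))) \<longlonglongrightarrow> char \<eta> (- (2 * pi * x))"
          by (rule levy_continuity1) (use rd \<eta> in auto)
        from LIMSEQ_subseq_LIMSEQ[OF this r(1)]
        show "(\<lambda>j. cmod (char (nu_tail N B (k (r j)) \<omega>) (- (2 * pi * x)))) \<longlonglongrightarrow> cmod (char \<eta> (- (2 * pi * x)))"
          by (intro tendsto_norm) (simp add: o_def)
        obtain J where J: "\<And>j i. j \<ge> J \<Longrightarrow> i < p + W \<Longrightarrow> \<omega> (k (r j) + i) = \<omega>' i"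
          using agree[of "p + W"] by (auto simp: eventually_sequentially)
        have "cmod (char (nu_tail N B (k (r j)) \<omega>) (- (2 * pi * x))) \<le> rs.C * \<bar>x\<bar> / 2 ^ (p + W)" if j: "j \<ge> J" for j
        proof -
          interpret rk: residue_sequence "\<lambda>i. N (\<omega> (k (r j) + i))" "\<lambda>i. B (\<omega> (k (r j) + i))" R Q by (rule seq[OF sh])
          have "char (nu_tail N B (k (r j)) \<omega>) (- (2 * pi * x)) =
            mask_limit (\<lambda>i. N (\<omega> (k (r j) + i))) (\<lambda>i. B (\<omega> (k (r j) + i))) x"
            unfolding nu_tail_def
            using rk.char_digit_measure[of x] mu_conv_eq_digit_measure[of N "\<lambda>i. \<omega> (k (r j) + i)" "\<lambda>_. 1" B R]
              rk.digit_sequence_axioms by simp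
          moreover have "mask_prod (\<lambda>i. N (\<omega> (k (r j) + i))) (\<lambda>i. B (\<omega> (k (r j) + i))) (p + W) (of_real x) =
            mask_prod a D (p + W) (of_real x)"
            unfolding mask_prod_def scale_def a_def D_def using J[OF j]
            by (intro prod.cong refl arg_cong2[of _ _ _ _ mask] arg_cong2[of _ _ _ _ "(/)"] arg_cong[of _ _ of_int]) auto
          ultimately show ?thesis using rk.mask_limit_approx[of x "p + W"] vanish[OF W] by simp
        qed
        then show "\<exists>J. \<forall>j\<ge>J. cmod (char (nu_tail N B (k (r j)) \<omega>) (- (2 * pi * x))) \<le> rs.C * \<bar>x\<bar> / 2 ^ (p + W)"
          by blast
      qed
      have "cmod (char \<eta> (- (2 * pi * x))) \<le> 0"
      proof (rule LIMSEQ_le_const)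
        show "(\<lambda>W. rs.C * \<bar>x\<bar> / 2 ^ (p + W)) \<longlonglongrightarrow> 0" by real_asymp
        show "\<exists>W0. \<forall>W\<ge>W0. cmod (char \<eta> (- (2 * pi * x))) \<le> rs.C * \<bar>x\<bar> / 2 ^ (p + W)"
          using bound by blast
      qed
      then show ?thesis by (simp add: x_def)
    qed
    then have "\<not> mutually_singular \<eta> lborel" by (rule \<eta>.not_singular_of_char_zeros[OF \<sigma>])
    then show ?thesis using \<eta>(3) by blast
  qed
qed

section \<open>Spectra of random convolutions\<close>

text \<open>The sum is an integer polynomial at \<open>cis (2 * pi / N)\<close>, its exponents
  reduced modulo \<open>N\<close> to become natural numbers; dilation by \<open>t\<close> evaluates
  it at the \<open>t\<close>-th power.\<close>

lemma sum_cis_coprime_dilation: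
  fixes L :: "int set" and c N :: int and t :: nat
  assumes L: "finite L" and N: "N > 0" and t: "t > 0" "coprime (int t) N"
    and zero: "(\<Sum>l\<in>L. cis (2 * pi * (of_int c * of_int l) / of_int N)) = 0"
  shows "(\<Sum>l\<in>L. cis (2 * pi * (of_int c * (real t * of_int l)) / of_int N)) = 0"
proof -
  define n where "n = nat N"
  have n: "n > 0" "int n = N" "real n = of_int N" using N by (simp_all add: n_def)
  define \<zeta> where "\<zeta> = cis (2 * pi / real n)"
  define f :: "int poly" where "f = (\<Sum>l\<in>L. monom 1 (nat (c * l mod N)))"
  have pow: "\<zeta> ^ k = cis (2 * pi * real k / real n)" for k
    unfolding \<zeta>_def Complex.DeMoivre by (simp add: mult.commute)
  have red: "cis (2 * pi * of_int (j * e) / of_int N) = cis (2 * pi * of_int (j * (e mod N)) / of_int N)" for j e :: int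
  proof -
    have "real_of_int e = of_int (e mod N) + of_int N * of_int (e div N)"
      by (simp only: of_int_mult[symmetric] of_int_add[symmetric] mod_mult_div_eq)
    then have "2 * pi * of_int (j * e) / of_int N = 2 * pi * of_int (j * (e mod N)) / of_int N + 2 * pi * of_int (j * (e div N))"
      using N by (simp add: field_simps)
    moreover have "cis (2 * pi * of_int (j * (e div N))) = 1" by (rule cis_multiple_2pi) simp
    ultimately show ?thesis by (simp only: cis_mult[symmetric] mult_1_right)
  qed
  have zN: "\<zeta> ^ n = 1" using n by (simp add: pow)
  have eval: "int_poly_eval f (\<zeta> ^ s) = (\<Sum>l\<in>L. cis (2 * pi * (of_int c * (real s * of_int l)) / of_int N))" for s
  proof -
    have "int_poly_eval f (\<zeta> ^ s) = (\<Sum>l\<in>L. \<zeta> ^ (s * nat (c * l mod N)))"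
      by (simp add: f_def power_mult)
    also have "\<dots> = (\<Sum>l\<in>L. cis (2 * pi * (of_int c * (real s * of_int l)) / of_int N))"
    proof (rule sum.cong[OF refl])
      fix l
      have "real (s * nat (c * l mod N)) = of_int (int s * (c * l mod N))"
        using N by simp
      then have "\<zeta> ^ (s * nat (c * l mod N)) = cis (2 * pi * of_int (int s * (c * l mod N)) / of_int N)"
        by (simp only: pow n)
      also have "\<dots> = cis (2 * pi * of_int (int s * (c * l)) / of_int N)" by (rule red[symmetric])
      also have "real_of_int (int s * (c * l)) = of_int c * (real s * of_int l)" by simp
      finally show "\<zeta> ^ (s * nat (c * l mod N)) = cis (2 * pi * (of_int c * (real s * of_int l)) / of_int N)" .
    qed
    finally show ?thesis .
  qed
  have "int_poly_eval f \<zeta> = 0" using eval[of 1] zero by simp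
  moreover have "coprime t n" using t(2) by (simp flip: n(2))
  ultimately have "int_poly_eval f (\<zeta> ^ t) = 0"
    by (intro root_of_unity_coprime_power[OF n(1) zN] t(1))
  then show ?thesis by (simp only: eval)
qed

text \<open>Orthogonality of rows gives vanishing sums, which survive coprime dilation. Translating
  the index set by one of its elements puts 0 into it and multiplies each sum by a unimodular
  constant. Distinct digits congruent modulo \<open>N\<close> would make every term of their row sum
  1.\<close>

lemma admissible_pair_spectrum:
  assumes "admissible_pair N B"
  obtains L where "finite L" "0 \<in> L" "card L = card B"
    "\<And>b b' t. b \<in> B \<Longrightarrow> b' \<in> B \<Longrightarrow> b \<noteq> b' \<Longrightarrow> t > 0 \<Longrightarrow> coprime (int t) N \<Longrightarrow>
      (\<Sum>l\<in>L. cis (- (2 * pi * of_int (b - b') * (real t * of_int l / of_int N)))) = 0"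
    "\<And>b b'. b \<in> B \<Longrightarrow> b' \<in> B \<Longrightarrow> b \<noteq> b' \<Longrightarrow> \<not> N dvd b - b'"
proof -
  have N: "N \<ge> 2" and B: "finite B" "card B \<ge> 2" using assms by (auto simp: admissible_pair_def)
  define q where "q = card B"
  obtain L :: "int set" where U: "unitary_matrix B L
        (\<lambda>b l. complex_of_real (1 / sqrt (real (card B)))
               * exp (- 2 * of_real pi * \<i> * of_int b * of_int l / of_int N))"
    using assms by (auto simp: admissible_pair_def)
  have L: "finite L" "card L = card B" using U by (auto simp: unitary_matrix_def)
  have row: "(\<Sum>l\<in>L. cis (- (2 * pi * of_int (b - b') * of_int l) / of_int N)) = 0"
    if b: "b \<in> B" "b' \<in> B" "b \<noteq> b'" for b b'
  proof -
    let ?u = "\<lambda>b l. complex_of_real (1 / sqrt (real q)) * exp (- 2 * of_real pi * \<i> * of_int b * of_int l / of_int N)"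
    have u: "?u b l = complex_of_real (1 / sqrt (real q)) * cis (- (2 * pi * of_int b * of_int l) / of_int N)" for b l
      by (simp add: cis_conv_exp mult_ac)
    have sq: "complex_of_real (sqrt (real q)) * complex_of_real (sqrt (real q)) = of_nat q"
      by (simp flip: of_real_mult)
    have "(\<Sum>l\<in>L. ?u b l * cnj (?u b' l)) = 0"
      using U b unfolding unitary_matrix_def q_def by auto
    moreover have "?u b l * cnj (?u b' l) = complex_of_real (1 / real q) * cis (- (2 * pi * of_int (b - b') * of_int l) / of_int N)" for l
    proof -
      have "?u b l * cnj (?u b' l) = complex_of_real (1 / sqrt (real q) * (1 / sqrt (real q))) *
        (cis (- (2 * pi * of_int b * of_int l) / of_int N) * cis ((2 * pi * of_int b' * of_int l) / of_int N))"
        unfolding u by (simp add: cis_cnj sq mult_ac)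
      also have "1 / sqrt (real q) * (1 / sqrt (real q)) = 1 / real q" by simp
      also have "cis (- (2 * pi * of_int b * of_int l) / of_int N) * cis ((2 * pi * of_int b' * of_int l) / of_int N) =
        cis (- (2 * pi * of_int (b - b') * of_int l) / of_int N)"
        unfolding cis_mult by (rule arg_cong[of _ _ cis]) (simp add: algebra_simps flip: add_divide_distrib diff_divide_distrib)
      finally show ?thesis .
    qed
    ultimately have "complex_of_real (1 / real q) * (\<Sum>l\<in>L. cis (- (2 * pi * of_int (b - b') * of_int l) / of_int N)) = 0"
      by (simp only: sum_distrib_left)
    then show ?thesis using B by (auto simp: q_def)
  qed
  have dil: "(\<Sum>l\<in>L. cis (- (2 * pi * of_int (b - b') * (real t * of_int l / of_int N)))) = 0"
    if b: "b \<in> B" "b' \<in> B" "b \<noteq> b'" and t: "t > 0" "coprime (int t) N" for b b' t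
  proof -
    have "(\<Sum>l\<in>L. cis (2 * pi * (of_int (b' - b) * (real t * of_int l)) / of_int N)) = 0"
    proof (rule sum_cis_coprime_dilation[OF L(1) _ t])
      show "N > 0" using N by simp
      show "(\<Sum>l\<in>L. cis (2 * pi * (of_int (b' - b) * of_int l) / of_int N)) = 0"
        using row[OF b] by (simp add: algebra_simps)
    qed
    then show ?thesis by (simp add: algebra_simps diff_divide_distrib)
  qed
  have distinct: "\<not> N dvd b - b'" if b: "b \<in> B" "b' \<in> B" "b \<noteq> b'" for b b'
  proof
    assume "N dvd b - b'"
    then obtain j where j: "b - b' = N * j" by blast
    have "cis (- (2 * pi * of_int (b - b') * of_int l) / of_int N) = 1" for l
    proof -
      have "- (2 * pi * of_int (b - b') * of_int l) / of_int N = 2 * pi * of_int (- (j * l))"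
        using N by (simp add: j)
      then show ?thesis using cis_multiple_2pi[of "of_int (- (j * l))"] by simp
    qed
    then have "of_nat (card L) = (0::complex)" using row[OF b] by simp
    then show False using L(2) B(2) by simp
  qed
  have "L \<noteq> {}" using L(2) B(2) by auto
  then obtain l0 where l0: "l0 \<in> L" by blast
  define L' where "L' = (\<lambda>l. l - l0) ` L"
  have inj: "inj_on (\<lambda>l. l - l0) L" by (auto intro!: inj_onI)
  show ?thesis
  proof (rule that[of L'])
    show "finite L'" using L by (simp add: L'_def)
    show "0 \<in> L'" using l0 by (force simp: L'_def)
    show "card L' = card B" using L(2) by (simp add: L'_def card_image[OF inj])
    show "(\<Sum>l\<in>L'. cis (- (2 * pi * of_int (b - b') * (real t * of_int l / of_int N)))) = 0"
      if b: "b \<in> B" "b' \<in> B" "b \<noteq> b'" and t: "t > 0" "coprime (int t) N" for b b' t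
    proof -
      have "(\<Sum>l\<in>L'. cis (- (2 * pi * of_int (b - b') * (real t * of_int l / of_int N)))) =
        (\<Sum>l\<in>L. cis (2 * pi * of_int (b - b') * (real t * of_int l0 / of_int N)) *
          cis (- (2 * pi * of_int (b - b') * (real t * of_int l / of_int N))))"
        unfolding L'_def sum.reindex[OF inj] o_def cis_mult
        by (intro sum.cong refl arg_cong[of _ _ cis]) (simp add: algebra_simps diff_divide_distrib)
      also have "\<dots> = 0" by (simp only: sum_distrib_left[symmetric] dil[OF b t] mult_zero_right)
      finally show ?thesis .
    qed
  qed (use distinct in blast)
qed

lemma spectral_sequence_of_admissible:
  fixes N :: "nat \<Rightarrow> int"
  assumes adm: "\<And>k. k \<in> {1..m} \<Longrightarrow> admissible_pair (N k) (B k)" and n: "\<And>k. n k > 0"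
    and \<omega>: "\<omega> \<in> seq_space m"
    and R: "\<And>k b. k \<in> {1..m} \<Longrightarrow> b \<in> B k \<Longrightarrow> \<bar>real_of_int b\<bar> \<le> R"
    and Q: "\<And>k. k \<in> {1..m} \<Longrightarrow> card (B k) \<le> Q"
    and E: "E = {t. t > 0 \<and> (\<forall>k\<in>{1..m}. coprime (int t) (N k))}"
  shows "residue_sequence (\<lambda>i. N (\<omega> i) ^ n i) (\<lambda>i. B (\<omega> i)) R Q"
    and "\<exists>L. spectral_sequence (\<lambda>i. N (\<omega> i) ^ n i) (\<lambda>i. B (\<omega> i)) R L E"
proof -
  have mem: "\<omega> i \<in> {1..m}" for i using \<omega> by (simp add: seq_space_def)
  have N2: "N (\<omega> i) \<ge> 2" and fin: "finite (B (\<omega> i))" and c2: "card (B (\<omega> i)) \<ge> 2" for i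
    using adm[OF mem[of i]] by (auto simp: admissible_pair_def)
  have dvd: "N (\<omega> i) dvd N (\<omega> i) ^ n i" for i using n[of i] by (simp add: dvd_power)
  define spec where "spec i L \<longleftrightarrow> finite L \<and> 0 \<in> L \<and> card L = card (B (\<omega> i)) \<and>
    (\<forall>b b' t. b \<in> B (\<omega> i) \<longrightarrow> b' \<in> B (\<omega> i) \<longrightarrow> b \<noteq> b' \<longrightarrow> t > 0 \<longrightarrow> coprime (int t) (N (\<omega> i)) \<longrightarrow>
      (\<Sum>l\<in>L. cis (- (2 * pi * of_int (b - b') * (real t * of_int l / of_int (N (\<omega> i)))))) = 0) \<and>
    (\<forall>b b'. b \<in> B (\<omega> i) \<longrightarrow> b' \<in> B (\<omega> i) \<longrightarrow> b \<noteq> b' \<longrightarrow> \<not> N (\<omega> i) dvd b - b')" for i and L :: "int set"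
  have "\<exists>L. spec i L" for i
    unfolding spec_def by (rule admissible_pair_spectrum[OF adm[OF mem[of i]]]) blast
  then obtain L where spec: "\<And>i. spec i (L i)" by metis
  have L: "finite (L i)" "0 \<in> L i" "card (L i) = card (B (\<omega> i))"
    "b \<in> B (\<omega> i) \<Longrightarrow> b' \<in> B (\<omega> i) \<Longrightarrow> b \<noteq> b' \<Longrightarrow> t > 0 \<Longrightarrow> coprime (int t) (N (\<omega> i)) \<Longrightarrow>
      (\<Sum>l\<in>L i. cis (- (2 * pi * of_int (b - b') * (real t * of_int l / of_int (N (\<omega> i)))))) = 0"
    "b \<in> B (\<omega> i) \<Longrightarrow> b' \<in> B (\<omega> i) \<Longrightarrow> b \<noteq> b' \<Longrightarrow> \<not> N (\<omega> i) dvd b - b'" for i b b' t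
    using spec[of i] unfolding spec_def by blast+
  have ds: "digit_sequence (\<lambda>i. N (\<omega> i) ^ n i) (\<lambda>i. B (\<omega> i)) R"
  proof
    fix i
    have "N (\<omega> i) ^ 1 \<le> N (\<omega> i) ^ n i" using N2[of i] n[of i] by (intro power_increasing) auto
    then show "N (\<omega> i) ^ n i \<ge> 2" using N2[of i] by simp
    show "finite (B (\<omega> i))" by (rule fin)
    show "B (\<omega> i) \<noteq> {}" using c2[of i] by auto
  qed (use R mem in blast)
  interpret digit_sequence "\<lambda>i. N (\<omega> i) ^ n i" "\<lambda>i. B (\<omega> i)" R by (rule ds)
  show "residue_sequence (\<lambda>i. N (\<omega> i) ^ n i) (\<lambda>i. B (\<omega> i)) R Q"
  proof
    show "\<not> N (\<omega> i) ^ n i dvd b - b'" if "b \<in> B (\<omega> i)" "b' \<in> B (\<omega> i)" "b \<noteq> b'" for i b b'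
      using L(5)[OF that] dvd_trans[OF dvd[of i], of "b - b'"] by blast
    show "card (B (\<omega> i)) \<le> Q" for i by (rule Q[OF mem])
  qed
  \<comment> \<open>The factor \<open>N ^ (n - 1)\<close> turns division by \<open>N ^ n\<close>
    into division by \<open>N\<close>, so a spectrum for \<open>N\<close> serves for the
    power.\<close>
  define L' where "L' i = (\<lambda>l. N (\<omega> i) ^ (n i - 1) * l) ` L i" for i
  have inj: "inj_on (\<lambda>l. N (\<omega> i) ^ (n i - 1) * l) (L i)" for i using N2[of i] by (auto intro!: inj_onI)
  have "spectral_sequence (\<lambda>i. N (\<omega> i) ^ n i) (\<lambda>i. B (\<omega> i)) R L' E"
  proof
    show "finite (L' i)" for i using L(1) by (simp add: L'_def)
    show "0 \<in> L' i" for i unfolding L'_def using L(2)[of i] by (intro image_eqI[of _ _ 0]) auto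
    show "1 \<in> E" "0 \<notin> E" by (simp_all add: E)
    fix i t y assume t: "t \<in> E"
    have e: "real t * of_int (N (\<omega> i) ^ (n i - 1) * l) / of_int (N (\<omega> i) ^ n i) = real t * of_int l / of_int (N (\<omega> i))" for l
    proof -
      have "N (\<omega> i) ^ n i = N (\<omega> i) ^ (n i - 1) * N (\<omega> i)" by (rule power_minus_mult[OF n, symmetric])
      then show ?thesis using N2[of i] by simp
    qed
    have "(\<Sum>l\<in>L' i. (cmod (mask (B (\<omega> i)) (of_real (y + real t * of_int l / of_int (N (\<omega> i) ^ n i)))))\<^sup>2) =
      (\<Sum>l\<in>L i. (cmod (mask (B (\<omega> i)) (of_real (y + real t * of_int l / of_int (N (\<omega> i))))))\<^sup>2)"
      unfolding L'_def by (rule sum.reindex_cong[OF inj refl]) (simp only: e)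
    also have "\<dots> = real (card (L i)) / real (card (B (\<omega> i)))"
    proof (rule sum_norm_mask_squared[OF finite_B B_nonempty])
      fix b b' assume "b \<in> B (\<omega> i)" "b' \<in> B (\<omega> i)" "b \<noteq> b'"
      then show "(\<Sum>l\<in>L i. cis (- (2 * pi * of_int (b - b') * (real t * of_int l / of_int (N (\<omega> i)))))) = 0"
        using t mem by (intro L(4)) (auto simp: E)
    qed
    also have "\<dots> = 1" using c2[of i] by (simp add: L(3))
    finally show "(\<Sum>l\<in>L' i. (cmod (mask (B (\<omega> i)) (of_real (y + real t * of_int l / of_int (N (\<omega> i) ^ n i)))))\<^sup>2) = 1" .
  qed
  then show "\<exists>L. spectral_sequence (\<lambda>i. N (\<omega> i) ^ n i) (\<lambda>i. B (\<omega> i)) R L E" by blast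
qed

text \<open>\<open>R\<close> and \<open>Q\<close> are chosen before the sequence and the exponents,
  so the same constants serve the given sequence, its shifts, their limits and all powers.\<close>

lemma admissible_sequences:
  fixes N :: "nat \<Rightarrow> int"
  assumes adm: "\<And>k. k \<in> {1..m} \<Longrightarrow> admissible_pair (N k) (B k)"
  shows "\<exists>R Q. \<forall>\<omega> n. \<omega> \<in> seq_space m \<longrightarrow> (\<forall>k. n k > 0) \<longrightarrow>
      residue_sequence (\<lambda>i. N (\<omega> i) ^ n i) (\<lambda>i. B (\<omega> i)) R Q \<and>
      (\<exists>L. spectral_sequence (\<lambda>i. N (\<omega> i) ^ n i) (\<lambda>i. B (\<omega> i)) R L
        {t. t > 0 \<and> (\<forall>k\<in>{1..m}. coprime (int t) (N k))})"
proof -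
  have finB: "finite (B k)" if "k \<in> {1..m}" for k using adm[OF that] by (simp add: admissible_pair_def)
  define R where "R = (\<Sum>k\<in>{1..m}. \<Sum>b\<in>B k. \<bar>real_of_int b\<bar>)"
  define Q where "Q = (\<Sum>k\<in>{1..m}. card (B k))"
  have R: "\<bar>real_of_int b\<bar> \<le> R" if "k \<in> {1..m}" "b \<in> B k" for k b
  proof -
    have "\<bar>real_of_int b\<bar> \<le> (\<Sum>b\<in>B k. \<bar>real_of_int b\<bar>)"
      using that finB by (intro member_le_sum) auto
    also have "\<dots> \<le> R" unfolding R_def
      using that(1) by (intro member_le_sum[of _ _ "\<lambda>k. \<Sum>b\<in>B k. \<bar>real_of_int b\<bar>"] sum_nonneg) auto
    finally show ?thesis .
  qed
  have Q: "card (B k) \<le> Q" if "k \<in> {1..m}" for k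
    unfolding Q_def using that by (intro member_le_sum) auto
  show ?thesis
  proof (intro exI[of _ R] exI[of _ Q] allI impI conjI)
    fix \<omega> and n :: "nat \<Rightarrow> nat" assume \<omega>: "\<omega> \<in> seq_space m" and n: "\<forall>k. n k > 0"
    show "residue_sequence (\<lambda>i. N (\<omega> i) ^ n i) (\<lambda>i. B (\<omega> i)) R Q"
      by (rule spectral_sequence_of_admissible(1)[OF _ _ \<omega> _ _ refl]) (use adm n R Q in auto)
    show "\<exists>L. spectral_sequence (\<lambda>i. N (\<omega> i) ^ n i) (\<lambda>i. B (\<omega> i)) R L
        {t. t > 0 \<and> (\<forall>k\<in>{1..m}. coprime (int t) (N k))}"
      by (rule spectral_sequence_of_admissible(2)[where Q = Q, OF _ _ \<omega> _ _ refl]) (use adm n R Q in auto)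
  qed
qed

lemma (in digit_sequence) is_spectrum_digit_measure:
  assumes S: "countable S"
    and orth: "\<And>s s'. s \<in> S \<Longrightarrow> s' \<in> S \<Longrightarrow> s \<noteq> s' \<Longrightarrow> mask_limit a B (s - s') = 0"
    and total: "\<And>x e. e > 0 \<Longrightarrow> \<exists>F. finite F \<and> F \<subseteq> S \<and> (\<Sum>s\<in>F. (cmod (mask_limit a B (s + x)))\<^sup>2) > 1 - e"
  shows "is_spectrum digit_measure S"
proof -
  interpret rd: real_distribution digit_measure using digit_measure_limit by blast
  show ?thesis
    by (rule rd.is_spectrumI[OF S AE_digit_measure]) (use orth total in \<open>simp_all add: char_digit_measure\<close>)
qed

lemma uncountable_common_spectra:
  fixes N :: "nat \<Rightarrow> int"
  assumes adm: "\<And>k. k \<in> {1..m} \<Longrightarrow> admissible_pair (N k) (B k)" and n: "\<And>k. n k > 0"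
    and \<omega>: "\<omega> \<in> seq_space m" and nd: "non_degenerate N B \<omega>"
  shows "uncountable {\<Lambda>. \<forall>t\<in>coprime_multipliers m N. is_spectrum (mu_conv N B n \<omega>) ((*) t ` \<Lambda>)}"
proof -
  define E where "E = {t::nat. t > 0 \<and> (\<forall>k\<in>{1..m}. coprime (int t) (N k))}"
  have E_eq: "coprime_multipliers m N = real ` E"
    by (simp add: coprime_multipliers_def E_def coprime_iff_gcd_eq_1)
  obtain R Q where seqs: "\<And>\<alpha> p. \<alpha> \<in> seq_space m \<Longrightarrow> (\<And>k. p k > 0) \<Longrightarrow>
      residue_sequence (\<lambda>i. N (\<alpha> i) ^ p i) (\<lambda>i. B (\<alpha> i)) R Q"
    "\<And>\<alpha> p. \<alpha> \<in> seq_space m \<Longrightarrow> (\<And>k. p k > 0) \<Longrightarrow>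
      \<exists>L. spectral_sequence (\<lambda>i. N (\<alpha> i) ^ p i) (\<lambda>i. B (\<alpha> i)) R L E"
    using admissible_sequences[of m N B, OF adm] unfolding E_def by blast
  define a where "a i = N (\<omega> i) ^ n i" for i
  define D where "D i = B (\<omega> i)" for i
  interpret rs: residue_sequence a D R Q
    unfolding a_def D_def by (rule seqs(1)[where p = n, OF \<omega> n])
  have "\<exists>L. spectral_sequence a D R L E"
    unfolding a_def D_def by (rule seqs(2)[where p = n, OF \<omega> n])
  then obtain L where "spectral_sequence a D R L E" by blast
  then interpret ss: spectral_sequence a D R L E .
  have mem: "\<omega> i \<in> {1..m}" for i using \<omega> by (simp add: seq_space_def)
  have N2: "N (\<omega> i) \<ge> 2" for i using adm[OF mem[of i]] by (simp add: admissible_pair_def)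
  have window: "\<exists>W. infinite {k. G \<le> card {j. j < W \<and> int (card (D (k + j))) < a (k + j)}}" for G
  proof -
    have "residue_sequence (\<lambda>i. N (\<alpha> i)) (\<lambda>i. B (\<alpha> i)) R Q" if "\<alpha> \<in> seq_space m" for \<alpha>
      using seqs(1)[where p = "\<lambda>_. 1", OF that] by simp
    then obtain W where W: "infinite {k. G \<le> card {j. j < W \<and> int (card (B (\<omega> (k + j)))) < N (\<omega> (k + j))}}"
      using window_of_non_degenerate[OF \<omega> _ nd] by blast
    \<comment> \<open>Non-degeneracy speaks of the exponent 1; a digit set that is too small for
      \<open>N\<close> is also too small for the power.\<close>
    have le: "N (\<omega> i) \<le> a i" for i
      using power_increasing[of 1 "n i" "N (\<omega> i)"] n[of i] N2[of i] by (simp add: a_def)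
    have "{k. G \<le> card {j. j < W \<and> int (card (B (\<omega> (k + j)))) < N (\<omega> (k + j))}} \<subseteq>
      {k. G \<le> card {j. j < W \<and> int (card (D (k + j))) < a (k + j)}}"
    proof clarify
      fix k assume "G \<le> card {j. j < W \<and> int (card (B (\<omega> (k + j)))) < N (\<omega> (k + j))}"
      also have "\<dots> \<le> card {j. j < W \<and> int (card (D (k + j))) < a (k + j)}"
      proof (rule card_mono)
        show "{j. j < W \<and> int (card (B (\<omega> (k + j)))) < N (\<omega> (k + j))} \<subseteq> {j. j < W \<and> int (card (D (k + j))) < a (k + j)}"
          using le by (auto simp: D_def intro: less_le_trans)
      qed simp
      finally show "G \<le> card {j. j < W \<and> int (card (D (k + j))) < a (k + j)}" .
    qed
    then show ?thesis using W finite_subset by blast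
  qed
  have coprime_a: "coprime (int t) (a i)" if "t \<in> E" for t i
    using that mem[of i] by (auto simp: E_def a_def)
  have equi: "\<exists>K \<epsilon>. infinite K \<and> \<epsilon> > 0 \<and>
    (\<forall>k\<in>K. \<forall>x. \<exists>\<kappa>::int. \<epsilon> < cmod (mask_limit (\<lambda>j. a (k + j)) (\<lambda>j. D (k + j)) (x + real t * of_int \<kappa>)))"
    if t: "t \<in> E" for t
  proof -
    have t0: "t > 0" using t by (simp add: E_def)
    obtain K \<epsilon> where "infinite K" "\<epsilon> > 0"
      "\<And>k x. k \<in> K \<Longrightarrow> \<exists>\<kappa>::int. \<epsilon> < cmod (mask_limit (\<lambda>j. a (k + j)) (\<lambda>j. D (k + j)) (x + real t * of_int \<kappa>))"
      by (rule rs.equipositive[OF t0 coprime_a[OF t] window]) (rule that)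
    then show ?thesis by blast
  qed
  obtain \<Lambda> :: "int set" where
    orth: "\<And>t \<nu> \<nu>'. t \<in> E \<Longrightarrow> \<nu> \<in> \<Lambda> \<Longrightarrow> \<nu>' \<in> \<Lambda> \<Longrightarrow> \<nu> \<noteq> \<nu>' \<Longrightarrow> mask_limit a D (real t * of_int (\<nu> - \<nu>')) = 0"
    and total: "\<And>t x e. t \<in> E \<Longrightarrow> e > 0 \<Longrightarrow> \<exists>F. finite F \<and> F \<subseteq> \<Lambda> \<and>
       (\<Sum>\<nu>\<in>F. (cmod (mask_limit a D (x + real t * of_int \<nu>)))\<^sup>2) > 1 - e"
    by (rule ss.common_spectrum[OF equi]) (assumption, rule that)
  \<comment> \<open>Translates are again common spectra, because differences are unchanged and
    \<open>total\<close> holds at every \<open>x\<close>. Each translate is countable while together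
    they cover the real line, so uncountably many of them are different.\<close>
  define T where "T u = (\<lambda>\<nu>. u + real_of_int \<nu>) ` \<Lambda>" for u
  have mu: "mu_conv N B n \<omega> = rs.digit_measure"
    unfolding a_def D_def
    by (rule mu_conv_eq_digit_measure) (rule rs.digit_sequence_axioms[unfolded a_def D_def])
  have spec: "is_spectrum (mu_conv N B n \<omega>) ((*) (real t) ` T u)" if t: "t \<in> E" for t u
  proof -
    have t0: "t > 0" using t by (simp add: E_def)
    define g where "g \<nu> = real t * (u + real_of_int \<nu>)" for \<nu>
    have img: "(*) (real t) ` T u = g ` \<Lambda>" by (auto simp: T_def g_def)
    have inj: "inj g" using t0 by (auto intro!: injI simp: g_def)
    show ?thesis unfolding mu img
    proof (rule rs.is_spectrum_digit_measure)
      show "countable (g ` \<Lambda>)" by simp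
      fix s s' assume "s \<in> g ` \<Lambda>" "s' \<in> g ` \<Lambda>" "s \<noteq> s'"
      then obtain \<nu> \<nu>' where "\<nu> \<in> \<Lambda>" "\<nu>' \<in> \<Lambda>" "s = g \<nu>" "s' = g \<nu>'" "\<nu> \<noteq> \<nu>'" by blast
      moreover have "g \<nu> - g \<nu>' = real t * of_int (\<nu> - \<nu>')" by (simp add: g_def algebra_simps)
      ultimately show "mask_limit a D (s - s') = 0" using orth[OF t] by metis
    next
      fix x e :: real assume "e > 0"
      then obtain F where F: "finite F" "F \<subseteq> \<Lambda>"
        "(\<Sum>\<nu>\<in>F. (cmod (mask_limit a D ((x + real t * u) + real t * of_int \<nu>)))\<^sup>2) > 1 - e"
        using total[OF t] by blast
      have "(\<Sum>s\<in>g ` F. (cmod (mask_limit a D (s + x)))\<^sup>2) =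
        (\<Sum>\<nu>\<in>F. (cmod (mask_limit a D ((x + real t * u) + real t * of_int \<nu>)))\<^sup>2)"
        by (rule sum.reindex_cong[OF inj_on_subset[OF inj subset_UNIV] refl]) (simp add: g_def algebra_simps)
      then show "\<exists>F. finite F \<and> F \<subseteq> g ` \<Lambda> \<and> (\<Sum>s\<in>F. (cmod (mask_limit a D (s + x)))\<^sup>2) > 1 - e"
        using F by (intro exI[of _ "g ` F"]) auto
    qed
  qed
  have "\<Lambda> \<noteq> {}"
  proof
    assume "\<Lambda> = {}"
    with total[OF ss.one_in_E, of 1 0] show False by auto
  qed
  then obtain \<nu>0 where \<nu>0: "\<nu>0 \<in> \<Lambda>" by blast
  have "uncountable (range T)"
  proof
    assume "countable (range T)"
    then have "countable (\<Union>X\<in>range T. X)"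
      by (rule countable_UN) (auto simp: T_def)
    moreover have "x \<in> (\<Union>X\<in>range T. X)" for x
    proof -
      have "x \<in> T (x - of_int \<nu>0)" unfolding T_def using \<nu>0 by (intro image_eqI[of _ _ \<nu>0]) auto
      then show ?thesis by blast
    qed
    then have "(\<Union>X\<in>range T. X) = UNIV" by blast
    ultimately show False using uncountable_UNIV_real by simp
  qed
  moreover have "range T \<subseteq> {\<Lambda>. \<forall>t\<in>coprime_multipliers m N. is_spectrum (mu_conv N B n \<omega>) ((*) t ` \<Lambda>)}"
    using spec by (auto simp: E_eq)
  ultimately show ?thesis using countable_subset by blast
qed

theorem theorem1p5:
  fixes m :: nat
    and N :: "nat \<Rightarrow> int"
    and B :: "nat \<Rightarrow> int set"
    and n :: "nat \<Rightarrow> nat"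
    and P :: "(nat \<Rightarrow> nat) measure"
  assumes "\<And>k. k \<in> {1..m} \<Longrightarrow> admissible_pair (N k) (B k)"
    and "\<And>k. n k > 0"
    and "prob_space P"
    and "sets P = sets (seq_borel m)"
    and "AE \<omega> in P. non_degenerate N B \<omega>"
  shows "spectral_random_measure P (mu_conv N B n) \<and>
    aleph1_spectral_eigen_set P (mu_conv N B n) (coprime_multipliers m N)"
proof -
  obtain R Q where "\<And>\<omega> p. \<omega> \<in> seq_space m \<Longrightarrow> (\<And>k. p k > 0) \<Longrightarrow>
      residue_sequence (\<lambda>i. N (\<omega> i) ^ p i) (\<lambda>i. B (\<omega> i)) R Q"
    using admissible_sequences[of m N B, OF assms(1)] by blast
  then have ds: "digit_sequence (\<lambda>i. N (\<omega> i) ^ n i) (\<lambda>i. B (\<omega> i)) R" if "\<omega> \<in> seq_space m" for \<omega>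
    using that assms(2) by (intro residue_sequence.axioms(1)[where Q = Q]) blast
  have rd: "real_distribution (mu_conv N B n \<omega>)" if "\<omega> \<in> seq_space m" for \<omega>
    using digit_sequence.digit_measure_limit[OF ds[OF that]] mu_conv_eq_digit_measure[of N \<omega> n B R] ds[OF that]
    by simp
  have space_P: "space P = seq_space m"
    using sets_eq_imp_space_eq[OF assms(4)] by (simp add: space_seq_borel)
  have unc: "AE \<omega> in P. uncountable {\<Lambda>. \<forall>t\<in>coprime_multipliers m N. is_spectrum (mu_conv N B n \<omega>) ((*) t ` \<Lambda>)}"
    using assms(5) AE_space
    by eventually_elim (rule uncountable_common_spectra[OF assms(1,2)], auto simp: space_P)
  have one: "1 \<in> coprime_multipliers m N"
    unfolding coprime_multipliers_def by (intro image_eqI[of _ _ 1]) auto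
  have "AE \<omega> in P. spectral_measure (mu_conv N B n \<omega>)"
    using unc AE_space
  proof eventually_elim
    case (elim \<omega>)
    \<comment> \<open>Any member of the uncountable family, dilated by 1, is a spectrum of the
      measure.\<close>
    have "{\<Lambda>. \<forall>t\<in>coprime_multipliers m N. is_spectrum (mu_conv N B n \<omega>) ((*) t ` \<Lambda>)} \<noteq> {}"
      using elim(1) by (metis countable_empty)
    then show ?case using elim(2) rd one by (auto simp: spectral_measure_def space_P)
  qed
  moreover have "random_measure P (mu_conv N B n)"
    by (rule random_measure_mu_conv[OF assms(4)]) (rule ds)
  ultimately show ?thesis using unc one
    by (simp add: spectral_random_measure_def aleph1_spectral_eigen_set_def)
qed

end
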